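(* Consider, on $\mathcal{S}\times\mathcal{G}$, the continuous-time best response dynamics $$\dot{\mathbf{U}}(\lambda)\in \mathrm{BR}_1(\boldsymbol{\Sigma}(\lambda))-\mathbf{U}(\lambda),\qquad \dot{\boldsymbol{\Sigma}}(\lambda)\in \mathrm{BR}_2(\mathbf{U}(\lambda))-\boldsymbol{\Sigma}(\lambda),$$ with all objects as in the context. Then: (i) The dynamics have a solution for every initial condition $(\mathbf{U}(0),\boldsymbol{\Sigma}(0))\in\mathcal{S}\times\mathcal{G}$. (ii) Along every solution, $v(\lambda):=\Phi(\mathbf{U}(\lambda),\boldsymbol{\Sigma}(\lambda))$ is a Lyapunov function with $\dot v(\lambda)\le -v(\lambda)$ for almost all $\lambda$, hence $v(\lambda)\le e^{-\lambda}v(0)$. Thus the zero-sum game has a value, i.e. $\max_{\boldsymbol{\Sigma}\in\mathcal{G}}\mathcal{C}(\boldsymbol{\Sigma})=\min_{\mathbf{U}}\mathcal{A}(\mathbf{U})$, and every solution converges to the non-empty set of saddle points of $\mathcal{J}$, which is a uniform global attractor for the dynamics.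
   Context: System: $x_{t+1}=Ax_t+Bu_t+w_t$, $y_t=Cx_t+v_t$, $t=0,\dots,T-1$, with $x_t\in\mathbb{R}^n$, $u_t\in\mathbb{R}^m$, $y_t\in\mathbb{R}^p$; weights $Q,Q_T\in\mathbb{S}^n_+$ (positive semidefinite), $R\in\mathbb{S}^m_{++}$ (positive definite). Stacked matrices: $\mathbf{Q}=\mathrm{diag}(Q,\dots,Q,Q_T)\in\mathbb{S}_+^{n(T+1)}$, $\mathbf{R}=\mathrm{diag}(R,\dots,R)\in\mathbb{S}_{++}^{mT}$; $\mathbf{C}\in\mathbb{R}^{pT\times n(T+1)}$ is block diagonal with blocks $C$, followed by a zero last block column; $\mathbf{G}\in\mathbb{R}^{n(T+1)\times n(T+1)}$ has $(t,s)$ block $A^{t-s}$ for $0\le s\le t\le T$ and $0$ otherwise; $\mathbf{H}\in\mathbb{R}^{n(T+1)\times mT}$ has $(t,s)$ block $A^{t-1-s}B$ for $0\le s<t\le T$ and $0$ otherwise; $\mathbf{D}=\mathbf{C}\mathbf{G}$. Minimizing player: $\mathbf{U}$ ranges over the linear space $\mathcal{L}\subseteq\mathbb{R}^{mT\times pT}$ of block lower triangular matrices (blocks of size $m\times p$), corresponding to causal linear policies $\mathbf{u}=\mathbf{U}\boldsymbol{\eta}$ in the purified observations $\boldsymbol{\eta}=\mathbf{D}\mathbf{w}+\mathbf{v}$. Maximizing player: $\mathcal{G}$ is the set of $\boldsymbol{\Sigma}=\mathrm{diag}(\mathbf{W},\mathbf{V})$, $\mathbf{W}=\mathrm{diag}(W_0,\dots,W_T)$,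 $\mathbf{V}=\mathrm{diag}(V_0,\dots,V_{T-1})$, with $W_t\in\mathbb{S}^n_{++}$, $V_t\in\mathbb{S}^p_{++}$ satisfying $\frac12(\mathrm{Tr}(\hat W_t^{-1}W_t)-n+\log\frac{\det\hat W_t}{\det W_t})\le\rho_{w_t}$ for $t=0,\dots,T$ and $\frac12(\mathrm{Tr}(\hat V_t^{-1}V_t)-p+\log\frac{\det\hat V_t}{\det V_t})\le\rho_{v_t}$ for $t=0,\dots,T-1$. Here $\hat W_t,\hat V_t\succ0$ and the radii $\rho_{w_t},\rho_{v_t}\ge0$ are given (index shifted by one for $W$, so that $W_0$ is the covariance of $x_0$). These are the covariances of the zero-mean Gaussian distributions in a Kullback–Leibler ball around the nominal Gaussians. Payoff: $\mathcal{J}(\mathbf{U},\boldsymbol{\Sigma})=\mathrm{Tr}(\mathbf{F}_1(\mathbf{U})\mathbf{W})+\mathrm{Tr}(\mathbf{F}_2(\mathbf{U})\mathbf{V})$ with $\mathbf{F}_1(\mathbf{U})=\mathbf{D}^\top\mathbf{U}^\top\mathbf{R}\mathbf{U}\mathbf{D}+(\mathbf{H}\mathbf{U}\mathbf{D}+\mathbf{G})^\top\mathbf{Q}(\mathbf{H}\mathbf{U}\mathbf{D}+\mathbf{G})$ and $\mathbf{F}_2(\mathbf{U})=\mathbf{U}^\top\mathbf{R}\mathbf{U}+\mathbf{U}^\top\mathbf{H}^\top\mathbf{Q}\mathbf{H}\mathbf{U}$. Set $\mathcal{A}(\mathbf{U})=\max_{\boldsymbol{\Sigma}\in\mathcal{G}}\mathcal{J}(\mathbf{U},\boldsymbol{\Sigma})$,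 $\mathcal{C}(\boldsymbol{\Sigma})=\min_{\mathbf{U}\in\mathcal{L}}\mathcal{J}(\mathbf{U},\boldsymbol{\Sigma})$, and $\Phi(\mathbf{U},\boldsymbol{\Sigma})=\mathcal{A}(\mathbf{U})-\mathcal{C}(\boldsymbol{\Sigma})\ge0$. Then $\Phi(\mathbf{U},\boldsymbol{\Sigma})=0$ if and only if $(\mathbf{U},\boldsymbol{\Sigma})$ is a saddle point of $\mathcal{J}$ (min in $\mathbf{U}$, max in $\boldsymbol{\Sigma}$). Best responses: $\mathrm{BR}_1(\boldsymbol{\Sigma})=\operatorname{argmin}_{\mathbf{U}\in\mathcal{L}}\mathcal{J}(\mathbf{U},\boldsymbol{\Sigma})$, $\mathrm{BR}_2(\mathbf{U})=\operatorname{argmax}_{\boldsymbol{\Sigma}\in\mathcal{G}}\mathcal{J}(\mathbf{U},\boldsymbol{\Sigma})$ (set-valued). $\mathcal{S}\subseteq\mathcal{L}$ is a compact convex set, independent of $\boldsymbol{\Sigma}$, such that $\mathrm{BR}_1(\boldsymbol{\Sigma})=\operatorname{argmin}_{\mathbf{U}\in\mathcal{S}}\mathcal{J}(\mathbf{U},\boldsymbol{\Sigma})$ for all $\boldsymbol{\Sigma}\in\mathcal{G}$ (such a set exists). A solution is an absolutely continuous curve $[0,\infty)\to\mathcal{S}\times\mathcal{G}$ satisfying the differential inclusion for almost all $\lambda$. "Uniform global attractor" means: for every $\varepsilon>0$ there is $\Lambda$ such that every solution starting in $\mathcal{S}\times\mathcal{G}$ is within distance $\varepsilon$ of the set of saddle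 points for all $\lambda\ge\Lambda$. *)

theory Defs
  imports "HOL-Analysis.Analysis" "HOL-Library.Option_ord"
begin

section \<open>Matrices\<close>

definition psd :: "real^'n^'n \<Rightarrow> bool" where
  "psd A \<longleftrightarrow> transpose A = A \<and> (\<forall>x. 0 \<le> x \<bullet> (A *v x))"

definition pd :: "real^'n^'n \<Rightarrow> bool" where
  "pd A \<longleftrightarrow> transpose A = A \<and> (\<forall>x. x \<noteq> 0 \<longrightarrow> 0 < x \<bullet> (A *v x))"

text \<open>The overloaded power on \<open>real^'n^'n\<close> is componentwise, so matrix powers are defined
  separately.\<close>

definition mat_power :: "real^'n^'n \<Rightarrow> nat \<Rightarrow> real^'n^'n" where
  "mat_power A k = (((**) A) ^^ k) (mat 1)"

text \<open>A stacked matrix has indices \<open>(i, t)\<close> with \<open>i\<close> a coordinate and \<open>t\<close> an element of a finite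
  linear order. Blocks are numbered from 0 by the rank of \<open>t\<close>. With horizon \<open>T = CARD('t)\<close>, the
  type \<open>'t\<close> carries the times \<open>0, \<dots>, T - 1\<close>, and \<open>'t option\<close> (linearly ordered, one
  more element) carries the times \<open>0, \<dots>, T\<close>.\<close>

definition time :: "'t::{finite,linorder} \<Rightarrow> nat" where
  "time t = card {s. s < t}"

definition block_mat ::
  "(nat \<Rightarrow> nat \<Rightarrow> real^'b^'a) \<Rightarrow> real^('b \<times> 's::{finite,linorder})^('a \<times> 'r::{finite,linorder})" where
  "block_mat F = (\<chi> i j. F (time (snd i)) (time (snd j)) $ fst i $ fst j)"

definition block_diag ::
  "(nat \<Rightarrow> real^'b^'a) \<Rightarrow> real^('b \<times> 's::{finite,linorder})^('a \<times> 'r::{finite,linorder})" where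
  "block_diag F = block_mat (\<lambda>t s. if t = s then F t else 0)"

definition diag2 :: "real^'a::finite^'a \<Rightarrow> real^'b::finite^'b \<Rightarrow> real^('a + 'b)^('a + 'b)" where
  "diag2 X Y = (\<chi> i j. case (i, j) of
     (Inl a, Inl a') \<Rightarrow> X $ a $ a' | (Inr b, Inr b') \<Rightarrow> Y $ b $ b' | _ \<Rightarrow> 0)"

definition upper_block :: "real^('a::finite + 'b::finite)^('a + 'b) \<Rightarrow> real^'a^'a" where
  "upper_block M = (\<chi> i j. M $ Inl i $ Inl j)"

definition lower_block :: "real^('a::finite + 'b::finite)^('a + 'b) \<Rightarrow> real^'b^'b" where
  "lower_block M = (\<chi> i j. M $ Inr i $ Inr j)"

text \<open>Kullback--Leibler divergence of \<open>N(0, X)\<close> from the nominal \<open>N(0, Xhat)\<close>.\<close>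

definition kl_gauss :: "real^'n^'n \<Rightarrow> real^'n^'n \<Rightarrow> real" where
  "kl_gauss X Xhat =
     1/2 * (trace (matrix_inv Xhat ** X) - real CARD('n) + ln (det Xhat / det X))"

section \<open>The game\<close>

text \<open>The families \<open>What\<close>, \<open>rho_w\<close> are used at \<open>0, \<dots>, T\<close> and \<open>Vhat\<close>, \<open>rho_v\<close> at
  \<open>0, \<dots>, T - 1\<close>; \<open>What 0\<close> is the nominal covariance of the initial state.\<close>

record ('n, 'm, 'p) lqg =
  Amat :: "real^'n^'n"
  Bmat :: "real^'m^'n"
  Cmat :: "real^'n^'p"
  Qmat :: "real^'n^'n"
  QTmat :: "real^'n^'n"
  Rmat :: "real^'m^'m"
  What :: "nat \<Rightarrow> real^'n^'n"
  Vhat :: "nat \<Rightarrow> real^'p^'p"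
  rho_w :: "nat \<Rightarrow> real"
  rho_v :: "nat \<Rightarrow> real"

type_synonym ('m, 'p, 't) gain = "real^('p \<times> 't)^('m \<times> 't)"

type_synonym ('n, 'p, 't) cov =
  "real^(('n \<times> 't option) + ('p \<times> 't))^(('n \<times> 't option) + ('p \<times> 't))"

definition stackQ :: "('n::finite, 'm::finite, 'p::finite) lqg
    \<Rightarrow> real^('n \<times> 't::{finite,linorder} option)^('n \<times> 't option)" where
  "stackQ P = block_diag (\<lambda>t. if t = CARD('t) then QTmat P else Qmat P)"

definition stackR :: "('n::finite, 'm::finite, 'p::finite) lqg
    \<Rightarrow> real^('m \<times> 't::{finite,linorder})^('m \<times> 't)" where
  "stackR P = block_diag (\<lambda>t. Rmat P)"

text \<open>Row blocks are numbered \<open>0, \<dots>, T - 1\<close> and column blocks \<open>0, \<dots>, T\<close>, so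
  the last block column is zero.\<close>

definition stackC :: "('n::finite, 'm::finite, 'p::finite) lqg
    \<Rightarrow> real^('n \<times> 't::{finite,linorder} option)^('p \<times> 't)" where
  "stackC P = block_diag (\<lambda>t. Cmat P)"

definition stackG :: "('n::finite, 'm::finite, 'p::finite) lqg
    \<Rightarrow> real^('n \<times> 't::{finite,linorder} option)^('n \<times> 't option)" where
  "stackG P = block_mat (\<lambda>t s. if s \<le> t then mat_power (Amat P) (t - s) else 0)"

definition stackH :: "('n::finite, 'm::finite, 'p::finite) lqg
    \<Rightarrow> real^('m \<times> 't::{finite,linorder})^('n \<times> 't option)" where
  "stackH P = block_mat (\<lambda>t s. if s < t then mat_power (Amat P) (t - 1 - s) ** Bmat P else 0)"

definition stackD :: "('n::finite, 'm::finite, 'p::finite) lqg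
    \<Rightarrow> real^('n \<times> 't::{finite,linorder} option)^('p \<times> 't)" where
  "stackD P = stackC P ** stackG P"

definition causal_gains :: "('m::finite, 'p::finite, 't::{finite,linorder}) gain set" where
  "causal_gains = {U. \<forall>i j t s. t < s \<longrightarrow> U $ (i, t) $ (j, s) = 0}"

definition kl_ball :: "('n::finite, 'm::finite, 'p::finite) lqg
    \<Rightarrow> ('n, 'p, 't::{finite,linorder}) cov set" where
  "kl_ball P = {diag2 (block_diag W) (block_diag V) | W V.
     (\<forall>t\<le>CARD('t). pd (W t) \<and> kl_gauss (W t) (What P t) \<le> rho_w P t) \<and>
     (\<forall>t<CARD('t). pd (V t) \<and> kl_gauss (V t) (Vhat P t) \<le> rho_v P t)}"

definition F1 :: "('n::finite, 'm::finite, 'p::finite) lqg \<Rightarrow> ('m, 'p, 't::{finite,linorder}) gain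
    \<Rightarrow> real^('n \<times> 't option)^('n \<times> 't option)" where
  "F1 P U = transpose (stackD P) ** transpose U ** stackR P ** U ** stackD P
     + transpose (stackH P ** U ** stackD P + stackG P) ** stackQ P
         ** (stackH P ** U ** stackD P + stackG P)"

definition F2 :: "('n::finite, 'm::finite, 'p::finite) lqg \<Rightarrow> ('m, 'p, 't::{finite,linorder}) gain
    \<Rightarrow> real^('p \<times> 't)^('p \<times> 't)" where
  "F2 P U = transpose U ** stackR P ** U
     + transpose U ** transpose (stackH P) ** stackQ P ** stackH P ** U"

definition payoff :: "('n::finite, 'm::finite, 'p::finite) lqg
    \<Rightarrow> ('m, 'p, 't::{finite,linorder}) gain \<Rightarrow> ('n, 'p, 't) cov \<Rightarrow> real" where
  "payoff P U \<Sigma> = trace (F1 P U ** upper_block \<Sigma>) + trace (F2 P U ** lower_block \<Sigma>)"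

definition worst_cost :: "('n::finite, 'm::finite, 'p::finite) lqg
    \<Rightarrow> ('m, 'p, 't::{finite,linorder}) gain \<Rightarrow> real" where
  "worst_cost P U = (GREATEST c. c \<in> (\<lambda>\<Sigma>. payoff P U \<Sigma>) ` kl_ball P)"

definition best_cost :: "('n::finite, 'm::finite, 'p::finite) lqg
    \<Rightarrow> ('n, 'p, 't::{finite,linorder}) cov \<Rightarrow> real" where
  "best_cost P \<Sigma> = (LEAST c. c \<in> (\<lambda>U. payoff P U \<Sigma>) ` causal_gains)"

definition duality_gap :: "('n::finite, 'm::finite, 'p::finite) lqg
    \<Rightarrow> ('m, 'p, 't::{finite,linorder}) gain \<Rightarrow> ('n, 'p, 't) cov \<Rightarrow> real" where
  "duality_gap P U \<Sigma> = worst_cost P U - best_cost P \<Sigma>"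

definition saddle_points :: "('n::finite, 'm::finite, 'p::finite) lqg
    \<Rightarrow> (('m, 'p, 't::{finite,linorder}) gain \<times> ('n, 'p, 't) cov) set" where
  "saddle_points P = {(U, \<Sigma>). U \<in> causal_gains \<and> \<Sigma> \<in> kl_ball P \<and>
     (\<forall>U'\<in>causal_gains. payoff P U \<Sigma> \<le> payoff P U' \<Sigma>) \<and>
     (\<forall>\<Sigma>'\<in>kl_ball P. payoff P U \<Sigma>' \<le> payoff P U \<Sigma>)}"

definition BR1 :: "('n::finite, 'm::finite, 'p::finite) lqg
    \<Rightarrow> ('n, 'p, 't::{finite,linorder}) cov \<Rightarrow> ('m, 'p, 't) gain set" where
  "BR1 P \<Sigma> = {U. is_arg_min (\<lambda>U. payoff P U \<Sigma>) (\<lambda>U. U \<in> causal_gains) U}"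

definition BR2 :: "('n::finite, 'm::finite, 'p::finite) lqg
    \<Rightarrow> ('m, 'p, 't::{finite,linorder}) gain \<Rightarrow> ('n, 'p, 't) cov set" where
  "BR2 P U = {\<Sigma>. is_arg_max (\<lambda>\<Sigma>. payoff P U \<Sigma>) (\<lambda>\<Sigma>. \<Sigma> \<in> kl_ball P) \<Sigma>}"

section \<open>Best response dynamics\<close>

definition abs_cont_on :: "real \<Rightarrow> real \<Rightarrow> (real \<Rightarrow> 'a::metric_space) \<Rightarrow> bool" where
  "abs_cont_on a b f \<longleftrightarrow> (\<forall>\<epsilon>>0. \<exists>\<delta>>0. \<forall>D. finite D \<and>
     (\<forall>(s, t)\<in>D. a \<le> s \<and> s \<le> t \<and> t \<le> b) \<and>
     pairwise (\<lambda>I J. {fst I<..<snd I} \<inter> {fst J<..<snd J} = {}) D \<and>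
     (\<Sum>(s, t)\<in>D. t - s) < \<delta> \<longrightarrow> (\<Sum>(s, t)\<in>D. dist (f s) (f t)) < \<epsilon>)"

text \<open>Absolute continuity on the unbounded interval \<open>[0, \<infinity>)\<close> is understood on every compact
  subinterval.\<close>

definition abs_cont_halfline :: "(real \<Rightarrow> 'a::metric_space) \<Rightarrow> bool" where
  "abs_cont_halfline f \<longleftrightarrow> (\<forall>b\<ge>0. abs_cont_on 0 b f)"

definition br_solution :: "('n::finite, 'm::finite, 'p::finite) lqg
    \<Rightarrow> ('m, 'p, 't::{finite,linorder}) gain set
    \<Rightarrow> (real \<Rightarrow> ('m, 'p, 't) gain) \<Rightarrow> (real \<Rightarrow> ('n, 'p, 't) cov) \<Rightarrow> bool" where
  "br_solution P S U \<Sigma> \<longleftrightarrow>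
     (\<forall>l\<ge>0. U l \<in> S \<and> \<Sigma> l \<in> kl_ball P) \<and>
     abs_cont_halfline U \<and> abs_cont_halfline \<Sigma> \<and>
     (AE l in lborel. 0 \<le> l \<longrightarrow> (\<exists>U' \<Sigma>'.
        (U has_vector_derivative U') (at l within {0..}) \<and>
        (\<Sigma> has_vector_derivative \<Sigma>') (at l within {0..}) \<and>
        U' \<in> (\<lambda>X. X - U l) ` BR1 P (\<Sigma> l) \<and>
        \<Sigma>' \<in> (\<lambda>X. X - \<Sigma> l) ` BR2 P (U l)))"

end

theory Submission
  imports Defs "HOL-Complex_Analysis.Great_Picard"
begin

text \<open>
  The theorem is an instance of a general fact about zero-sum games. Let \<open>S\<close> and \<open>G\<close> be
  non-empty compact convex sets and let \<open>J\<close> be Lipschitz on \<open>S \<times> G\<close>, convex in its first and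
  concave in its second argument. Write \<open>A x\<close> for the maximum of \<open>J x y\<close> over \<open>y\<close>, \<open>C y\<close> for
  the minimum over \<open>x\<close>, and \<open>v = A (x l) - C (y l)\<close> along a solution of the best response
  dynamics, so that \<open>x' = xs - x\<close> and \<open>y' = ys - y\<close> with best replies \<open>xs\<close> to \<open>y\<close> and \<open>ys\<close> to
  \<open>x\<close>. The function \<open>A (x m) - J (x m) ys\<close> of \<open>m\<close> is non-negative and vanishes at \<open>m = l\<close>, so the
  derivative of \<open>A (x l)\<close> is that of \<open>J (x l) ys\<close> with \<open>ys\<close> held fixed. By convexity it is at most
  \<open>J xs ys - J x ys = J xs ys - A x\<close>. Symmetrically the derivative of \<open>C (y l)\<close> is at least
  \<open>J xs ys - C y\<close>, and subtracting gives \<open>v' \<le> - v\<close> (\<open>upper_derivative_le\<close>, \<open>gap_lyapunov\<close>).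

  All remaining assertions follow from this inequality and from the existence of solutions. The
  gap is continuous, non-negative, and zero exactly at the saddle points. Along any solution it
  tends to zero, so its minimum over the compact set \<open>S \<times> G\<close> is zero: a saddle point exists, without
  an appeal to a minimax theorem. As the gap is bounded, its decay is uniform over all solutions,
  and a compactness argument turns a small gap into a small distance from the saddle points.

  Best replies are set-valued and in general have no continuous selection: the worst covariance need
  not be unique where a block of the cost matrix vanishes. Solutions are therefore obtained as limits of Euler
  steps (\<open>best_reply_inclusion_solution\<close>). The limit is Lipschitz; at each of its points of
  differentiability, difference quotients of the approximations are averages of velocities that lie
  close to the convex set of admissible ones, so its derivative is admissible. Two facts of real
  analysis complete this part: a Lipschitz curve is differentiable almost everywhere
  (\<open>lipschitz_ae_differentiable\<close>), and an absolutely continuous function whose derivative is almost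
  everywhere bounded above grows at most at that rate (\<open>abs_cont_deriv_bound\<close>).

  It remains to see that the control problem is such a game. The payoff is linear in the
  covariance, and in the gain it is a sum of terms \<open>trace (Z\<^sup>T M Z W)\<close> with \<open>Z\<close> affine in the gain
  and \<open>M\<close>, \<open>W\<close> positive semidefinite, hence convex. Compactness and convexity of the
  Kullback--Leibler ball follow from the bound of \<open>ln (det Z)\<close> by an affine function of \<open>trace Z\<close>
  (\<open>ln_det_le_trace\<close>), which comes from the spectral theorem. Finally, \<open>S\<close> is non-empty because
  the payoff is coercive in the gain, \<open>R\<close> and the noise covariances being positive definite.
\<close>

section \<open>Almost everywhere differentiability of Lipschitz functions\<close>

lemma emeasure_interval_measure_Ioo:
  assumes "a < b" "mono F" "continuous_on UNIV F"
  shows "emeasure (interval_measure F) {a<..<b} = F b - F a"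
proof -
  let ?M = "interval_measure F"
  have m: "\<And>x y. x \<le> y \<Longrightarrow> F x \<le> F y" using assms(2) by (auto simp: mono_def)
  have rc: "\<And>a. continuous (at_right a) F"
    using assms(3) by (metis UNIV_I continuous_on_eq_continuous_within continuous_within_subset subset_UNIV)
  have z: "emeasure ?M {b} = 0"
    using emeasure_interval_measure_Icc[of b b F] m assms(3) by simp
  have "{a<..b} = {a<..<b} \<union> {b}" using assms(1) by auto
  then have "emeasure ?M {a<..b} = emeasure ?M {a<..<b} + emeasure ?M {b}"
    by (simp only:) (rule plus_emeasure[symmetric]; auto)
  then show ?thesis
    using z emeasure_interval_measure_Ioc[of a b F] m rc assms(1) by simp
qed

text \<open>
  Vitali's theorem is applied to intervals selected by the slope of a function over them, so they are
  indexed by their end points, and \<open>Q\<close> stands for the condition on the slope.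
\<close>
lemma Vitali_open_intervals:
  fixes E O' :: "real set"
  assumes O': "open O'" "E \<subseteq> O'"
    and fine: "\<forall>x\<in>E. \<forall>d>0. \<exists>u v. u < x \<and> x < v \<and> v - u < d \<and> Q u v"
  obtains C where "countable C" "\<forall>i\<in>C. fst i < snd i \<and> {fst i<..<snd i} \<subseteq> O' \<and> Q (fst i) (snd i)"
    "disjoint_family_on (\<lambda>i. {fst i<..<snd i}) C" "negligible (E - (\<Union>i\<in>C. {fst i<..<snd i}))"
proof -
  have ballI: "ball ((u+v)/2) ((v-u)/2) = {u<..<v}" for u v :: real
    by (auto simp: ball_def dist_real_def abs_if field_simps split: if_splits)
  define K where "K = {i. fst i < snd i \<and> {fst i<..<snd i} \<subseteq> O' \<and> Q (fst i) (snd i)}"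
  have "\<exists>i. i \<in> K \<and> x \<in> ball ((fst i + snd i)/2) ((snd i - fst i)/2) \<and> (snd i - fst i)/2 < d"
    if x: "x \<in> E" and d: "0 < d" for x d
  proof -
    obtain r where r: "r > 0" "ball x r \<subseteq> O'" using x O' open_contains_ball by blast
    obtain u v where uv: "u < x" "x < v" "v - u < min r d" "Q u v"
      using fine[rule_format, OF x, of "min r d"] r(1) d by auto
    have "{u<..<v} \<subseteq> ball x r" using uv by (auto simp: dist_real_def)
    then have "(u,v) \<in> K" using uv r unfolding K_def by auto
    moreover have "x \<in> {u<..<v}" using uv by auto
    ultimately show ?thesis using uv by (intro exI[of _ "(u,v)"]) (auto simp: ballI)
  qed
  then obtain C where C: "countable C" "C \<subseteq> K"
    "pairwise (\<lambda>i j. disjnt (ball ((fst i + snd i)/2) ((snd i - fst i)/2)) (ball ((fst j + snd j)/2) ((snd j - fst j)/2))) C"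
    "negligible (E - (\<Union>i\<in>C. ball ((fst i + snd i)/2) ((snd i - fst i)/2)))"
    by (rule Vitali_covering_theorem_balls[where a="\<lambda>i. (fst i + snd i)/2" and r="\<lambda>i. (snd i - fst i)/2" and K=K])
  show ?thesis
  proof (rule that[OF C(1)])
    show "\<forall>i\<in>C. fst i < snd i \<and> {fst i<..<snd i} \<subseteq> O' \<and> Q (fst i) (snd i)"
      using C(2) by (auto simp: K_def)
    show "disjoint_family_on (\<lambda>i. {fst i<..<snd i}) C"
      using C(3) by (auto simp: pairwise_def disjoint_family_on_def ballI disjnt_def)
    show "negligible (E - (\<Union>i\<in>C. {fst i<..<snd i}))" using C(4) by (simp add: ballI)
  qed
qed

text \<open>
  The heart of Lebesgue's theorem on monotone functions. Let \<open>\<nu>\<close> be the Stieltjes measure of \<open>F\<close> and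
  \<open>s\<close> the outer measure of the set \<open>E\<close> of points that lie in arbitrarily short intervals of slope
  below \<open>p\<close> and in others of slope above \<open>q\<close>. A Vitali cover of \<open>E\<close> by intervals of the first kind,
  inside an open set of measure at most \<open>s + e\<close>, has a disjoint union \<open>U\<close> with \<open>\<nu> U \<le> p (s + e)\<close>.
  A Vitali cover of \<open>E \<inter> U\<close> by intervals of the second kind inside \<open>U\<close> has a disjoint union \<open>V\<close> with
  \<open>q s \<le> \<nu> V\<close>. Hence \<open>q s \<le> p s\<close>.
\<close>
lemma mono_oscillating_slopes_negligible:
  fixes F :: "real \<Rightarrow> real" and p q a b :: real
  assumes "mono F" "continuous_on UNIV F" "0 \<le> p" "p < q"
  defines "E \<equiv> {x \<in> {a<..<b}.
       (\<forall>d>0. \<exists>u v. u < x \<and> x < v \<and> v - u < d \<and> F v - F u < p * (v - u)) \<and>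
       (\<forall>d>0. \<exists>u v. u < x \<and> x < v \<and> v - u < d \<and> F v - F u > q * (v - u))}"
  shows "negligible E"
proof -
  let ?nu = "interval_measure F"
  have mF: "\<And>x y. x \<le> y \<Longrightarrow> F x \<le> F y" using assms(1) by (auto simp: mono_def)
  define s where "s = outer_measure_of lebesgue E"
  obtain H where H: "H \<in> sets lebesgue" "E \<subseteq> H" "emeasure lebesgue H = s"
    using outer_measure_of_attain[of E lebesgue] by (auto simp: s_def)
  have sle: "s \<le> emeasure lebesgue A" if "E \<subseteq> A" "A \<in> sets lebesgue" for A
    unfolding s_def outer_measure_of_def using that by (intro INF_lower) auto
  have sfin: "s < \<infinity>"
  proof -
    have "s \<le> emeasure lebesgue {a<..<b}"
      by (rule sle) (auto simp: E_def)
    also have "\<dots> < \<infinity>" using emeasure_bounded_finite[of "{a<..<b}"] by simp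
    finally show ?thesis .
  qed
  let ?I = "\<lambda>i::real\<times>real. {fst i<..<snd i}"
  have key: "ennreal q * s \<le> ennreal p * (s + ennreal e)" if epos: "e > 0" for e
  proof -
    obtain O' where O': "open O'" "H \<subseteq> O'" "emeasure lebesgue (O' - H) < ennreal e"
      by (rule sets_lebesgue_outer_open[OF H(1) epos])
    have O's_set: "O' \<in> sets lebesgue" using O'(1) by simp
    have O's: "emeasure lebesgue O' \<le> s + ennreal e"
    proof -
      have "O' = H \<union> (O' - H)" using O'(2) by auto
      then have "emeasure lebesgue O' \<le> emeasure lebesgue H + emeasure lebesgue (O' - H)"
        using emeasure_subadditive[of H lebesgue "O' - H"] H(1) O's_set by auto
      also have "\<dots> \<le> s + ennreal e" using H(3) O'(3) by (intro add_mono) auto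
      finally show ?thesis .
    qed
    have sub: "E \<subseteq> O'" using H(2) O'(2) by blast
    have below: "\<forall>x\<in>E. \<forall>d>0. \<exists>u v. u < x \<and> x < v \<and> v - u < d \<and> F v - F u < p * (v - u)"
      by (simp add: E_def)
    obtain C where C: "countable C" "\<forall>i\<in>C. fst i < snd i \<and> ?I i \<subseteq> O' \<and> F (snd i) - F (fst i) < p * (snd i - fst i)"
      "disjoint_family_on ?I C" "negligible (E - (\<Union>i\<in>C. ?I i))"
      using Vitali_open_intervals[where Q="\<lambda>u v. F v - F u < p * (v - u)", OF O'(1) sub below] by blast
    define U where "U = (\<Union>i\<in>C. ?I i)"
    have Uopen: "open U" by (auto simp: U_def)
    have C4: "negligible (E - U)" using C(4) by (simp add: U_def)
    have "emeasure ?nu U = (\<integral>\<^sup>+i. emeasure ?nu (?I i) \<partial>count_space C)"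
      unfolding U_def using C(1,3) by (intro emeasure_UN_countable) auto
    also have "\<dots> \<le> (\<integral>\<^sup>+i. ennreal p * emeasure lborel (?I i) \<partial>count_space C)"
    proof (intro nn_integral_mono)
      fix i assume "i \<in> space (count_space C)"
      then have i: "fst i < snd i" "F (snd i) - F (fst i) < p * (snd i - fst i)" 
        using C(2) by auto
      then show "emeasure ?nu (?I i) \<le> ennreal p * emeasure lborel (?I i)"
        using assms(1,2,3) by (auto simp: emeasure_interval_measure_Ioo ennreal_mult[symmetric] intro!: ennreal_leI)
    qed
    also have "\<dots> = ennreal p * (\<integral>\<^sup>+i. emeasure lborel (?I i) \<partial>count_space C)"
      by (rule nn_integral_cmult) auto
    also have "(\<integral>\<^sup>+i. emeasure lborel (?I i) \<partial>count_space C) = emeasure lborel U"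
      unfolding U_def using C(1,3) by (intro emeasure_UN_countable[symmetric]) auto
    also have "emeasure lborel U \<le> emeasure lborel O'"
      using C(2) O'(1) unfolding U_def by (intro emeasure_mono UN_least) auto
    also have "\<dots> \<le> s + ennreal e"
      using O's O'(1) by (simp add: emeasure_completion)
    finally have upper: "emeasure ?nu U \<le> ennreal p * (s + ennreal e)"
      by (auto simp: mult_left_mono)
    have above: "\<forall>x\<in>E \<inter> U. \<forall>d>0. \<exists>u v. u < x \<and> x < v \<and> v - u < d \<and> F v - F u > q * (v - u)"
      by (simp add: E_def)
    obtain D where D: "countable D" "\<forall>i\<in>D. fst i < snd i \<and> ?I i \<subseteq> U \<and> F (snd i) - F (fst i) > q * (snd i - fst i)"
      "disjoint_family_on ?I D" "negligible ((E \<inter> U) - (\<Union>i\<in>D. ?I i))"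
      using Vitali_open_intervals[where Q="\<lambda>u v. F v - F u > q * (v - u)", OF Uopen Int_lower2 above] by blast
    define V where "V = (\<Union>i\<in>D. ?I i)"
    have Vopen: "open V" by (auto simp: V_def)
    have D4: "negligible (E \<inter> U - V)" using D(4) by (simp add: V_def)
    define N where "N = (E - U) \<union> (E \<inter> U - V)"
    have N: "N \<in> null_sets lebesgue" using C4 D4 by (auto simp: N_def negligible_iff_null_sets[symmetric])
    have "s \<le> emeasure lebesgue (V \<union> N)"
      using N Vopen by (intro sle) (auto simp: N_def)
    also have "\<dots> = emeasure lborel V"
      using N Vopen by (simp add: emeasure_Un_null_set emeasure_completion)
    finally have "ennreal q * s \<le> ennreal q * emeasure lborel V" by (simp add: mult_left_mono)
    also have "emeasure lborel V = (\<integral>\<^sup>+i. emeasure lborel (?I i) \<partial>count_space D)"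
      unfolding V_def using D(1,3) by (intro emeasure_UN_countable) auto
    also have "ennreal q * \<dots> = (\<integral>\<^sup>+i. ennreal q * emeasure lborel (?I i) \<partial>count_space D)"
      by (rule nn_integral_cmult[symmetric]) auto
    also have "\<dots> \<le> (\<integral>\<^sup>+i. emeasure ?nu (?I i) \<partial>count_space D)"
    proof (intro nn_integral_mono)
      fix i assume "i \<in> space (count_space D)"
      then have i: "fst i < snd i" "F (snd i) - F (fst i) > q * (snd i - fst i)" 
        using D(2) by auto
      then show "ennreal q * emeasure lborel (?I i) \<le> emeasure ?nu (?I i)"
        using assms(1,2,3,4) by (auto simp: emeasure_interval_measure_Ioo ennreal_mult[symmetric] intro!: ennreal_leI)
    qed
    also have "\<dots> = emeasure ?nu V"
      unfolding V_def using D(1,3) by (intro emeasure_UN_countable[symmetric]) auto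
    also have "\<dots> \<le> emeasure ?nu U"
      using D(2) Uopen unfolding V_def by (intro emeasure_mono UN_least) auto
    finally show ?thesis using upper by (rule order_trans)
  qed
  have "s = 0"
  proof -
    obtain r where r: "s = ennreal r" "r \<ge> 0" using sfin by (cases s) auto
    have kr: "q * r \<le> p * (r + e)" if "e > 0" for e
      using key[OF that] r assms(3,4) that
      by (simp add: ennreal_mult[symmetric] ennreal_plus[symmetric] del: ennreal_plus)
    have "q * r \<le> p * r"
    proof (rule field_le_epsilon)
      fix e :: real assume "e > 0"
      have "q * r \<le> p * (r + e / (p+1))" using kr[of "e/(p+1)"] \<open>e > 0\<close> assms(3) by simp
      also have "\<dots> \<le> p * r + e" using assms(3) \<open>e > 0\<close> by (simp add: field_simps)
      finally show "q * r \<le> p * r + e" .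
    qed
    then have "r \<le> 0" using assms(4) by (smt (verit) mult_strict_right_mono)
    then show ?thesis using r by simp
  qed
  then have "H \<in> null_sets lebesgue" using H by auto
  then show ?thesis using H(2) negligible_iff_null_sets negligible_subset by blast
qed

text \<open>
  Off the countable union of the exceptional sets for rational \<open>p < q\<close>, the slopes over intervals
  straddling \<open>x\<close> eventually lie above \<open>p\<close> or below \<open>q\<close>, for every such pair. So they converge, to
  the supremum \<open>D\<close> of the rationals that are eventual lower bounds; the Lipschitz constant bounds
  this set. Continuity of \<open>F\<close> moves one end point of the interval to \<open>x\<close>.
\<close>
lemma mono_lipschitz_ae_differentiable:
  fixes F :: "real \<Rightarrow> real"
  assumes "mono F" and lip: "L-lipschitz_on UNIV F"
  shows "AE x in lborel. \<exists>D. (F has_real_derivative D) (at x)"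
proof -
  have cF: "continuous_on UNIV F" using lip by (rule lipschitz_on_continuous_on)
  define lo where "lo x p \<longleftrightarrow> (\<exists>d>0. \<forall>u v. u < x \<and> x < v \<and> v - u < d \<longrightarrow> F v - F u \<ge> p * (v - u))" for x p
  define hi where "hi x q \<longleftrightarrow> (\<exists>d>0. \<forall>u v. u < x \<and> x < v \<and> v - u < d \<longrightarrow> F v - F u \<le> q * (v - u))" for x q
  define E where "E n p q = {x \<in> {- real n<..<real n}. \<not> lo x p \<and> \<not> hi x q}" for n p q
  define R where "R = {(p::real,q). p \<in> \<rat> \<and> q \<in> \<rat> \<and> 0 \<le> p \<and> p < q}"
  have cR: "countable R"
    by (rule countable_subset[of _ "\<rat> \<times> \<rat>"]) (auto simp: R_def countable_rat)
  have nE: "negligible (E n p q)" if "0 \<le> p" "p < q" for n p q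
  proof -
    have "E n p q = {x \<in> {- real n<..<real n}.
       (\<forall>d>0. \<exists>u v. u < x \<and> x < v \<and> v - u < d \<and> F v - F u < p * (v - u)) \<and>
       (\<forall>d>0. \<exists>u v. u < x \<and> x < v \<and> v - u < d \<and> F v - F u > q * (v - u))}"
      unfolding E_def lo_def hi_def by (simp add: not_le)
    then show ?thesis
      using mono_oscillating_slopes_negligible[OF assms(1) cF that, of "- real n" "real n"] by simp
  qed
  have "(\<Union>i\<in>(UNIV::nat set) \<times> R. E (fst i) (fst (snd i)) (snd (snd i))) \<in> null_sets lebesgue"
    using cR nE by (intro null_sets_UN') (auto simp: R_def negligible_iff_null_sets)
  then obtain N where N: "N \<in> null_sets lborel" "(\<Union>i\<in>(UNIV::nat set) \<times> R. E (fst i) (fst (snd i)) (snd (snd i))) \<subseteq> N"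
    by (auto simp: null_sets_completion_iff2)
  have "\<exists>D. (F has_real_derivative D) (at x)" if "x \<notin> N" for x
  proof -
    have dich: "lo x p \<or> hi x q" if "p \<in> \<rat>" "q \<in> \<rat>" "0 \<le> p" "p < q" for p q
    proof (rule ccontr)
      assume *: "\<not> ?thesis"
      obtain n where n: "\<bar>x\<bar> < real n" using reals_Archimedean2 by blast
      have "x \<in> E n p q" using * n by (auto simp: E_def)
      moreover have "(n,p,q) \<in> UNIV \<times> R" using that by (auto simp: R_def)
      ultimately have "x \<in> N" using N(2) by fastforce
      then show False using \<open>x \<notin> N\<close> by simp
    qed
    define P where "P = {p\<in>\<rat>. 0 \<le> p \<and> lo x p}"
    have "0 \<in> P" using monoD[OF assms(1)] by (auto simp: P_def lo_def intro!: exI[of _ 1])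
    have ub: "p \<le> L" if p: "p \<in> P" for p
    proof -
      obtain d where d: "d > 0" "\<forall>u v. u < x \<and> x < v \<and> v - u < d \<longrightarrow> F v - F u \<ge> p * (v - u)"
        using p by (auto simp: P_def lo_def)
      have "p * (d/2) \<le> F (x + d/4) - F (x - d/4)" using d(1) d(2)[rule_format, of "x - d/4" "x + d/4"] by simp
      also have "\<dots> \<le> L * (d/2)" 
        using lipschitz_onD[OF lip, of "x + d/4" "x - d/4"] d(1)
          abs_ge_self[of "F (x + d/4) - F (x - d/4)"] by (simp add: dist_real_def)
      finally show ?thesis using d(1) by simp
    qed
    have bdd: "bdd_above P" by (rule bdd_aboveI[OF ub])
    define D where "D = Sup P"
    have D0: "0 \<le> D" using \<open>0 \<in> P\<close> bdd unfolding D_def by (rule cSup_upper)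
    have str: "\<exists>d>0. \<forall>u v. u < x \<and> x < v \<and> v - u < d \<longrightarrow> \<bar>F v - F u - D * (v - u)\<bar> \<le> e * (v - u)"
      if e: "e > 0" for e
    proof -
      obtain p where p: "p \<in> P" "D - e < p"
        using less_cSupE[of "D - e" P] e \<open>0 \<in> P\<close> unfolding D_def by auto
      obtain d1 where d1: "d1 > 0" "\<And>u v. u < x \<and> x < v \<and> v - u < d1 \<Longrightarrow> F v - F u \<ge> p * (v - u)"
        using p by (auto simp: P_def lo_def)
      obtain p' where p': "p' \<in> \<rat>" "D < p'" "p' < D + e" using Rats_dense_in_real[of D "D+e"] e by auto
      obtain q where q: "q \<in> \<rat>" "p' < q" "q < D + e" using Rats_dense_in_real[of p' "D+e"] p' by auto
      have "p' \<notin> P" using p'(2) cSup_upper[OF _ bdd] unfolding D_def by force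
      then have "\<not> lo x p'" using p' D0 by (auto simp: P_def)
      then have "hi x q" using dich[of p' q] p' q D0 by auto
      then obtain d2 where d2: "d2 > 0" "\<And>u v. u < x \<and> x < v \<and> v - u < d2 \<Longrightarrow> F v - F u \<le> q * (v - u)"
        by (auto simp: hi_def)
      have "\<bar>F v - F u - D * (v - u)\<bar> \<le> e * (v - u)" if "u < x \<and> x < v \<and> v - u < min d1 d2" for u v
      proof -
        have "(D - e) * (v - u) \<le> p * (v - u)" "q * (v - u) \<le> (D + e) * (v - u)"
          using that p(2) q(3) by (auto intro: mult_right_mono)
        then show ?thesis using d1(2)[of u v] d2(2)[of u v] that by (auto simp: algebra_simps abs_le_iff)
      qed
      then show ?thesis using d1(1) d2(1) by (intro exI[of _ "min d1 d2"]) auto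
    qed
    have iF: "isCont F z" for z using cF by (simp add: continuous_on_eq_continuous_at)
    have "\<exists>d>0. \<forall>y. norm (y - x) < d \<longrightarrow> norm (F y - F x - D * (y - x)) \<le> e * norm (y - x)" if e: "e > 0" for e
    proof -
      obtain d where d: "d > 0" "\<And>u v. u < x \<and> x < v \<and> v - u < d \<Longrightarrow> \<bar>F v - F u - D * (v - u)\<bar> \<le> e * (v - u)"
        using str[OF e] by blast
      have "norm (F y - F x - D * (y - x)) \<le> e * norm (y - x)" if y: "norm (y - x) < d/2" for y
      proof -
        consider "y = x" | "y > x" | "y < x" by linarith
        then show ?thesis
        proof cases
          case 2
          have t: "((\<lambda>u. \<bar>F y - F u - D * (y - u)\<bar> - e * (y - u)) \<longlongrightarrow> \<bar>F y - F x - D * (y - x)\<bar> - e * (y - x)) (at_left x)"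
            using iF[of x] unfolding isCont_def by (intro tendsto_intros) (auto intro: tendsto_within_subset)
          have ev: "eventually (\<lambda>u. \<bar>F y - F u - D * (y - u)\<bar> - e * (y - u) \<le> 0) (at_left x)"
            unfolding eventually_at_left[of "x - 1" x, simplified]
            using d y 2 by (intro exI[of _ "x - d/2"]) (auto intro!: d(2))
          show ?thesis using tendsto_upperbound[OF t ev] 2 by simp
        next
          case 3
          have t: "((\<lambda>v. \<bar>F v - F y - D * (v - y)\<bar> - e * (v - y)) \<longlongrightarrow> \<bar>F x - F y - D * (x - y)\<bar> - e * (x - y)) (at_right x)"
            using iF[of x] unfolding isCont_def by (intro tendsto_intros) (auto intro: tendsto_within_subset)
          have ev: "eventually (\<lambda>v. \<bar>F v - F y - D * (v - y)\<bar> - e * (v - y) \<le> 0) (at_right x)"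
            unfolding eventually_at_right[of x "x + 1", simplified]
            using d y 3 by (intro exI[of _ "x + d/2"]) (auto intro!: d(2))
          show ?thesis using tendsto_upperbound[OF t ev] 3 by (simp add: abs_if algebra_simps split: if_splits)
        qed auto
      qed
      then show ?thesis using d(1) by (intro exI[of _ "d/2"]) auto
    qed
    then have "(F has_derivative (*) D) (at x)"
      unfolding has_derivative_at_alt by (auto simp: bounded_linear_mult_right)
    then show ?thesis by (auto simp: has_field_derivative_def)
  qed
  then show ?thesis using N(1) by (intro AE_I'[OF N(1)]) auto
qed

text \<open>
  Each coordinate of the curve becomes monotone when a linear function of slope \<open>L\<close> is added.
\<close>
lemma lipschitz_ae_differentiable:
  fixes f :: "real \<Rightarrow> 'a::euclidean_space"
  assumes "L-lipschitz_on {0..} f"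
  shows "AE x in lborel. 0 < x \<longrightarrow> (\<exists>D. (f has_vector_derivative D) (at x))"
proof -
  have L0: "L \<ge> 0" using assms by (rule lipschitz_on_nonneg)
  have "AE x in lborel. \<exists>D. ((\<lambda>t. f (max 0 t) \<bullet> b) has_real_derivative D) (at x)" if b: "b \<in> Basis" for b
  proof -
    define g where "g t = f (max 0 t) \<bullet> b" for t
    have glip: "\<bar>g t - g s\<bar> \<le> L * \<bar>t - s\<bar>" for s t
    proof -
      have "\<bar>g t - g s\<bar> = \<bar>(f (max 0 t) - f (max 0 s)) \<bullet> b\<bar>" by (simp add: g_def inner_diff_left)
      also have "\<dots> \<le> norm (f (max 0 t) - f (max 0 s))" by (rule Basis_le_norm[OF b])
      also have "\<dots> \<le> L * \<bar>max 0 t - max 0 s\<bar>"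
        using lipschitz_onD[OF assms, of "max 0 t" "max 0 s"] by (simp add: dist_norm)
      also have "\<dots> \<le> L * \<bar>t - s\<bar>" using L0 by (intro mult_left_mono) auto
      finally show ?thesis .
    qed
    have "mono (\<lambda>t. g t + L * t)"
    proof (rule monoI)
      fix x y :: real assume "x \<le> y"
      then show "g x + L * x \<le> g y + L * y" using glip[of y x] by (simp add: algebra_simps abs_le_iff)
    qed
    moreover have "(2*L)-lipschitz_on UNIV (\<lambda>t. g t + L * t)"
    proof (rule lipschitz_onI)
      fix x y :: real
      have "\<bar>(g x + L * x) - (g y + L * y)\<bar> \<le> \<bar>g x - g y\<bar> + \<bar>L * (x - y)\<bar>"
        by (simp add: algebra_simps abs_triangle_ineq)
      then show "dist (g x + L * x) (g y + L * y) \<le> 2 * L * dist x y"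
        using glip[of x y] L0 by (simp add: dist_real_def abs_mult)
    qed (use L0 in simp)
    ultimately have "AE x in lborel. \<exists>D. ((\<lambda>t. g t + L * t) has_real_derivative D) (at x)"
      by (rule mono_lipschitz_ae_differentiable)
    then show ?thesis
    proof (rule AE_mp, intro AE_I2 impI)
      fix x assume "\<exists>D. ((\<lambda>t. g t + L * t) has_real_derivative D) (at x)"
      then obtain D where "((\<lambda>t. g t + L * t) has_real_derivative D) (at x)" by blast
      then have "((\<lambda>t. (g t + L * t) - L * t) has_real_derivative D - L * 1) (at x)"
        by (intro DERIV_diff DERIV_cmult DERIV_ident)
      then show "\<exists>D. ((\<lambda>t. f (max 0 t) \<bullet> b) has_real_derivative D) (at x)" by (auto simp: g_def)
    qed
  qed
  then have "AE x in lborel. \<forall>b\<in>Basis. \<exists>D. ((\<lambda>t. f (max 0 t) \<bullet> b) has_real_derivative D) (at x)"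
    by (intro AE_finite_allI) auto
  then show ?thesis
  proof (rule AE_mp, intro AE_I2 impI)
    fix x :: real assume "\<forall>b\<in>Basis. \<exists>D. ((\<lambda>t. f (max 0 t) \<bullet> b) has_real_derivative D) (at x)" and x: "0 < x"
    then obtain D where D: "\<And>b. b \<in> Basis \<Longrightarrow> ((\<lambda>t. f (max 0 t) \<bullet> b) has_real_derivative D b) (at x)" by metis
    have "((\<lambda>t. \<Sum>b\<in>Basis. (f (max 0 t) \<bullet> b) *\<^sub>R b) has_vector_derivative (\<Sum>b\<in>Basis. D b *\<^sub>R b)) (at x)"
      by (intro has_vector_derivative_sum has_vector_derivative_scaleR[where g="\<lambda>_. b" and g'=0 for b, simplified] D)
         auto
    then have "((\<lambda>t. f (max 0 t)) has_vector_derivative (\<Sum>b\<in>Basis. D b *\<^sub>R b)) (at x)"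
      by (simp add: euclidean_representation)
    then have "(f has_vector_derivative (\<Sum>b\<in>Basis. D b *\<^sub>R b)) (at x)"
      by (rule has_vector_derivative_transform_within_open[of _ _ _ "{0<..}"]) (use x in \<open>auto simp: max_def\<close>)
    then show "\<exists>D. (f has_vector_derivative D) (at x)" by blast
  qed
qed

section \<open>Absolutely continuous functions\<close>

text \<open>
  The increment is evaluated on a tagged division that is fine for the following gauge. At a point
  outside the exceptional null set \<open>N\<close> the gauge makes the increment at most \<open>M + e\<close> times the
  length. At a point of \<open>N\<close> it confines the interval to an open neighbourhood of \<open>N\<close> of small
  measure, so that absolute continuity makes the sum of these increments small.
\<close>
lemma abs_cont_deriv_bound:
  fixes f :: "real \<Rightarrow> real"
  assumes ab: "a \<le> b" and ac: "abs_cont_on a b f" and M: "0 \<le> M"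
    and der: "AE x in lborel. x \<in> {a..b} \<longrightarrow> (\<exists>D. (f has_real_derivative D) (at x within {a..b}) \<and> D \<le> M)"
  shows "f b - f a \<le> M * (b - a)"
proof (rule field_le_epsilon)
  fix e0 :: real assume e0: "0 < e0"
  define e where "e = e0 / (b - a + 1)"
  have e: "e > 0" using e0 ab by (simp add: e_def)
  obtain \<delta> where \<delta>: "\<delta> > 0" and ac\<delta>: "\<And>D. finite D \<Longrightarrow> (\<forall>(s, t)\<in>D. a \<le> s \<and> s \<le> t \<and> t \<le> b) \<Longrightarrow>
     pairwise (\<lambda>I J. {fst I<..<snd I} \<inter> {fst J<..<snd J} = {}) D \<Longrightarrow>
     (\<Sum>(s, t)\<in>D. t - s) < \<delta> \<Longrightarrow> (\<Sum>(s, t)\<in>D. dist (f s) (f t)) < e"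
    using ac e unfolding abs_cont_on_def by meson
  obtain N where N: "N \<in> null_sets lborel"
    "\<And>x. x \<notin> N \<Longrightarrow> x \<in> {a..b} \<Longrightarrow> (\<exists>D. (f has_real_derivative D) (at x within {a..b}) \<and> D \<le> M)"
    using der by (auto elim!: AE_E3)
  obtain O' where O': "open O'" "N \<subseteq> O'" "emeasure lborel (O' - N) < \<delta>"
    using outer_regular_lborel[of N \<delta>] N(1) \<delta> by (auto simp: null_sets_def)
  have O'm: "emeasure lborel O' < \<delta>"
    using O'(1,3) N(1) emeasure_Diff_null_set[of N lborel O'] by simp
  have "\<exists>d>0. \<forall>y\<in>{a..b}. \<bar>y - x\<bar> < d \<longrightarrow> (x \<le> y \<longrightarrow> f y - f x \<le> (M + e) * (y - x)) \<and> (y \<le> x \<longrightarrow> f x - f y \<le> (M + e) * (x - y))"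
    if x: "x \<notin> N" "x \<in> {a..b}" for x
  proof -
    obtain D where D: "(f has_real_derivative D) (at x within {a..b})" "D \<le> M" using N(2)[OF x] by blast
    then obtain d where d: "d > 0"
      "\<And>y. y \<in> {a..b} \<Longrightarrow> norm (y - x) < d \<Longrightarrow> norm (f y - f x - D * (y - x)) \<le> e * norm (y - x)"
      using e unfolding has_field_derivative_def has_derivative_within_alt by blast
    have "(x \<le> y \<longrightarrow> f y - f x \<le> (M + e) * (y - x)) \<and> (y \<le> x \<longrightarrow> f x - f y \<le> (M + e) * (x - y))"
      if y: "y \<in> {a..b}" "\<bar>y - x\<bar> < d" for y
    proof (intro conjI impI)
      assume "x \<le> y"
      then have "D * (y - x) \<le> M * (y - x)" using D(2) by (simp add: mult_right_mono)
      then show "f y - f x \<le> (M + e) * (y - x)" using d(2)[of y] y \<open>x \<le> y\<close> by (simp add: algebra_simps abs_le_iff)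
    next
      assume "y \<le> x"
      then have "D * (x - y) \<le> M * (x - y)" using D(2) by (simp add: mult_right_mono)
      then show "f x - f y \<le> (M + e) * (x - y)" using d(2)[of y] y \<open>y \<le> x\<close> by (simp add: algebra_simps abs_le_iff)
    qed
    then show ?thesis using d(1) by blast
  qed
  then obtain d where d: "\<And>x. x \<notin> N \<Longrightarrow> x \<in> {a..b} \<Longrightarrow> d x > 0"
    "\<And>x y. x \<notin> N \<Longrightarrow> x \<in> {a..b} \<Longrightarrow> y \<in> {a..b} \<Longrightarrow> \<bar>y - x\<bar> < d x \<Longrightarrow>
       (x \<le> y \<longrightarrow> f y - f x \<le> (M + e) * (y - x)) \<and> (y \<le> x \<longrightarrow> f x - f y \<le> (M + e) * (x - y))"
    by metis
  define g where "g x = (if x \<in> N then O' else if x \<in> {a..b} then ball x (d x) else ball x 1)" for x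
  have "gauge g" using O' d(1) by (auto simp: gauge_def g_def)
  then obtain p where p: "p tagged_division_of {a..b}" "g fine p"
    by (rule fine_division_exists_real)
  note pD = tagged_division_ofD[OF p(1)]
  have K: "K = {Inf K..Sup K}" "Inf K \<le> x" "x \<le> Sup K" "a \<le> Inf K" "Sup K \<le> b" "K \<subseteq> g x" if xK: "(x,K) \<in> p" for x K
  proof -
    obtain u v where uv: "K = {u..v}" using pD(4)[OF xK] by auto
    have "x \<in> K" "K \<subseteq> {a..b}" using pD(2,3)[OF xK] by auto
    then show "K = {Inf K..Sup K}" "Inf K \<le> x" "x \<le> Sup K" "a \<le> Inf K" "Sup K \<le> b" using uv by auto
    show "K \<subseteq> g x" using p(2) xK by (auto simp: fine_def)
  qed
  have disj: "{Inf K<..<Sup K} \<inter> {Inf K'<..<Sup K'} = {}" if "(x,K) \<in> p" "(x',K') \<in> p" "(x,K) \<noteq> (x',K')" for x K x' K'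
    using pD(5)[OF that] K(1)[OF that(1)] K(1)[OF that(2)] by (metis interior_atLeastAtMost_real)
  define p1 where "p1 = {z\<in>p. fst z \<in> N}"
  define p2 where "p2 = {z\<in>p. fst z \<notin> N}"
  have pp: "p = p1 \<union> p2" "p1 \<inter> p2 = {}" "finite p1" "finite p2" using pD(1) by (auto simp: p1_def p2_def)
  define h where "h = (\<lambda>z::real \<times> real set. (Inf (snd z), Sup (snd z)))"
  \<comment> \<open>Distinct tags could share an interval only if it were degenerate, and then it contains just its tag.\<close>
  have inj: "inj_on h p1"
  proof (rule inj_onI)
    fix z z' assume zz: "z \<in> p1" "z' \<in> p1" "h z = h z'"
    obtain x K x' K' where z: "z = (x,K)" "z' = (x',K')" by (metis surj_pair)
    have inp: "(x,K) \<in> p" "(x',K') \<in> p" using zz z by (auto simp: p1_def)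
    have eq: "Inf K = Inf K'" "Sup K = Sup K'" using zz z by (auto simp: h_def)
    then have KK: "K = K'" using K(1)[OF inp(1)] K(1)[OF inp(2)] by simp
    show "z = z'"
    proof (rule ccontr)
      assume "z \<noteq> z'"
      then have "{Inf K<..<Sup K} = {}" using disj[OF inp] z eq by auto
      then have "Inf K = Sup K" using K(2,3)[OF inp(1)] by (auto simp: greaterThanLessThan_empty_iff)
      then have "x = x'" using K(2,3)[OF inp(1)] K(2,3)[OF inp(2)] eq by auto
      then show False using \<open>z \<noteq> z'\<close> z KK by auto
    qed
  qed
  have small: "(\<Sum>(s, t)\<in>h ` p1. t - s) < \<delta>"
  proof -
    have "ennreal (\<Sum>z\<in>p1. Sup (snd z) - Inf (snd z)) = (\<Sum>z\<in>p1. ennreal (Sup (snd z) - Inf (snd z)))"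
      using K(2,3) by (intro sum_ennreal[symmetric]) (fastforce simp: p1_def)
    also have "\<dots> = (\<Sum>z\<in>p1. emeasure lborel {Inf (snd z)<..<Sup (snd z)})"
      using K(2,3) by (intro sum.cong) (fastforce simp: p1_def)+
    also have "\<dots> = emeasure lborel (\<Union>z\<in>p1. {Inf (snd z)<..<Sup (snd z)})"
    proof (rule sum_emeasure)
      show "disjoint_family_on (\<lambda>z. {Inf (snd z)<..<Sup (snd z)}) p1"
        unfolding disjoint_family_on_def p1_def using disj by (metis (no_types, lifting) mem_Collect_eq prod.collapse)
    qed (use pp in auto)
    also have "\<dots> \<le> emeasure lborel O'"
    proof (intro emeasure_mono UN_least)
      fix z assume z: "z \<in> p1"
      then have "(fst z, snd z) \<in> p" "fst z \<in> N" by (auto simp: p1_def)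
      then have "snd z \<subseteq> O'" "snd z = {Inf (snd z)..Sup (snd z)}"
        using K(1,6)[of "fst z" "snd z"] by (auto simp only: g_def if_True)
      moreover have "{Inf (snd z)<..<Sup (snd z)} \<subseteq> {Inf (snd z)..Sup (snd z)}" by auto
      ultimately show "{Inf (snd z)<..<Sup (snd z)} \<subseteq> O'" by blast
    qed (use O' in simp)
    also have "\<dots> < \<delta>" by (rule O'm)
    finally have "(\<Sum>z\<in>p1. Sup (snd z) - Inf (snd z)) < \<delta>"
      using ennreal_leI leD not_le_imp_less by metis
    then show ?thesis using inj by (simp add: sum.reindex h_def)
  qed
  have "(\<Sum>(s, t)\<in>h ` p1. dist (f s) (f t)) < e"
  proof (rule ac\<delta>)
    show "finite (h ` p1)" using pp by simp
    show "\<forall>(s, t)\<in>h ` p1. a \<le> s \<and> s \<le> t \<and> t \<le> b"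
    proof
      fix y assume "y \<in> h ` p1"
      then obtain x K' where "(x,K') \<in> p" "y = (Inf K', Sup K')" by (auto simp: h_def p1_def)
      then show "case y of (s, t) \<Rightarrow> a \<le> s \<and> s \<le> t \<and> t \<le> b" using K(2-5)[of x K'] by auto
    qed
    show "pairwise (\<lambda>I J. {fst I<..<snd I} \<inter> {fst J<..<snd J} = {}) (h ` p1)"
      unfolding pairwise_def
    proof (intro ballI impI)
      fix y y' assume y: "y \<in> h ` p1" "y' \<in> h ` p1" "y \<noteq> y'"
      then obtain z z' where z: "z \<in> p1" "z' \<in> p1" "y = h z" "y' = h z'" by blast
      then have "(fst z, snd z) \<in> p" "(fst z', snd z') \<in> p" "z \<noteq> z'" using y(3) by (auto simp: p1_def)
      then show "{fst y<..<snd y} \<inter> {fst y'<..<snd y'} = {}"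
        using disj[of "fst z" "snd z" "fst z'" "snd z'"] z(3,4) by (simp add: h_def)
    qed
  qed (rule small)
  then have s1: "(\<Sum>z\<in>p1. dist (f (Inf (snd z))) (f (Sup (snd z)))) < e"
    using inj by (simp add: sum.reindex h_def)
  have "f b - f a = (\<Sum>(x,K)\<in>p. f (Sup K) - f (Inf K))"
    by (rule additive_tagged_division_1[OF ab p(1), symmetric])
  also have "\<dots> = (\<Sum>(x,K)\<in>p1. f (Sup K) - f (Inf K)) + (\<Sum>(x,K)\<in>p2. f (Sup K) - f (Inf K))"
    unfolding pp(1) by (rule sum.union_disjoint[OF pp(3,4,2)])
  also have "(\<Sum>(x,K)\<in>p1. f (Sup K) - f (Inf K)) \<le> (\<Sum>z\<in>p1. dist (f (Inf (snd z))) (f (Sup (snd z))))"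
    by (intro sum_mono) (auto simp: dist_real_def)
  also have "\<dots> \<le> e" using s1 by simp
  also have "(\<Sum>(x,K)\<in>p2. f (Sup K) - f (Inf K)) \<le> (\<Sum>(x,K)\<in>p2. (M + e) * (Sup K - Inf K))"
  proof (intro sum_mono, clarify)
    fix x K' assume "(x,K') \<in> p2"
    then have xK: "(x,K') \<in> p" "x \<notin> N" by (auto simp: p2_def)
    have xab: "x \<in> {a..b}" using pD(2,3)[OF xK(1)] by auto
    have "{Inf K'..Sup K'} \<subseteq> ball x (d x)" using K(1,6)[OF xK(1)] xK(2) xab by (auto simp: g_def)
    moreover have "Inf K' \<in> {Inf K'..Sup K'}" "Sup K' \<in> {Inf K'..Sup K'}" using K(2,3)[OF xK(1)] by auto
    ultimately have "Inf K' \<in> ball x (d x)" "Sup K' \<in> ball x (d x)" by blast+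
    then have "f (Sup K') - f x \<le> (M + e) * (Sup K' - x)" "f x - f (Inf K') \<le> (M + e) * (x - Inf K')"
      using d(2)[OF xK(2) xab, of "Sup K'"] d(2)[OF xK(2) xab, of "Inf K'"] K(2-5)[OF xK(1)]
      by (auto simp: dist_real_def abs_minus_commute)
    then show "f (Sup K') - f (Inf K') \<le> (M + e) * (Sup K' - Inf K')" by (simp add: algebra_simps)
  qed
  also have "(\<Sum>(x,K)\<in>p2. (M + e) * (Sup K - Inf K)) \<le> (\<Sum>(x,K)\<in>p. (M + e) * (Sup K - Inf K))"
  proof (rule sum_mono2)
    show "finite p" by (rule pD(1))
    show "p2 \<subseteq> p" by (auto simp: p2_def)
    fix z assume "z \<in> p - p2"
    then have "(fst z, snd z) \<in> p" by auto
    from K(2,3)[OF this] show "0 \<le> (case z of (x, K) \<Rightarrow> (M + e) * (Sup K - Inf K))"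
      using M e by (auto simp: split_beta)
  qed
  also have "\<dots> = (M + e) * (b - a)"
    using additive_tagged_division_1[OF ab p(1), of "\<lambda>x. (M + e) * x"] by (simp add: algebra_simps)
  finally have "f b - f a \<le> e + (M + e) * (b - a)" by simp
  also have "\<dots> = M * (b - a) + e * (b - a + 1)" by (simp add: algebra_simps)
  also have "e * (b - a + 1) = e0" using ab by (simp add: e_def)
  finally show "f b - f a \<le> M * (b - a) + e0" .
qed

lemma abs_cont_on_dominated:
  assumes ac: "abs_cont_on a b f" and sub: "a \<le> c" "d \<le> b"
    and le: "\<And>s t. s \<in> {c..d} \<Longrightarrow> t \<in> {c..d} \<Longrightarrow> dist (g s) (g t) \<le> dist (f s) (f t)"
  shows "abs_cont_on c d g"
  unfolding abs_cont_on_def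
proof (intro allI impI)
  fix \<epsilon> :: real assume "0 < \<epsilon>"
  then obtain \<delta> where \<delta>: "\<delta> > 0" "\<forall>D. finite D \<and> (\<forall>(s, t)\<in>D. a \<le> s \<and> s \<le> t \<and> t \<le> b) \<and>
     pairwise (\<lambda>I J. {fst I<..<snd I} \<inter> {fst J<..<snd J} = {}) D \<and>
     (\<Sum>(s, t)\<in>D. t - s) < \<delta> \<longrightarrow> (\<Sum>(s, t)\<in>D. dist (f s) (f t)) < \<epsilon>"
    using ac unfolding abs_cont_on_def by meson
  show "\<exists>\<delta>>0. \<forall>D. finite D \<and> (\<forall>(s, t)\<in>D. c \<le> s \<and> s \<le> t \<and> t \<le> d) \<and>
     pairwise (\<lambda>I J. {fst I<..<snd I} \<inter> {fst J<..<snd J} = {}) D \<and>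
     (\<Sum>(s, t)\<in>D. t - s) < \<delta> \<longrightarrow> (\<Sum>(s, t)\<in>D. dist (g s) (g t)) < \<epsilon>"
  proof (intro exI[of _ \<delta>] conjI allI impI \<delta>(1); (elim conjE)?)
    fix D :: "(real \<times> real) set"
    assume D: "finite D" "\<forall>(s, t)\<in>D. c \<le> s \<and> s \<le> t \<and> t \<le> d"
      "pairwise (\<lambda>I J. {fst I<..<snd I} \<inter> {fst J<..<snd J} = {}) D"
      "(\<Sum>(s, t)\<in>D. t - s) < \<delta>"
    have "\<forall>(s, t)\<in>D. a \<le> s \<and> s \<le> t \<and> t \<le> b"
    proof
      fix y assume "y \<in> D"
      then show "case y of (s, t) \<Rightarrow> a \<le> s \<and> s \<le> t \<and> t \<le> b" using D(2) sub by (cases y) auto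
    qed
    then have "(\<Sum>(s, t)\<in>D. dist (f s) (f t)) < \<epsilon>" using \<delta>(2) D by blast
    moreover have "(\<Sum>(s, t)\<in>D. dist (g s) (g t)) \<le> (\<Sum>(s, t)\<in>D. dist (f s) (f t))"
      using le D(2) by (intro sum_mono) (auto simp: split_beta)
    ultimately show "(\<Sum>(s, t)\<in>D. dist (g s) (g t)) < \<epsilon>" by simp
  qed
qed

lemma abs_cont_halfline_cong:
  assumes "abs_cont_halfline f" "\<And>l. 0 \<le> l \<Longrightarrow> f l = g l" shows "abs_cont_halfline g"
  unfolding abs_cont_halfline_def
proof (intro allI impI)
  fix b :: real assume "0 \<le> b"
  then have "abs_cont_on 0 b f" using assms(1) by (simp add: abs_cont_halfline_def)
  then show "abs_cont_on 0 b g" by (rule abs_cont_on_dominated) (use assms(2) in auto)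
qed

lemma lipschitz_imp_abs_cont_on:
  assumes "L-lipschitz_on {a..b} f"
  shows "abs_cont_on a b f"
  unfolding abs_cont_on_def
proof (intro allI impI)
  fix \<epsilon> :: real assume \<epsilon>: "0 < \<epsilon>"
  have L: "L \<ge> 0" using assms by (rule lipschitz_on_nonneg)
  show "\<exists>\<delta>>0. \<forall>D. finite D \<and> (\<forall>(s, t)\<in>D. a \<le> s \<and> s \<le> t \<and> t \<le> b) \<and>
     pairwise (\<lambda>I J. {fst I<..<snd I} \<inter> {fst J<..<snd J} = {}) D \<and>
     (\<Sum>(s, t)\<in>D. t - s) < \<delta> \<longrightarrow> (\<Sum>(s, t)\<in>D. dist (f s) (f t)) < \<epsilon>"
  proof (intro exI[of _ "\<epsilon> / (L + 1)"] conjI allI impI; (elim conjE)?)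
    show "0 < \<epsilon> / (L + 1)" using \<epsilon> L by simp
    fix D :: "(real \<times> real) set"
    assume D: "\<forall>(s, t)\<in>D. a \<le> s \<and> s \<le> t \<and> t \<le> b" "(\<Sum>(s, t)\<in>D. t - s) < \<epsilon> / (L + 1)"
    have "(\<Sum>(s, t)\<in>D. dist (f s) (f t)) \<le> (\<Sum>(s, t)\<in>D. (L + 1) * (t - s))"
    proof (intro sum_mono, clarify)
      fix s t assume "(s,t) \<in> D"
      then have st: "a \<le> s" "s \<le> t" "t \<le> b" using D(1) by auto
      then have "dist (f s) (f t) \<le> L * (t - s)" using lipschitz_onD[OF assms, of s t] by (simp add: dist_real_def)
      also have "\<dots> \<le> (L + 1) * (t - s)" using st by (simp add: mult_right_mono)
      finally show "dist (f s) (f t) \<le> (L + 1) * (t - s)" .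
    qed
    also have "\<dots> = (L + 1) * (\<Sum>(s, t)\<in>D. t - s)" by (simp add: sum_distrib_left split_beta)
    also have "\<dots> < (L + 1) * (\<epsilon> / (L + 1))" using D(2) L by (intro mult_strict_left_mono) auto
    also have "\<dots> = \<epsilon>" using L by simp
    finally show "(\<Sum>(s, t)\<in>D. dist (f s) (f t)) < \<epsilon>" .
  qed
qed

text \<open>
  The vector-valued case reduces to the scalar one along the direction of the increment.
\<close>
lemma abs_cont_bounded_deriv_lipschitz:
  fixes f :: "real \<Rightarrow> 'a::real_inner"
  assumes ac: "abs_cont_halfline f" and M: "0 \<le> M"
    and der: "AE x in lborel. 0 \<le> x \<longrightarrow> (\<exists>D. (f has_vector_derivative D) (at x within {0..}) \<and> norm D \<le> M)"
  shows "M-lipschitz_on {0..} f"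
proof (rule lipschitz_on_leI[OF _ M])
  fix s t :: real assume st: "s \<in> {0..}" "t \<in> {0..}" "s \<le> t"
  define u where "u = sgn (f t - f s)"
  have u: "norm u \<le> 1" by (simp add: u_def norm_sgn)
  have "(f t - f s) \<bullet> u = norm (f t - f s)"
    by (cases "f t = f s") (simp_all add: u_def sgn_div_norm power2_norm_eq_inner[symmetric] power2_eq_square)
  moreover have "f t \<bullet> u - f s \<bullet> u \<le> M * (t - s)"
  proof (rule abs_cont_deriv_bound)
    have *: "abs_cont_on 0 t f"
      using ac st unfolding abs_cont_halfline_def by simp
    have "dist (f x \<bullet> u) (f y \<bullet> u) \<le> dist (f x) (f y)" for x y
    proof -
      have "\<bar>(f x - f y) \<bullet> u\<bar> \<le> norm (f x - f y) * norm u" by (rule Cauchy_Schwarz_ineq2)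
      also have "\<dots> \<le> norm (f x - f y)" using u by (simp add: mult_left_le)
      finally show ?thesis by (simp add: dist_norm inner_diff_left)
    qed
    then show "abs_cont_on s t (\<lambda>x. f x \<bullet> u)" 
      by (intro abs_cont_on_dominated[OF *]) (use st in auto)
    show "AE x in lborel. x \<in> {s..t} \<longrightarrow> (\<exists>D. ((\<lambda>x. f x \<bullet> u) has_real_derivative D) (at x within {s..t}) \<and> D \<le> M)"
      using der
    proof (rule AE_mp, intro AE_I2 impI)
      fix x assume h: "0 \<le> x \<longrightarrow> (\<exists>D. (f has_vector_derivative D) (at x within {0..}) \<and> norm D \<le> M)" "x \<in> {s..t}"
      then obtain D where D: "(f has_vector_derivative D) (at x within {0..})" "norm D \<le> M" using st by auto
      have "((\<lambda>x. f x \<bullet> u) has_vector_derivative D \<bullet> u) (at x within {s..t})"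
        by (rule bounded_linear.has_vector_derivative[OF bounded_linear_inner_left])
           (use D(1) st in \<open>auto intro: has_vector_derivative_within_subset\<close>)
      moreover have "D \<bullet> u \<le> M"
      proof -
        have "D \<bullet> u \<le> norm D * norm u" by (rule norm_cauchy_schwarz)
        also have "\<dots> \<le> M" using u D(2) M by (smt (verit) mult_left_le norm_ge_zero)
        finally show ?thesis .
      qed
      ultimately show "\<exists>D. ((\<lambda>x. f x \<bullet> u) has_real_derivative D) (at x within {s..t}) \<and> D \<le> M"
        by (auto simp: has_real_derivative_iff_has_vector_derivative)
    qed
  qed (use st M in auto)
  ultimately show "dist (f s) (f t) \<le> M * dist s t"
    using st by (simp add: dist_norm inner_diff_left norm_minus_commute)
qed

section \<open>A differential inclusion on a compact convex set\<close>

text \<open>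
  A closed graph in a compact set makes a set-valued map upper semicontinuous: otherwise values
  that stay away from \<open>F x\<close> would accumulate, and the closed graph puts their limit into \<open>F x\<close>.
\<close>
lemma closed_graph_usc:
  fixes F :: "'a::euclidean_space \<Rightarrow> 'a set"
  assumes K: "compact K" and FK: "\<And>x. x \<in> K \<Longrightarrow> F x \<subseteq> K"
    and cg: "\<And>xs ys x y. (\<forall>n. xs n \<in> K \<and> ys n \<in> F (xs n)) \<Longrightarrow> xs \<longlonglongrightarrow> x \<Longrightarrow> ys \<longlonglongrightarrow> y \<Longrightarrow> y \<in> F x"
    and x: "x \<in> K" and ne: "F x \<noteq> {}" and e: "0 < e"
  shows "\<exists>d>0. \<forall>x'\<in>K. dist x' x < d \<longrightarrow> (\<forall>y\<in>F x'. \<exists>z\<in>F x. dist y z \<le> e)"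
proof (rule ccontr)
  assume "\<not> ?thesis"
  then have "\<forall>n::nat. \<exists>x' y. x' \<in> K \<and> dist x' x < inverse (Suc n) \<and> y \<in> F x' \<and> (\<forall>z\<in>F x. e < dist y z)"
    by (auto simp: not_le Ball_def)
  then obtain xs ys where xy: "\<And>n. xs n \<in> K" "\<And>n. dist (xs n) x < inverse (Suc n)" "\<And>n. ys n \<in> F (xs n)"
    "\<And>n z. z \<in> F x \<Longrightarrow> e < dist (ys n) z" by metis
  have "xs \<longlonglongrightarrow> x"
    by (rule iffD2[OF tendsto_dist_iff], rule tendsto_sandwich[OF _ _ tendsto_const LIMSEQ_inverse_real_of_nat])
       (auto intro!: always_eventually less_imp_le xy(2) simp del: of_nat_Suc)
  moreover have "\<forall>n. ys n \<in> K" using xy FK by blast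
  then obtain y r where r: "strict_mono r" "(ys \<circ> r) \<longlonglongrightarrow> y"
    using K unfolding compact_def by meson
  ultimately have "y \<in> F x"
    using cg[of "xs \<circ> r" "ys \<circ> r" x y] xy(1,3) LIMSEQ_subseq_LIMSEQ[of xs x r] by auto
  then have "\<forall>n. e < dist ((ys \<circ> r) n) y" using xy(4) by auto
  moreover have "\<exists>n. dist ((ys \<circ> r) n) y < e"
    using r(2) e unfolding lim_sequentially by blast
  ultimately show False by (metis less_asym)
qed

text \<open>
  The functions are equi-Lipschitz only up to an error \<open>c n\<close> that tends to zero, as is the case for
  step functions on ever finer grids.
\<close>
lemma convergent_from_dense:
  fixes f :: "nat \<Rightarrow> real \<Rightarrow> 'a::banach"
  assumes L: "L \<ge> 0"
    and eq: "\<And>n s t. 0 \<le> s \<Longrightarrow> 0 \<le> t \<Longrightarrow> norm (f n t - f n s) \<le> L * (\<bar>t - s\<bar> + c n)" and c: "c \<longlonglongrightarrow> (0::real)"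
    and conv: "\<And>q. q \<in> \<rat> \<Longrightarrow> 0 \<le> q \<Longrightarrow> convergent (\<lambda>n. f n q)"
    and t: "0 \<le> t"
  shows "convergent (\<lambda>n. f n t)"
proof (rule Cauchy_convergent, rule metric_CauchyI)
  fix e :: real assume e: "e > 0"
  define d where "d = e / (8 * (L + 1))"
  have d: "d > 0" using e L by (simp add: d_def)
  obtain q where q: "q \<in> \<rat>" "t < q" "q < t + d" using Rats_dense_in_real[of t "t+d"] d by auto
  then have q0: "q \<ge> 0" using t by simp
  obtain N1 where N1: "\<And>m n. m \<ge> N1 \<Longrightarrow> n \<ge> N1 \<Longrightarrow> dist (f m q) (f n q) < e/4"
    using convergent_Cauchy[OF conv[OF q(1) q0]] e unfolding Cauchy_def by (metis divide_pos_pos zero_less_numeral)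
  obtain N2 where N2: "\<And>n. n \<ge> N2 \<Longrightarrow> \<bar>c n\<bar> < d"
    using c d unfolding lim_sequentially by (auto simp: dist_real_def)
  have close: "dist (f n t) (f n q) \<le> e/4" if "n \<ge> N2" for n
  proof -
    have "norm (f n t - f n q) \<le> L * (\<bar>t - q\<bar> + c n)" using eq q0 t by blast
    also have "\<dots> \<le> L * (2 * d)" using q N2[OF that] L by (intro mult_left_mono) auto
    also have "\<dots> \<le> e/4" using L e by (simp add: d_def field_simps)
    finally show ?thesis by (simp add: dist_norm)
  qed
  have "dist (f m t) (f n t) < e" if "m \<ge> max N1 N2" "n \<ge> max N1 N2" for m n
  proof -
    have "dist (f m t) (f n t) \<le> dist (f m t) (f m q) + dist (f m q) (f n q) + dist (f n q) (f n t)"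
      by (meson dist_triangle order_trans add_right_mono)
    also have "\<dots> < e/4 + e/4 + e/4"
      using close[of m] close[of n] N1[of m n] that by (simp add: dist_commute)
    finally show ?thesis using e by simp
  qed
  then show "\<exists>M. \<forall>m\<ge>M. \<forall>n\<ge>M. dist (f m t) (f n t) < e" by blast
qed

text \<open>
  Euler's scheme for \<open>x' \<in> F x - x\<close> with step \<open>h \<le> 1\<close> replaces \<open>x\<close> by the convex combination
  \<open>(1 - h) x + h y\<close> with some \<open>y \<in> F x\<close>, so it never leaves \<open>K\<close>. A subsequence of the step functions
  \<open>Y\<close> converges at all rational times and hence at all times, to a Lipschitz curve \<open>X\<close>. Pointwise
  convergence suffices to identify the derivative at a fixed time \<open>t\<close>: for small \<open>s\<close> all states
  that an approximation visits between \<open>t\<close> and \<open>t + s\<close> are close to \<open>X t\<close>, so by upper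
  semicontinuity its velocities lie in the closed \<open>e\<close>-neighbourhood \<open>N\<close> of \<open>F (X t) - X t\<close>. As \<open>N\<close>
  is convex, it contains their average, the difference quotient; as it is closed, it contains the
  limit.
\<close>
theorem best_reply_inclusion_solution:
  fixes F :: "'a::euclidean_space \<Rightarrow> 'a set"
  assumes K: "compact K" "convex K" and FK: "\<And>x. x \<in> K \<Longrightarrow> F x \<subseteq> K"
    and ne: "\<And>x. x \<in> K \<Longrightarrow> F x \<noteq> {}"
    and cvx: "\<And>x. x \<in> K \<Longrightarrow> convex (F x)"
    and cg: "\<And>xs ys x y. (\<forall>n. xs n \<in> K \<and> ys n \<in> F (xs n)) \<Longrightarrow> xs \<longlonglongrightarrow> x \<Longrightarrow> ys \<longlonglongrightarrow> y \<Longrightarrow> y \<in> F x"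
    and x0: "x0 \<in> K"
  obtains X L where "X 0 = x0" "\<And>t. 0 \<le> t \<Longrightarrow> X t \<in> K" "L-lipschitz_on {0..} X"
    "\<And>t D. 0 < t \<Longrightarrow> (X has_vector_derivative D) (at t) \<Longrightarrow> D \<in> (\<lambda>y. y - X t) ` F (X t)"
proof -
  define f where "f x = (SOME y. y \<in> F x)" for x
  have f: "f x \<in> F x" if "x \<in> K" for x using ne[OF that] unfolding f_def by (simp add: some_in_eq)
  define h where "h k = 1 / real (Suc k)" for k
  have h: "h k > 0" "h k \<le> 1" for k by (auto simp: h_def)
  have h0: "h \<longlonglongrightarrow> 0" unfolding h_def using LIMSEQ_inverse_real_of_nat by (simp add: inverse_eq_divide)
  define x where "x k = rec_nat x0 (\<lambda>_ y. y + h k *\<^sub>R (f y - y))" for k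
  have x_Suc: "x k (Suc j) = x k j + h k *\<^sub>R (f (x k j) - x k j)" and x_0: "x k 0 = x0" for k j
    by (auto simp: x_def)
  have xK: "x k j \<in> K" for k j
  proof (induction j)
    case (Suc j)
    have "x k (Suc j) = (1 - h k) *\<^sub>R x k j + h k *\<^sub>R f (x k j)"
      by (simp add: x_Suc algebra_simps)
    then show ?case using convexD_alt[OF K(2) Suc, of "f (x k j)" "h k"] f[OF Suc] FK[OF Suc] h[of k] by auto
  qed (simp add: x_0 x0)
  obtain B where B: "B > 0" "\<And>y. y \<in> K \<Longrightarrow> norm y \<le> B"
    using compact_imp_bounded[OF K(1)] bounded_pos by blast
  define L where "L = 2 * B"
  have L: "L > 0" using B by (simp add: L_def)
  have step: "norm (f y - y) \<le> L" if "y \<in> K" for y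
    using norm_triangle_ineq4[of "f y" y] B(2)[OF that] B(2)[of "f y"] f[OF that] FK[OF that] by (auto simp: L_def)
  have incr: "x k (i + m) - x k i = h k *\<^sub>R (\<Sum>j<m. f (x k (i + j)) - x k (i + j))" for k i m
    by (induction m) (auto simp: x_Suc algebra_simps)
  have xlip: "norm (x k (i + m) - x k i) \<le> L * (h k * real m)" for k i m
  proof -
    have "norm (\<Sum>j<m. f (x k (i + j)) - x k (i + j)) \<le> (\<Sum>j<m. L)"
      by (rule sum_norm_le) (use step xK in auto)
    then show ?thesis using h[of k] unfolding incr by (simp add: mult_left_mono mult.assoc mult.commute mult.left_commute)
  qed
  define g where "g k t = nat \<lfloor>t / h k\<rfloor>" for k t
  have g: "real (g k t) * h k \<le> t" "t < (real (g k t) + 1) * h k" if "0 \<le> t" for k t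
  proof -
    have "real (g k t) = of_int \<lfloor>t / h k\<rfloor>" using that h[of k] by (simp add: g_def)
    then show "real (g k t) * h k \<le> t" "t < (real (g k t) + 1) * h k"
      using h(1)[of k] by (simp_all add: pos_le_divide_eq[symmetric] pos_divide_less_eq[symmetric])
  qed
  have gmono: "g k s \<le> g k t" if "0 \<le> s" "s \<le> t" for k s t
    using that h(1)[of k] unfolding g_def by (intro nat_mono floor_mono divide_right_mono) auto
  have gdiff: "h k * (real (g k t) - real (g k s)) \<le> t - s + h k" if "0 \<le> s" "s \<le> t" for k s t
    using g[of s k] g[of t k] that by (auto simp: algebra_simps)
  define Y where "Y k t = x k (g k t)" for k t
  have YK: "Y k t \<in> K" for k t using xK by (simp add: Y_def)
  have Ylip: "norm (Y k t - Y k s) \<le> L * (\<bar>t - s\<bar> + h k)" if "0 \<le> s" "0 \<le> t" for k s t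
  proof -
    have *: "norm (Y k t - Y k s) \<le> L * (t - s + h k)" if "0 \<le> s" "s \<le> t" for s t
    proof -
      have "norm (Y k t - Y k s) \<le> L * (h k * real (g k t - g k s))"
        using xlip[of k "g k s" "g k t - g k s"] gmono[OF that, of k] by (simp add: Y_def)
      also have "\<dots> \<le> L * (t - s + h k)"
        using gdiff[OF that, of k] gmono[OF that, of k] L by (intro mult_left_mono) (auto simp: of_nat_diff)
      finally show ?thesis .
    qed
    show ?thesis using *[of s t] *[of t s] that by (cases "s \<le> t") (auto simp: norm_minus_commute)
  qed
  obtain r :: "nat \<Rightarrow> nat" where r: "strict_mono r" "\<And>q. q \<in> \<rat> \<Longrightarrow> \<exists>l. (\<lambda>n. Y (r n) q) \<longlonglongrightarrow> l"
    using function_convergent_subsequence[of "\<rat>" Y B] countable_rat B(2) YK by metis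
  have hr: "(\<lambda>n. h (r n)) \<longlonglongrightarrow> 0" using LIMSEQ_subseq_LIMSEQ[OF h0 r(1)] by (simp add: o_def)
  have "convergent (\<lambda>n. Y (r n) t)" if "0 \<le> t" for t
    by (rule convergent_from_dense[where c="\<lambda>n. h (r n)" and L=L])
       (use L Ylip hr r(2) that in \<open>auto simp: convergent_def\<close>)
  then obtain X where X: "\<And>t. 0 \<le> t \<Longrightarrow> (\<lambda>n. Y (r n) t) \<longlonglongrightarrow> X t"
    unfolding convergent_def by metis
  have XK: "X t \<in> K" if "0 \<le> t" for t
    using closed_sequentially[OF compact_imp_closed[OF K(1)] _ X[OF that]] YK by blast
  have Xlip: "L-lipschitz_on {0..} X"
  proof (rule lipschitz_onI)
    fix s t :: real assume st: "s \<in> {0..}" "t \<in> {0..}"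
    have "norm (X s - X t) \<le> L * (\<bar>s - t\<bar> + 0)"
    proof (rule LIMSEQ_le)
      show "(\<lambda>n. norm (Y (r n) s - Y (r n) t)) \<longlonglongrightarrow> norm (X s - X t)"
        using st by (intro tendsto_intros X) auto
      show "(\<lambda>n. L * (\<bar>s - t\<bar> + h (r n))) \<longlonglongrightarrow> L * (\<bar>s - t\<bar> + 0)"
        by (intro tendsto_intros hr)
    qed (use Ylip st in auto)
    then show "dist (X s) (X t) \<le> L * dist s t" by (simp add: dist_norm)
  qed (use L in simp)
  have X0: "X 0 = x0"
  proof -
    have "Y (r n) 0 = x0" for n by (simp add: Y_def g_def x_0)
    then show ?thesis using X[of 0] LIMSEQ_unique tendsto_const by fastforce
  qed
  have incl: "D \<in> (\<lambda>y. y - X t) ` F (X t)" if t: "0 < t" and D: "(X has_vector_derivative D) (at t)" for t D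
  proof -
    let ?x = "X t"
    have xin: "?x \<in> K" using XK t by simp
    have Fcl: "closed (F ?x)"
      unfolding closed_sequential_limits using cg[of "\<lambda>_. ?x" _ ?x] xin by auto
    have Fcp: "compact (F ?x)" using compact_Int_closed[OF K(1) Fcl] FK[OF xin] by (simp add: Int_absorb1)
    define G where "G = (\<lambda>y. y - ?x) ` F ?x"
    have Gcl: "closed G" "convex G" "G \<noteq> {}"
      using Fcl cvx[OF xin] ne[OF xin] by (auto simp: G_def closed_translation_subtract convex_translation_subtract)
    have near: "infdist D G \<le> e" if e: "e > 0" for e
    proof -
      obtain d where d: "d > 0" "\<And>x' y. x' \<in> K \<Longrightarrow> dist x' ?x < d \<Longrightarrow> y \<in> F x' \<Longrightarrow> \<exists>z\<in>F ?x. dist y z \<le> e/2"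
      proof -
        have "\<exists>d>0. \<forall>x'\<in>K. dist x' ?x < d \<longrightarrow> (\<forall>y\<in>F x'. \<exists>z\<in>F ?x. dist y z \<le> e/2)"
          by (rule closed_graph_usc[where K=K and F=F]) (use K(1) FK cg e xin ne[OF xin] in \<open>blast | simp\<close>)+
        then show ?thesis using that by blast
      qed
      define d' where "d' = min d (e/2)"
      have d': "d' > 0" "d' \<le> d" "d' \<le> e/2" using d e by (auto simp: d'_def)
      define N where "N = {y. infdist y G \<le> e}"
      have "N = (\<Union>z\<in>G. \<Union>w\<in>cball 0 e. {z + w})"
      proof safe
        fix y assume y: "y \<in> N"
        obtain z where z: "z \<in> G" "infdist y G = dist y z" using infdist_attains_inf[OF Gcl(1,3)] by blast
        then have "y - z \<in> cball 0 e" using y by (simp add: N_def dist_norm norm_minus_commute)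
        moreover have "y \<in> {z + (y - z)}" by simp
        ultimately show "y \<in> (\<Union>z\<in>G. \<Union>w\<in>cball 0 e. {z + w})" using z(1) by blast
      next
        fix z w :: 'a assume "z \<in> G" "w \<in> cball 0 e"
        then show "z + w \<in> N" using infdist_le[of z G "z + w"] by (simp add: N_def dist_norm)
      qed
      then have Ncvx: "convex N" using convex_sums[OF Gcl(2) convex_cball, of 0 e] by simp
      have Ncl: "closed N" unfolding N_def by (intro closed_Collect_le continuous_intros)
      have inN: "f y - y \<in> N" if y: "y \<in> K" "dist y ?x < d'" for y
      proof -
        obtain z where z: "z \<in> F ?x" "dist (f y) z \<le> e/2" using d(2)[OF y(1) _ f[OF y(1)]] y d' by auto
        have "dist (f y - y) (z - ?x) = norm ((f y - z) - (y - ?x))" by (simp add: dist_norm algebra_simps)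
        also have "\<dots> \<le> dist (f y) z + dist y ?x" unfolding dist_norm by (rule norm_triangle_ineq4)
        also have "\<dots> \<le> e" using z y d' by simp
        finally show ?thesis using z infdist_le[of "z - ?x" G "f y - y"] by (auto simp: N_def G_def)
      qed
      \<comment> \<open>For \<open>s < s1\<close> and steps below \<open>s1\<close> the elapsed time is at most \<open>2 s1\<close>, hence the drift at most \<open>d' / 2\<close>.\<close>
      define s1 where "s1 = d' / (4 * L)"
      have s1: "s1 > 0" using d' L by (simp add: s1_def)
      have quot: "(1 / s) *\<^sub>R (X (t + s) - X t) \<in> N" if s: "0 < s" "s < s1" for s
      proof -
        define m where "m n = g (r n) (t + s) - g (r n) t" for n
        have rm: "real (m n) = real (g (r n) (t + s)) - real (g (r n) t)" for n
          using gmono[of t "t + s" "r n"] s t by (simp add: m_def)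
        have hm: "\<bar>h (r n) * real (m n) - s\<bar> \<le> h (r n)" for n
          using g[of t "r n"] g[of "t + s" "r n"] s t by (auto simp: rm algebra_simps abs_le_iff)
        have hmlim: "(\<lambda>n. h (r n) * real (m n)) \<longlonglongrightarrow> s"
          by (rule Lim_transform_bound[where g="\<lambda>n. h (r n)" and f="\<lambda>n. h (r n) * real (m n) - s", THEN LIM_zero_cancel])
             (use hm hr h in \<open>auto intro!: always_eventually simp: less_imp_le\<close>)
        have qlim: "(\<lambda>n. (1 / (h (r n) * real (m n))) *\<^sub>R (Y (r n) (t + s) - Y (r n) t)) \<longlonglongrightarrow> (1 / s) *\<^sub>R (X (t + s) - X t)"
          using s t by (intro tendsto_intros hmlim X) auto
        have "\<forall>\<^sub>F n in sequentially. dist (Y (r n) t) ?x < d'/4"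
          using X[of t] t d' by (intro tendstoD) auto
        moreover have "\<forall>\<^sub>F n in sequentially. h (r n) < s1" using hr s1 by (rule order_tendstoD)
        moreover have "\<forall>\<^sub>F n in sequentially. h (r n) * real (m n) > 0" using hmlim s(1) by (rule order_tendstoD)
        ultimately have "\<forall>\<^sub>F n in sequentially. (1 / (h (r n) * real (m n))) *\<^sub>R (Y (r n) (t + s) - Y (r n) t) \<in> N"
        proof eventually_elim
          case (elim n)
          define k i where "k = r n" and "i = g k t"
          have mp: "m n > 0" using elim(3) by (auto intro: Nat.gr0I)
          have hms: "h k * real (m n) \<le> 2 * s1" using hm[of n] elim(2) s by (auto simp: k_def abs_le_iff)
          have nearx: "dist (x k (i + j)) ?x < d'" if j: "j < m n" for j
          proof -
            have "norm (x k (i + j) - x k i) \<le> L * (h k * real j)" by (rule xlip)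
            also have "\<dots> \<le> L * (h k * real (m n))" using j L h[of k] by (intro mult_left_mono) auto
            also have "\<dots> \<le> L * (2 * s1)" using hms L by (intro mult_left_mono) auto
            also have "\<dots> = d'/2" using L by (simp add: s1_def)
            finally have "dist (x k (i + j)) (x k i) \<le> d'/2" by (simp add: dist_norm)
            moreover have "dist (x k i) ?x < d'/4" using elim(1) by (simp add: Y_def k_def i_def)
            ultimately show ?thesis using dist_triangle[of "x k (i+j)" ?x "x k i"] d' by simp
          qed
          have "Y k (t + s) - Y k t = h k *\<^sub>R (\<Sum>j<m n. f (x k (i + j)) - x k (i + j))"
            using incr[of k i "m n"] gmono[of t "t + s" k] s t by (simp add: Y_def i_def m_def k_def)
          then have "(1 / (h k * real (m n))) *\<^sub>R (Y k (t + s) - Y k t) = (\<Sum>j<m n. (1 / real (m n)) *\<^sub>R (f (x k (i + j)) - x k (i + j)))"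
            using h(1)[of k] by (simp add: scaleR_sum_right[symmetric])
          also have "\<dots> \<in> N"
            by (rule convex_sum) (use Ncvx mp inN xK nearx in auto)
          finally show ?case by (simp add: k_def)
        qed
        then show ?thesis using Lim_in_closed_set[OF Ncl _ _ qlim] by simp
      qed
      have "((\<lambda>s. (1 / s) *\<^sub>R (X (t + s) - X t)) \<longlongrightarrow> D) (at_right 0)"
      proof (rule tendstoI)
        fix \<epsilon> :: real assume \<epsilon>: "\<epsilon> > 0"
        obtain d where d: "d > 0" "\<And>y. norm (y - t) < d \<Longrightarrow> norm (X y - X t - (y - t) *\<^sub>R D) \<le> \<epsilon>/2 * norm (y - t)"
          using D half_gt_zero[OF \<epsilon>] unfolding has_vector_derivative_def has_derivative_at_alt by meson
        have "dist ((1 / s) *\<^sub>R (X (t + s) - X t)) D < \<epsilon>" if s: "0 < s" "s < d" for s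
        proof -
          have "(1 / s) *\<^sub>R (X (t + s) - X t) - D = (1 / s) *\<^sub>R (X (t + s) - X t - (t + s - t) *\<^sub>R D)"
            using s by (simp add: scaleR_diff_right)
          then have "dist ((1 / s) *\<^sub>R (X (t + s) - X t)) D = norm (X (t + s) - X t - (t + s - t) *\<^sub>R D) / s"
            using s by (simp only: dist_norm norm_scaleR) simp
          also have "\<dots> \<le> \<epsilon>/2" using d(2)[of "t + s"] s by (simp add: divide_le_eq)
          finally show ?thesis using \<epsilon> by simp
        qed
        then show "eventually (\<lambda>s. dist ((1 / s) *\<^sub>R (X (t + s) - X t)) D < \<epsilon>) (at_right 0)"
          unfolding eventually_at_right[OF d(1)] using d(1) by blast
      qed
      moreover have "eventually (\<lambda>s. (1 / s) *\<^sub>R (X (t + s) - X t) \<in> N) (at_right 0)"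
        unfolding eventually_at_right[OF s1] using quot s1 by blast
      ultimately have "D \<in> N" by (intro Lim_in_closed_set[OF Ncl]) auto
      then show ?thesis by (simp add: N_def)
    qed
    then have "infdist D G \<le> 0" by (meson field_le_epsilon add_0 dense_ge)
    then have "D \<in> G" using Gcl in_closed_iff_infdist_zero infdist_nonneg by (metis order_antisym)
    then show ?thesis by (simp add: G_def)
  qed
  show ?thesis using that[OF X0 XK Xlip incl] by blast
qed

section \<open>Best response dynamics of convex-concave games\<close>

lemma lipschitz_on_bilinear:
  assumes B: "bounded_bilinear B" and f: "Lf-lipschitz_on K f" and g: "Lg-lipschitz_on K g"
    and bf: "bounded (f ` K)" and bg: "bounded (g ` K)"
  shows "\<exists>L. L-lipschitz_on K (\<lambda>x. B (f x) (g x))"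
proof -
  interpret bounded_bilinear B by fact
  obtain C where C: "C > 0" "\<And>a b. norm (B a b) \<le> norm a * norm b * C" using pos_bounded by blast
  obtain Mf where Mf: "Mf > 0" "\<And>x. x \<in> K \<Longrightarrow> norm (f x) \<le> Mf" using bf bounded_pos by (metis imageI)
  obtain Mg where Mg: "Mg > 0" "\<And>x. x \<in> K \<Longrightarrow> norm (g x) \<le> Mg" using bg bounded_pos by (metis imageI)
  have Lf: "Lf \<ge> 0" and Lg: "Lg \<ge> 0" using f g lipschitz_on_nonneg by auto
  have "((Lf * Mg + Mf * Lg) * C)-lipschitz_on K (\<lambda>x. B (f x) (g x))"
  proof (rule lipschitz_onI)
    fix x y assume xy: "x \<in> K" "y \<in> K"
    have "B (f x) (g x) - B (f y) (g y) = B (f x - f y) (g x) + B (f y) (g x - g y)"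
      by (simp add: diff_left diff_right)
    then have "dist (B (f x) (g x)) (B (f y) (g y)) \<le> norm (B (f x - f y) (g x)) + norm (B (f y) (g x - g y))"
      by (simp add: dist_norm norm_triangle_ineq)
    also have "\<dots> \<le> norm (f x - f y) * norm (g x) * C + norm (f y) * norm (g x - g y) * C"
      by (intro add_mono C)
    also have "\<dots> \<le> (Lf * dist x y) * Mg * C + Mf * (Lg * dist x y) * C"
      using lipschitz_onD[OF f xy] lipschitz_onD[OF g xy] Mf(2)[OF xy(2)] Mg(2)[OF xy(1)] C(1) Mf(1) Mg(1) Lf Lg
      by (intro add_mono mult_right_mono mult_mono) (auto simp: dist_norm)
    finally show "dist (B (f x) (g x)) (B (f y) (g y)) \<le> (Lf * Mg + Mf * Lg) * C * dist x y"
      by (simp add: algebra_simps)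
  qed (use C Lf Lg Mf Mg in simp)
  then show ?thesis by blast
qed

definition max_payoff :: "('a \<Rightarrow> 'b \<Rightarrow> real) \<Rightarrow> 'b set \<Rightarrow> 'a \<Rightarrow> real" where
  "max_payoff J G x = Sup (J x ` G)"

locale convex_concave_game =
  fixes S :: "'a::euclidean_space set" and G :: "'b::euclidean_space set"
    and J :: "'a \<Rightarrow> 'b \<Rightarrow> real" and L :: real
  assumes S: "compact S" "convex S" "S \<noteq> {}" and G: "compact G" "convex G" "G \<noteq> {}"
    and lip: "L-lipschitz_on (S \<times> G) (\<lambda>z. J (fst z) (snd z))"
    and cvx: "\<And>y. y \<in> G \<Longrightarrow> convex_on S (\<lambda>x. J x y)"
    and ccv: "\<And>x. x \<in> S \<Longrightarrow> convex_on G (\<lambda>y. - J x y)"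
begin

text \<open>
  Exchanging the players and the sign of the payoff gives a game of the same kind; every statement
  about the minimizer is obtained from one about the maximizer in this way.
\<close>
lemma dual: "convex_concave_game G S (\<lambda>y x. - J x y) L"
proof
  show "L-lipschitz_on (G \<times> S) (\<lambda>z. - J (snd z) (fst z))"
  proof (rule lipschitz_onI)
    fix p q assume pq: "p \<in> G \<times> S" "q \<in> G \<times> S"
    have "dist (- J (snd p) (fst p)) (- J (snd q) (fst q)) = dist (J (snd p) (fst p)) (J (snd q) (fst q))"
      by (simp add: dist_real_def abs_minus_commute)
    also have "\<dots> \<le> L * dist (snd p, fst p) (snd q, fst q)"
      using lipschitz_onD[OF lip, of "(snd p, fst p)" "(snd q, fst q)"] pq by (auto simp: mem_Times_iff)
    also have "dist (snd p, fst p) (snd q, fst q) = dist p q"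
      by (simp add: dist_prod_def add.commute)
    finally show "dist (- J (snd p) (fst p)) (- J (snd q) (fst q)) \<le> L * dist p q" .
  qed (use lip lipschitz_on_nonneg in blast)
qed (use S G cvx ccv in auto)

lemma J_lip: "x \<in> S \<Longrightarrow> x' \<in> S \<Longrightarrow> y \<in> G \<Longrightarrow> y' \<in> G \<Longrightarrow> \<bar>J x y - J x' y'\<bar> \<le> L * dist (x, y) (x', y')"
  using lipschitz_onD[OF lip, of "(x,y)" "(x',y')"] by (simp add: dist_real_def)

lemma J_lip_fst: "x \<in> S \<Longrightarrow> x' \<in> S \<Longrightarrow> y \<in> G \<Longrightarrow> \<bar>J x y - J x' y\<bar> \<le> L * dist x x'"
  using J_lip[of x x' y y] by (simp add: dist_prod_def)

lemma J_tendsto: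
  assumes "\<And>n::nat. xs n \<in> S" "\<And>n. ys n \<in> G" "x \<in> S" "y \<in> G" "xs \<longlonglongrightarrow> x" "ys \<longlonglongrightarrow> y"
  shows "(\<lambda>n. J (xs n) (ys n)) \<longlonglongrightarrow> J x y"
proof -
  have c: "continuous_on (S \<times> G) (\<lambda>z. J (fst z) (snd z))" using lip by (rule lipschitz_on_continuous_on)
  show ?thesis
    using continuous_on_tendsto_compose[OF c tendsto_Pair[OF assms(5,6)]] assms(1-4) by auto
qed

lemma J_cont_snd: "x \<in> S \<Longrightarrow> continuous_on G (J x)"
  by (rule lipschitz_on_continuous_on[of L], rule lipschitz_onI)
     (use J_lip[of x x] lipschitz_on_nonneg[OF lip] in \<open>auto simp: dist_real_def dist_prod_def\<close>)

abbreviation "upper \<equiv> max_payoff J G"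

lemma upper_attained:
  assumes "x \<in> S" obtains y where "y \<in> G" "J x y = upper x" "\<And>y'. y' \<in> G \<Longrightarrow> J x y' \<le> upper x"
proof -
  obtain y where y: "y \<in> G" "\<And>y'. y' \<in> G \<Longrightarrow> J x y' \<le> J x y"
    using continuous_attains_sup[OF G(1,3) J_cont_snd[OF assms]] by blast
  have "upper x = J x y" unfolding max_payoff_def using y by (intro cSup_eq_maximum) auto
  then show ?thesis using that y by auto
qed

lemma J_le_upper: "x \<in> S \<Longrightarrow> y \<in> G \<Longrightarrow> J x y \<le> upper x"
  by (metis upper_attained)

lemma upper_lipschitz: "L-lipschitz_on S upper"
proof (rule lipschitz_onI)
  have *: "upper x - upper x' \<le> L * dist x x'" if xx: "x \<in> S" "x' \<in> S" for x x'
  proof -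
    obtain y where y: "y \<in> G" "J x y = upper x" using upper_attained[OF xx(1)] by blast
    show ?thesis using J_lip_fst[OF xx y(1)] J_le_upper[OF xx(2) y(1)] y(2) by auto
  qed
  show "dist (upper x) (upper x') \<le> L * dist x x'" if "x \<in> S" "x' \<in> S" for x x'
    using *[OF that] *[OF that(2,1)] by (simp add: dist_real_def dist_commute abs_le_iff)
qed (use lip lipschitz_on_nonneg in blast)

text \<open>
  The envelope argument. With \<open>g x = J x ys\<close> we have \<open>upper (X m) \<ge> g (X m)\<close> with equality at
  \<open>m = l\<close>, so \<open>D\<close> is at most the limit of \<open>(g (X l) - g (X (l - h))) / h\<close>. To bound this by convexity
  without leaving \<open>S\<close> or differentiating \<open>g\<close>, the point \<open>X l\<close> is compared with the point \<open>z\<close> that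
  divides the segment from \<open>X (l - h)\<close> to \<open>xs\<close> in the ratio \<open>h : 1\<close>. Since \<open>X\<close> has velocity
  \<open>xs - X l\<close>, the distance of \<open>z\<close> from \<open>X l\<close> is of smaller order than \<open>h\<close>.
\<close>
lemma upper_derivative_le:
  assumes X: "\<And>l. l \<ge> 0 \<Longrightarrow> X l \<in> S" and l: "l > 0"
    and dX: "(X has_vector_derivative xs - X l) (at l)" and xs: "xs \<in> S"
    and ys: "ys \<in> G" "\<And>y. y \<in> G \<Longrightarrow> J (X l) y \<le> J (X l) ys"
    and dA: "((\<lambda>l. upper (X l)) has_real_derivative D) (at l)"
  shows "D \<le> J xs ys - upper (X l)"
proof (rule field_le_epsilon)
  fix e0 :: real assume e0: "e0 > 0"
  have L0: "L \<ge> 0" using lip lipschitz_on_nonneg by blast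
  define e where "e = e0 / (1 + L)"
  have e: "e > 0" "(1 + L) * e = e0" using e0 L0 by (auto simp: e_def)
  let ?x = "X l"
  have xl: "?x \<in> S" using X l by simp
  obtain d1 where d1: "d1 > 0" "\<And>y. norm (y - l) < d1 \<Longrightarrow> norm (X y - X l - (y - l) *\<^sub>R (xs - X l)) \<le> e * norm (y - l)"
    using dX e unfolding has_vector_derivative_def has_derivative_at_alt by blast
  obtain d2 where d2: "d2 > 0" "\<And>y. norm (y - l) < d2 \<Longrightarrow> norm (upper (X y) - upper (X l) - D * (y - l)) \<le> e * norm (y - l)"
    using dA e unfolding has_field_derivative_def has_derivative_at_alt by blast
  define h where "h = min l (min d1 d2) / 2"
  have h: "h > 0" "h < l" "h < d1" "h < d2" using l d1(1) d2(1) by (auto simp: h_def)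
  define u where "u = X (l - h)"
  have u: "u \<in> S" using X h by (simp add: u_def)
  define z where "z = (1 - h / (1 + h)) *\<^sub>R u + (h / (1 + h)) *\<^sub>R xs"
  have z: "z \<in> S" unfolding z_def using convexD_alt[OF S(2) u xs, of "h / (1+h)"] h by auto
  have c: "1 - h / (1 + h) = 1 / (1 + h)" using h by (simp add: field_simps)
  have h1: "(1 + h) * (1 / (1 + h)) = 1" "(1 + h) * (h / (1 + h)) = h" using h by auto
  have "(1 + h) *\<^sub>R (z - ?x) = u + h *\<^sub>R xs - (1 + h) *\<^sub>R ?x"
    unfolding z_def c by (simp only: scaleR_diff_right scaleR_add_right scaleR_scaleR h1 scaleR_one)
  also have "\<dots> = X (l - h) - X l - (l - h - l) *\<^sub>R (xs - X l)"
    by (simp add: u_def algebra_simps)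
  finally have "norm ((1 + h) *\<^sub>R (z - ?x)) \<le> e * h"
    using d1(2)[of "l - h"] h by simp
  then have "(1 + h) * norm (z - ?x) \<le> e * h" using h by simp
  then have "L * ((1 + h) * norm (z - ?x)) \<le> L * (e * h)" using L0 by (rule mult_left_mono)
  then have n: "(1 + h) * (L * norm (z - ?x)) \<le> L * e * h" by (simp add: algebra_simps)
  have "J ?x ys \<le> J z ys + L * norm (z - ?x)"
    using J_lip_fst[OF xl z ys(1)] by (simp add: dist_norm norm_minus_commute abs_le_iff)
  also have "J z ys \<le> (1 / (1 + h)) * J u ys + (h / (1 + h)) * J xs ys"
    using convex_onD[OF cvx[OF ys(1)], of "h / (1 + h)" u xs] u xs h unfolding z_def c by simp
  finally have "(1 + h) * J ?x ys \<le> (1 + h) * ((1 / (1 + h)) * J u ys + (h / (1 + h)) * J xs ys + L * norm (z - ?x))"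
    using h by (intro mult_left_mono) auto
  also have "\<dots> = J u ys + h * J xs ys + (1 + h) * (L * norm (z - ?x))"
    using h by (simp add: distrib_left)
  finally have 1: "(1 + h) * J ?x ys \<le> J u ys + h * J xs ys + L * e * h" using n by simp
  have eq: "J ?x ys = upper ?x"
    using ys upper_attained[OF xl] by (metis order_antisym)
  have "h * D - e * h \<le> upper ?x - upper u"
    using d2(2)[of "l - h"] h by (simp add: u_def abs_le_iff algebra_simps)
  also have "\<dots> \<le> J ?x ys - J u ys" using eq J_le_upper[OF u ys(1)] by simp
  also have "\<dots> \<le> h * (J xs ys - J ?x ys + L * e)" using 1 by (simp add: algebra_simps)
  finally have "h * D \<le> h * (J xs ys - upper ?x + e0)"
    using eq unfolding e(2)[symmetric] by (simp add: algebra_simps)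
  then show "D \<le> J xs ys - upper ?x + e0" using h by simp
qed

text \<open>
  The minimum of \<open>J x y\<close> over \<open>x\<close>, written as the upper value of the dual game so that it inherits
  the properties of \<open>upper\<close>.
\<close>
definition lower :: "'b \<Rightarrow> real" where "lower y = - max_payoff (\<lambda>y x. - J x y) S y"

interpretation D: convex_concave_game G S "\<lambda>y x. - J x y" L by (rule dual)

lemma lower_attained:
  assumes "y \<in> G" obtains x where "x \<in> S" "J x y = lower y" "\<And>x'. x' \<in> S \<Longrightarrow> lower y \<le> J x' y"
  using D.upper_attained[OF assms] unfolding lower_def by (metis minus_le_iff minus_minus)

lemma lower_le_J: "x \<in> S \<Longrightarrow> y \<in> G \<Longrightarrow> lower y \<le> J x y"
  by (metis lower_attained)

definition gap :: "'a \<Rightarrow> 'b \<Rightarrow> real" where "gap x y = upper x - lower y"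

definition min_reply :: "'b \<Rightarrow> 'a set" where "min_reply y = {x\<in>S. \<forall>x'\<in>S. J x y \<le> J x' y}"
definition max_reply :: "'a \<Rightarrow> 'b set" where "max_reply x = {y\<in>G. \<forall>y'\<in>G. J x y' \<le> J x y}"

definition saddles :: "('a \<times> 'b) set" where
  "saddles = {(x, y). x \<in> min_reply y \<and> y \<in> max_reply x}"

lemma gap_nonneg: "x \<in> S \<Longrightarrow> y \<in> G \<Longrightarrow> 0 \<le> gap x y"
  using J_le_upper lower_le_J unfolding gap_def by fastforce

lemma gap_zero_iff:
  assumes "x \<in> S" "y \<in> G" shows "gap x y = 0 \<longleftrightarrow> (x, y) \<in> saddles"
proof
  assume "gap x y = 0"
  then have "J x y = upper x" "J x y = lower y"
    using J_le_upper[OF assms] lower_le_J[OF assms] by (auto simp: gap_def)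
  then show "(x, y) \<in> saddles"
    using assms J_le_upper[OF assms(1)] lower_le_J[OF _ assms(2)]
    unfolding saddles_def min_reply_def max_reply_def by simp
next
  assume s: "(x, y) \<in> saddles"
  obtain y' where "y' \<in> G" "J x y' = upper x" using upper_attained[OF assms(1)] by blast
  then have "upper x \<le> J x y" using s by (auto simp: saddles_def max_reply_def)
  moreover obtain x' where "x' \<in> S" "J x' y = lower y" using lower_attained[OF assms(2)] by blast
  then have "J x y \<le> lower y" using s by (auto simp: saddles_def min_reply_def)
  ultimately show "gap x y = 0" using gap_nonneg[OF assms] by (simp add: gap_def)
qed

lemma lower_lipschitz: "L-lipschitz_on G lower"
  using D.upper_lipschitz unfolding lower_def[abs_def] by simp

lemma gap_lipschitz: "(L + L)-lipschitz_on (S \<times> G) (\<lambda>z. gap (fst z) (snd z))"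
proof (rule lipschitz_onI)
  have L0: "L \<ge> 0" using lip lipschitz_on_nonneg by blast
  fix p q assume pq: "p \<in> S \<times> G" "q \<in> S \<times> G"
  have "\<bar>upper (fst p) - upper (fst q)\<bar> \<le> L * dist (fst p) (fst q)"
    using lipschitz_onD[OF upper_lipschitz, of "fst p" "fst q"] pq by (auto simp: dist_real_def)
  moreover have "\<bar>lower (snd p) - lower (snd q)\<bar> \<le> L * dist (snd p) (snd q)"
    using lipschitz_onD[OF lower_lipschitz, of "snd p" "snd q"] pq by (auto simp: dist_real_def)
  moreover have "L * dist (fst p) (fst q) \<le> L * dist p q" "L * dist (snd p) (snd q) \<le> L * dist p q"
    by (intro mult_left_mono dist_fst_le dist_snd_le L0)+
  ultimately show "dist (gap (fst p) (snd p)) (gap (fst q) (snd q)) \<le> (L + L) * dist p q"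
    by (simp add: dist_real_def gap_def abs_le_iff algebra_simps)
qed (use lip lipschitz_on_nonneg in force)

definition br_curve :: "(real \<Rightarrow> 'a) \<Rightarrow> (real \<Rightarrow> 'b) \<Rightarrow> bool" where
  "br_curve X Y \<longleftrightarrow> (\<forall>l\<ge>0. X l \<in> S \<and> Y l \<in> G) \<and> abs_cont_halfline X \<and> abs_cont_halfline Y \<and>
     (AE l in lborel. 0 \<le> l \<longrightarrow> (\<exists>X' Y'.
        (X has_vector_derivative X') (at l within {0..}) \<and>
        (Y has_vector_derivative Y') (at l within {0..}) \<and>
        X' \<in> (\<lambda>z. z - X l) ` min_reply (Y l) \<and>
        Y' \<in> (\<lambda>z. z - Y l) ` max_reply (X l)))"

text \<open>
  Velocities are differences of points of bounded sets.
\<close>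
lemma br_curve_lipschitz:
  assumes "br_curve X Y"
  obtains M where "M-lipschitz_on {0..} X" "M-lipschitz_on {0..} Y"
proof -
  obtain B1 where B1: "B1 > 0" "\<And>x. x \<in> S \<Longrightarrow> norm x \<le> B1" using compact_imp_bounded[OF S(1)] bounded_pos by blast
  obtain B2 where B2: "B2 > 0" "\<And>x. x \<in> G \<Longrightarrow> norm x \<le> B2" using compact_imp_bounded[OF G(1)] bounded_pos by blast
  define M where "M = 2 * B1 + 2 * B2"
  have M: "M \<ge> 0" using B1 B2 by (simp add: M_def)
  have in': "\<And>l. l \<ge> 0 \<Longrightarrow> X l \<in> S" "\<And>l. l \<ge> 0 \<Longrightarrow> Y l \<in> G"
    and ac: "abs_cont_halfline X" "abs_cont_halfline Y"
    and ae: "AE l in lborel. 0 \<le> l \<longrightarrow> (\<exists>X' Y'.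
        (X has_vector_derivative X') (at l within {0..}) \<and>
        (Y has_vector_derivative Y') (at l within {0..}) \<and>
        X' \<in> (\<lambda>z. z - X l) ` min_reply (Y l) \<and>
        Y' \<in> (\<lambda>z. z - Y l) ` max_reply (X l))"
    using assms by (auto simp: br_curve_def)
  have nS: "norm (z - X l) \<le> M" if "l \<ge> 0" "z \<in> S" for z l
    using norm_triangle_ineq4[of z "X l"] B1(2)[OF that(2)] B1(2)[OF in'(1)[OF that(1)]] B2(1) by (simp add: M_def)
  have nG: "norm (z - Y l) \<le> M" if "l \<ge> 0" "z \<in> G" for z l
    using norm_triangle_ineq4[of z "Y l"] B2(2)[OF that(2)] B2(2)[OF in'(2)[OF that(1)]] B1(1) by (simp add: M_def)
  show ?thesis
  proof
    show "M-lipschitz_on {0..} X"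
      by (rule abs_cont_bounded_deriv_lipschitz[OF ac(1) M], rule AE_mp[OF ae], intro AE_I2)
         (use nS in \<open>auto simp: min_reply_def\<close>)
    show "M-lipschitz_on {0..} Y"
      by (rule abs_cont_bounded_deriv_lipschitz[OF ac(2) M], rule AE_mp[OF ae], intro AE_I2)
         (use nG in \<open>auto simp: max_reply_def\<close>)
  qed
qed

text \<open>
  The envelope estimates for the two players add up, because the term \<open>J xs ys\<close> cancels. The
  exponential bound is the statement that \<open>exp l * v l\<close> is non-increasing, which holds since this
  function is Lipschitz on bounded intervals and its derivative is almost everywhere at most zero.
\<close>
theorem gap_lyapunov:
  assumes sol: "br_curve X Y"
  defines "v \<equiv> \<lambda>l. gap (X l) (Y l)"
  shows "abs_cont_halfline v"
    and "AE l in lborel. 0 \<le> l \<longrightarrow> (\<exists>v'. (v has_real_derivative v') (at l within {0..}) \<and> v' \<le> - v l)"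
    and "\<And>s t. 0 \<le> s \<Longrightarrow> s \<le> t \<Longrightarrow> v t \<le> exp (s - t) * v s"
proof -
  obtain M where MX: "M-lipschitz_on {0..} X" and MY: "M-lipschitz_on {0..} Y"
    using br_curve_lipschitz[OF sol] by blast
  have in': "\<And>l. l \<ge> 0 \<Longrightarrow> X l \<in> S" "\<And>l. l \<ge> 0 \<Longrightarrow> Y l \<in> G"
    and ae: "AE l in lborel. 0 \<le> l \<longrightarrow> (\<exists>X' Y'.
        (X has_vector_derivative X') (at l within {0..}) \<and>
        (Y has_vector_derivative Y') (at l within {0..}) \<and>
        X' \<in> (\<lambda>z. z - X l) ` min_reply (Y l) \<and>
        Y' \<in> (\<lambda>z. z - Y l) ` max_reply (X l))"
    using sol by (auto simp: br_curve_def)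
  have lA: "(L * M)-lipschitz_on {0..} (\<lambda>l. upper (X l))"
    by (rule lipschitz_on_compose2[OF MX lipschitz_on_subset[OF upper_lipschitz]]) (use in' in auto)
  have lC: "(L * M)-lipschitz_on {0..} (\<lambda>l. max_payoff (\<lambda>y x. - J x y) S (Y l))"
    by (rule lipschitz_on_compose2[OF MY lipschitz_on_subset[OF D.upper_lipschitz]]) (use in' in auto)
  have veq: "v = (\<lambda>l. upper (X l) + max_payoff (\<lambda>y x. - J x y) S (Y l))"
    by (simp add: v_def gap_def lower_def)
  have lv: "(L * M + L * M)-lipschitz_on {0..} v"
    unfolding veq by (rule lipschitz_on_add[OF lA lC])
  show "abs_cont_halfline v"
    unfolding abs_cont_halfline_def
    by (auto intro!: lipschitz_imp_abs_cont_on[OF lipschitz_on_subset[OF lv]])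
  show dv: "AE l in lborel. 0 \<le> l \<longrightarrow> (\<exists>v'. (v has_real_derivative v') (at l within {0..}) \<and> v' \<le> - v l)"
    using ae lipschitz_ae_differentiable[OF lA] lipschitz_ae_differentiable[OF lC] AE_lborel_singleton[of 0]
  proof eventually_elim
    case (elim l)
    show ?case
    proof
      assume "0 \<le> l"
      then have l: "0 < l" using elim(4) by simp
      have atl: "at l within {0..} = at l" using l by (intro at_within_interior) (simp add: interior_Ici[of "-1"])
      obtain xs ys where xy: "xs \<in> min_reply (Y l)" "ys \<in> max_reply (X l)"
        "(X has_vector_derivative xs - X l) (at l)" "(Y has_vector_derivative ys - Y l) (at l)"
        using elim(1) l unfolding atl by auto
      obtain D1 where D1: "((\<lambda>l. upper (X l)) has_real_derivative D1) (at l)"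
        using elim(2) l by (auto simp: has_real_derivative_iff_has_vector_derivative)
      obtain D2 where D2: "((\<lambda>l. max_payoff (\<lambda>y x. - J x y) S (Y l)) has_real_derivative D2) (at l)"
        using elim(3) l by (auto simp: has_real_derivative_iff_has_vector_derivative)
      have "D1 \<le> J xs ys - upper (X l)"
        by (rule upper_derivative_le[OF in'(1) l xy(3) _ _ _ D1])
           (use xy in \<open>auto simp: min_reply_def max_reply_def\<close>)
      moreover have "D2 \<le> - J xs ys - max_payoff (\<lambda>y x. - J x y) S (Y l)"
        by (rule D.upper_derivative_le[OF in'(2) l xy(4) _ _ _ D2])
           (use xy in \<open>auto simp: min_reply_def max_reply_def\<close>)
      ultimately have "D1 + D2 \<le> - v l" by (simp add: veq)
      moreover have "(v has_real_derivative D1 + D2) (at l)" unfolding veq by (rule DERIV_add[OF D1 D2])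
      ultimately show "\<exists>v'. (v has_real_derivative v') (at l within {0..}) \<and> v' \<le> - v l"
        unfolding atl by blast
    qed
  qed
  show "v t \<le> exp (s - t) * v s" if st: "0 \<le> s" "s \<le> t" for s t
  proof -
    define w where "w l = exp l * v l" for l
    have K: "(exp t)-lipschitz_on {s..t} exp"
    proof (rule lipschitz_onI)
      fix x y assume xy: "x \<in> {s..t}" "y \<in> {s..t}"
      have "norm (exp x - exp y) \<le> exp t * norm (x - y)"
        by (rule field_differentiable_bound[OF convex_real_interval(5), where f=exp and f'=exp, of s t])
           (use xy in \<open>auto intro: DERIV_subset[OF DERIV_exp]\<close>)
      then show "dist (exp x) (exp y) \<le> exp t * dist x y" by (simp add: dist_norm)
    qed simp
    have lv': "(L * M + L * M)-lipschitz_on {s..t} v" by (rule lipschitz_on_subset[OF lv]) (use st in auto)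
    have bd: "bounded (f ` {s..t})" if "C-lipschitz_on {s..t} f" for f :: "real \<Rightarrow> real" and C
      by (intro compact_imp_bounded compact_continuous_image lipschitz_on_continuous_on[OF that]) simp
    obtain W where W: "W-lipschitz_on {s..t} w"
      unfolding w_def using lipschitz_on_bilinear[OF bounded_bilinear_mult K lv' bd[OF K] bd[OF lv']] by blast
    have "w t - w s \<le> 0 * (t - s)"
    proof (rule abs_cont_deriv_bound[OF st(2) lipschitz_imp_abs_cont_on[OF W]])
      show "AE x in lborel. x \<in> {s..t} \<longrightarrow> (\<exists>D. (w has_real_derivative D) (at x within {s..t}) \<and> D \<le> 0)"
        using dv
      proof eventually_elim
        case (elim x)
        show ?case
        proof
          assume x: "x \<in> {s..t}"
          then obtain v' where v': "(v has_real_derivative v') (at x within {0..})" "v' \<le> - v x" using elim st by auto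
          have "(v has_real_derivative v') (at x within {s..t})"
            by (rule has_field_derivative_subset[OF v'(1)]) (use st in auto)
          then have "(w has_real_derivative exp x * v x + exp x * v') (at x within {s..t})"
            unfolding w_def by (auto intro!: derivative_eq_intros)
          moreover have "exp x * v x + exp x * v' \<le> 0"
            using v'(2) by (simp add: distrib_left[symmetric] mult_nonneg_nonpos)
          ultimately show "\<exists>D. (w has_real_derivative D) (at x within {s..t}) \<and> D \<le> 0" by blast
        qed
      qed
    qed simp
    then have "exp t * v t \<le> exp s * v s" by (simp add: w_def)
    then show ?thesis by (simp add: exp_diff field_simps)
  qed
qed
end

context convex_concave_game begin

interpretation D: convex_concave_game G S "\<lambda>y x. - J x y" L by (rule dual)

lemma max_reply_convex: "x \<in> S \<Longrightarrow> convex (max_reply x)"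
  unfolding convex_alt
proof (intro ballI allI impI)
  fix y y' and u :: real assume x: "x \<in> S" and y: "y \<in> max_reply x" "y' \<in> max_reply x" "0 \<le> u \<and> u \<le> 1"
  then have yG: "y \<in> G" "y' \<in> G" "J x y = J x y'" by (auto simp: max_reply_def intro: order_antisym)
  have "J x y' \<le> J x ((1 - u) *\<^sub>R y + u *\<^sub>R y')"
    using convex_onD[OF ccv[OF x], of u y y'] yG y(3) by (simp add: algebra_simps)
  then show "(1 - u) *\<^sub>R y + u *\<^sub>R y' \<in> max_reply x"
    using y convexD_alt[OF G(2) yG(1,2), of u] unfolding max_reply_def by (auto intro: order_trans)
qed

lemma min_reply_dual: "min_reply y = D.max_reply y"
  by (simp add: min_reply_def D.max_reply_def)

lemma min_reply_convex: "y \<in> G \<Longrightarrow> convex (min_reply y)"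
  unfolding min_reply_dual by (rule convex_concave_game.max_reply_convex[OF dual])

lemma max_reply_nonempty: "x \<in> S \<Longrightarrow> max_reply x \<noteq> {}"
proof -
  assume "x \<in> S"
  then obtain y where "y \<in> G" "J x y = upper x" "\<And>y'. y' \<in> G \<Longrightarrow> J x y' \<le> upper x" using upper_attained by blast
  then have "y \<in> max_reply x" by (simp add: max_reply_def)
  then show ?thesis by blast
qed

lemma min_reply_nonempty: "y \<in> G \<Longrightarrow> min_reply y \<noteq> {}"
  unfolding min_reply_dual by (rule convex_concave_game.max_reply_nonempty[OF dual])

lemma max_reply_closed_graph:
  assumes "\<And>n. xs n \<in> S" "\<And>n. ys n \<in> max_reply (xs n)" "xs \<longlonglongrightarrow> x" "ys \<longlonglongrightarrow> y"
  shows "y \<in> max_reply x"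
proof -
  have x: "x \<in> S" using closed_sequentially[OF compact_imp_closed[OF S(1)] _ assms(3)] assms(1) by blast
  have yn: "\<And>n. ys n \<in> G" using assms(2) by (auto simp: max_reply_def)
  have y: "y \<in> G" using closed_sequentially[OF compact_imp_closed[OF G(1)] _ assms(4)] yn by blast
  have "J x y' \<le> J x y" if y': "y' \<in> G" for y'
  proof (rule LIMSEQ_le)
    show "(\<lambda>n. J (xs n) y') \<longlonglongrightarrow> J x y'"
      by (rule J_tendsto) (use assms(1) x y' assms(3) in auto)
    show "(\<lambda>n. J (xs n) (ys n)) \<longlonglongrightarrow> J x y"
      by (rule J_tendsto) (use assms yn x y in auto)
    show "\<exists>N. \<forall>n\<ge>N. J (xs n) y' \<le> J (xs n) (ys n)" using assms(2) y' by (auto simp: max_reply_def)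
  qed
  then show ?thesis using y by (simp add: max_reply_def)
qed

theorem br_curve_exists:
  assumes "x0 \<in> S" "y0 \<in> G"
  obtains X Y where "br_curve X Y" "X 0 = x0" "Y 0 = y0"
proof -
  define F where "F z = min_reply (snd z) \<times> max_reply (fst z)" for z
  have cg: "y \<in> F x" if "\<forall>n. xs n \<in> S \<times> G \<and> ys n \<in> F (xs n)" "xs \<longlonglongrightarrow> x" "ys \<longlonglongrightarrow> y"
    for xs ys :: "nat \<Rightarrow> 'a \<times> 'b" and x y
  proof -
    have "fst y \<in> min_reply (snd x)" unfolding min_reply_dual
      by (rule convex_concave_game.max_reply_closed_graph[OF dual, of "\<lambda>n. snd (xs n)" "\<lambda>n. fst (ys n)"])
         (use that in \<open>auto simp: F_def mem_Times_iff min_reply_dual intro: tendsto_intros\<close>)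
    moreover have "snd y \<in> max_reply (fst x)"
      by (rule max_reply_closed_graph[of "\<lambda>n. fst (xs n)" "\<lambda>n. snd (ys n)"])
         (use that in \<open>auto simp: F_def mem_Times_iff intro: tendsto_intros\<close>)
    ultimately show ?thesis by (simp add: F_def mem_Times_iff)
  qed
  obtain Z M where Z: "Z 0 = (x0, y0)" "\<And>t. 0 \<le> t \<Longrightarrow> Z t \<in> S \<times> G" "M-lipschitz_on {0..} Z"
    "\<And>t D. 0 < t \<Longrightarrow> (Z has_vector_derivative D) (at t) \<Longrightarrow> D \<in> (\<lambda>y. y - Z t) ` F (Z t)"
  proof (rule best_reply_inclusion_solution[of "S \<times> G" F "(x0,y0)"])
    show "compact (S \<times> G)" "convex (S \<times> G)" using S G by (auto intro: compact_Times convex_Times)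
    show "F z \<subseteq> S \<times> G" for z by (auto simp: F_def min_reply_def max_reply_def)
    show "F z \<noteq> {}" if "z \<in> S \<times> G" for z using that min_reply_nonempty max_reply_nonempty by (auto simp: F_def)
    show "convex (F z)" if "z \<in> S \<times> G" for z
      using that min_reply_convex max_reply_convex by (auto simp: F_def intro: convex_Times)
  qed (use cg assms in blast)+
  have ac: "abs_cont_halfline Z"
    unfolding abs_cont_halfline_def by (auto intro!: lipschitz_imp_abs_cont_on[OF lipschitz_on_subset[OF Z(3)]])
  have "br_curve (\<lambda>t. fst (Z t)) (\<lambda>t. snd (Z t))"
    unfolding br_curve_def
  proof (intro conjI)
    show "\<forall>l\<ge>0. fst (Z l) \<in> S \<and> snd (Z l) \<in> G" using Z(2) by (auto simp: mem_Times_iff)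
    show "abs_cont_halfline (\<lambda>t. fst (Z t))" "abs_cont_halfline (\<lambda>t. snd (Z t))"
      using ac unfolding abs_cont_halfline_def by (auto intro: abs_cont_on_dominated dist_fst_le dist_snd_le)
    show "AE l in lborel. 0 \<le> l \<longrightarrow> (\<exists>X' Y'.
        ((\<lambda>t. fst (Z t)) has_vector_derivative X') (at l within {0..}) \<and>
        ((\<lambda>t. snd (Z t)) has_vector_derivative Y') (at l within {0..}) \<and>
        X' \<in> (\<lambda>z. z - fst (Z l)) ` min_reply (snd (Z l)) \<and>
        Y' \<in> (\<lambda>z. z - snd (Z l)) ` max_reply (fst (Z l)))"
      using lipschitz_ae_differentiable[OF Z(3)] AE_lborel_singleton[of 0]
    proof eventually_elim
      case (elim l)
      show ?case
      proof
        assume "0 \<le> l"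
        then have l: "0 < l" using elim(2) by simp
        have atl: "at l within {0..} = at l" using l by (intro at_within_interior) (simp add: interior_Ici[of "-1"])
        obtain D' where D': "(Z has_vector_derivative D') (at l)" using elim(1) l by blast
        obtain w where w: "w \<in> F (Z l)" "D' = w - Z l" using Z(4)[OF l D'] by blast
        have "((\<lambda>t. fst (Z t)) has_vector_derivative fst D') (at l)" "((\<lambda>t. snd (Z t)) has_vector_derivative snd D') (at l)"
          using bounded_linear.has_vector_derivative[OF bounded_linear_fst D'] bounded_linear.has_vector_derivative[OF bounded_linear_snd D'] by auto
        then show "\<exists>X' Y'.
          ((\<lambda>t. fst (Z t)) has_vector_derivative X') (at l within {0..}) \<and>
          ((\<lambda>t. snd (Z t)) has_vector_derivative Y') (at l within {0..}) \<and>
          X' \<in> (\<lambda>z. z - fst (Z l)) ` min_reply (snd (Z l)) \<and>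
          Y' \<in> (\<lambda>z. z - snd (Z l)) ` max_reply (fst (Z l))"
          unfolding atl using w by (intro exI conjI) (auto simp: F_def mem_Times_iff)
      qed
    qed
  qed
  then show ?thesis using that Z(1) by simp
qed

lemma gap_continuous: "continuous_on (S \<times> G) (\<lambda>z. gap (fst z) (snd z))"
  by (rule lipschitz_on_continuous_on[OF gap_lipschitz])

lemma gap_bounded: obtains M where "M > 0" "\<And>x y. x \<in> S \<Longrightarrow> y \<in> G \<Longrightarrow> gap x y \<le> M"
proof -
  have "bounded ((\<lambda>z. gap (fst z) (snd z)) ` (S \<times> G))"
    using S G by (intro compact_imp_bounded compact_continuous_image gap_continuous compact_Times)
  then obtain M where "M > 0" "\<forall>w\<in>(\<lambda>z. gap (fst z) (snd z)) ` (S \<times> G). norm w \<le> M" using bounded_pos by blast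
  then show ?thesis by (intro that[of M]) (force simp: image_iff abs_le_iff)+
qed

text \<open>
  The threshold does not depend on the curve, since the gap is bounded on \<open>S \<times> G\<close>.
\<close>
lemma gap_decay:
  assumes "0 < \<delta>"
  obtains \<Lambda> where "0 \<le> \<Lambda>" "\<And>X Y l. br_curve X Y \<Longrightarrow> \<Lambda> \<le> l \<Longrightarrow> gap (X l) (Y l) < \<delta>"
proof -
  obtain M where M: "M > 0" "\<And>x y. x \<in> S \<Longrightarrow> y \<in> G \<Longrightarrow> gap x y \<le> M" using gap_bounded by blast
  define \<Lambda> where "\<Lambda> = max 0 (ln (2 * M / \<delta>))"
  have "gap (X l) (Y l) < \<delta>" if c: "br_curve X Y" and l: "\<Lambda> \<le> l" for X Y l
  proof -
    have l0: "0 \<le> l" "ln (2 * M / \<delta>) \<le> l" using l by (auto simp: \<Lambda>_def)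
    have "gap (X l) (Y l) \<le> exp (0 - l) * gap (X 0) (Y 0)" by (rule gap_lyapunov(3)[OF c]) (use l0 in auto)
    also have "\<dots> \<le> exp (0 - l) * M" using M(2) c by (auto simp: br_curve_def)
    also have "\<dots> < \<delta>"
    proof -
      have "exp (ln (2 * M / \<delta>)) \<le> exp l" using l0(2) by simp
      then have "2 * M / \<delta> \<le> exp l" using M(1) assms by simp
      then have "2 * M \<le> \<delta> * exp l" using assms by (simp add: field_simps)
      then have "M < \<delta> * exp l" using M(1) by simp
      then show ?thesis by (simp add: exp_minus field_simps)
    qed
    finally show ?thesis .
  qed
  then show ?thesis using that[of \<Lambda>] by (simp add: \<Lambda>_def)
qed

text \<open>
  The gap attains its minimum on \<open>S \<times> G\<close>, and a positive minimum would contradict the decay along a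
  solution.
\<close>
theorem saddles_nonempty: "saddles \<noteq> {}"
proof -
  obtain x0 y0 where "x0 \<in> S" "y0 \<in> G" using S G by blast
  then obtain X Y where c: "br_curve X Y" using br_curve_exists by metis
  have K: "compact (S \<times> G)" "S \<times> G \<noteq> {}" using S G by (auto intro: compact_Times)
  obtain z where z: "z \<in> S \<times> G" "\<And>w. w \<in> S \<times> G \<Longrightarrow> gap (fst z) (snd z) \<le> gap (fst w) (snd w)"
    using continuous_attains_inf[OF K gap_continuous] by blast
  have "gap (fst z) (snd z) \<le> 0"
  proof (rule ccontr)
    assume "\<not> ?thesis"
    then obtain \<Lambda> where "0 \<le> \<Lambda>" "gap (X \<Lambda>) (Y \<Lambda>) < gap (fst z) (snd z)"
      using gap_decay[of "gap (fst z) (snd z)"] c by (metis not_le order_refl)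
    then show False using z(2)[of "(X \<Lambda>, Y \<Lambda>)"] c by (auto simp: br_curve_def)
  qed
  then have "gap (fst z) (snd z) = 0" using gap_nonneg[of "fst z" "snd z"] z(1) by (auto simp: mem_Times_iff)
  then show ?thesis using gap_zero_iff[of "fst z" "snd z"] z(1) by (auto simp: mem_Times_iff)
qed

text \<open>
  On the compact set of points at distance at least \<open>\<epsilon>\<close> from the saddle points the gap is bounded
  below by some \<open>\<delta> > 0\<close>, and after a uniform time it is smaller than \<open>\<delta>\<close>.
\<close>
theorem saddles_uniform_attractor:
  assumes \<epsilon>: "0 < \<epsilon>"
  obtains \<Lambda> where "0 \<le> \<Lambda>" "\<And>X Y l. br_curve X Y \<Longrightarrow> \<Lambda> \<le> l \<Longrightarrow> infdist (X l, Y l) saddles < \<epsilon>"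
proof -
  define K where "K = {z \<in> S \<times> G. \<epsilon> \<le> infdist z saddles}"
  have Kc: "compact K"
  proof -
    have "K = (S \<times> G) \<inter> {z. \<epsilon> \<le> infdist z saddles}" by (auto simp: K_def)
    moreover have "closed {z. \<epsilon> \<le> infdist z saddles}" by (intro closed_Collect_le continuous_intros)
    ultimately show ?thesis using S G by (simp add: compact_Int_closed compact_Times)
  qed
  obtain \<delta> where \<delta>: "\<delta> > 0" "\<And>z. z \<in> K \<Longrightarrow> \<delta> \<le> gap (fst z) (snd z)"
  proof (cases "K = {}")
    case True then show ?thesis using that[of 1] by auto
  next
    case False
    have "continuous_on K (\<lambda>z. gap (fst z) (snd z))"
      by (rule continuous_on_subset[OF gap_continuous]) (auto simp: K_def)
    then obtain z where z: "z \<in> K" "\<And>w. w \<in> K \<Longrightarrow> gap (fst z) (snd z) \<le> gap (fst w) (snd w)"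
      using continuous_attains_inf[OF Kc False] by blast
    have zin: "fst z \<in> S" "snd z \<in> G" using z(1) by (auto simp: K_def)
    have "z \<notin> saddles" using z(1) \<epsilon> by (auto simp: K_def)
    then have "gap (fst z) (snd z) \<noteq> 0" using gap_zero_iff[OF zin] by simp
    then have "gap (fst z) (snd z) > 0" using gap_nonneg[OF zin] by simp
    then show ?thesis using that z(2) by blast
  qed
  obtain \<Lambda> where \<Lambda>: "0 \<le> \<Lambda>" "\<And>X Y l. br_curve X Y \<Longrightarrow> \<Lambda> \<le> l \<Longrightarrow> gap (X l) (Y l) < \<delta>"
    using gap_decay[OF \<delta>(1)] by blast
  have "infdist (X l, Y l) saddles < \<epsilon>" if c: "br_curve X Y" and l: "\<Lambda> \<le> l" for X Y l
  proof (rule ccontr)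
    assume "\<not> ?thesis"
    then have "(X l, Y l) \<in> K" using c l \<Lambda>(1) by (auto simp: K_def br_curve_def)
    then show False using \<delta>(2)[of "(X l, Y l)"] \<Lambda>(2)[OF c l] by simp
  qed
  then show ?thesis using that \<Lambda>(1) by blast
qed

end

section \<open>Symmetric matrices\<close>

text \<open>
  First-order optimality for a quadratic polynomial: if it is non-negative and vanishes at \<open>0\<close>, it
  has no linear term.
\<close>
lemma quadratic_nonneg_imp_zero:
  fixes a b :: real
  assumes "\<And>t. 0 \<le> 2 * t * a + t\<^sup>2 * b"
  shows "a = 0"
proof (rule ccontr)
  assume a: "a \<noteq> 0"
  define c where "c = \<bar>b\<bar> + 1"
  have c: "c > 0" "b < c" by (auto simp: c_def)
  have "0 \<le> 2 * (- a / c) * a + (- a / c)\<^sup>2 * b" by (rule assms)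
  also have "\<dots> = (a\<^sup>2 / c) * (b / c - 2)" using c by (simp add: power2_eq_square field_simps)
  also have "\<dots> < 0" using a c by (intro mult_pos_neg) (auto simp: field_simps)
  finally show False by simp
qed

lemma symmetric_inner:
  fixes A :: "real^'n^'n"
  assumes "transpose A = A" shows "x \<bullet> (A *v y) = (A *v x) \<bullet> y"
  by (metis assms dot_lmul_matrix transpose_matrix_vector)

text \<open>
  The eigenvector is a maximizer of the quadratic form on the unit sphere of the subspace.
  Perturbing it in the direction \<open>y\<close> shows that \<open>A x - c x\<close> is orthogonal to every \<open>y\<close> in the
  subspace, in particular to itself.
\<close>
lemma symmetric_eigenvector_in_subspace:
  fixes A :: "real^'n^'n"
  assumes sym: "transpose A = A" and V: "subspace V" "\<And>x. x \<in> V \<Longrightarrow> A *v x \<in> V" and nt: "\<exists>x\<in>V. x \<noteq> 0"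
  obtains x c where "x \<in> V" "norm x = 1" "A *v x = c *\<^sub>R x"
proof -
  let ?K = "V \<inter> sphere 0 1"
  have "compact ?K" using closed_Int_compact[OF closed_subspace[OF V(1)] compact_sphere] by blast
  moreover have "?K \<noteq> {}"
  proof -
    obtain x where x: "x \<in> V" "x \<noteq> 0" using nt by blast
    then have "sgn x \<in> ?K" using subspace_scale[OF V(1) x(1)] by (simp add: sgn_div_norm norm_sgn[unfolded sgn_div_norm])
    then show ?thesis by blast
  qed
  moreover have "continuous_on ?K (\<lambda>x. x \<bullet> (A *v x))"
    by (intro continuous_intros linear_continuous_on linear_linear[THEN iffD1] matrix_vector_mul_linear)
  ultimately obtain x where x: "x \<in> ?K" "\<And>y. y \<in> ?K \<Longrightarrow> y \<bullet> (A *v y) \<le> x \<bullet> (A *v x)"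
    using continuous_attains_sup by meson
  define c where "c = x \<bullet> (A *v x)"
  have xx: "x \<bullet> x = 1" using x(1) by (simp add: dot_square_norm)
  have le: "z \<bullet> (A *v z) \<le> c * (z \<bullet> z)" if z: "z \<in> V" for z
  proof (cases "z = 0")
    case False
    then have "sgn z \<in> ?K" using subspace_scale[OF V(1) z] by (simp add: sgn_div_norm norm_sgn[unfolded sgn_div_norm])
    then have "sgn z \<bullet> (A *v sgn z) \<le> c" unfolding c_def by (rule x(2))
    then have "(z \<bullet> (A *v z)) / (norm z)\<^sup>2 \<le> c"
      by (simp add: sgn_div_norm matrix_vector_mult_scaleR power2_eq_square divide_inverse algebra_simps)
    then show ?thesis using False by (simp add: power2_norm_eq_inner divide_le_eq)
  qed simp
  have orth: "y \<bullet> (A *v x - c *\<^sub>R x) = 0" if y: "y \<in> V" for y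
  proof -
    have "(c *\<^sub>R x - A *v x) \<bullet> y = 0"
    proof (rule quadratic_nonneg_imp_zero)
      fix t
      have "x + t *\<^sub>R y \<in> V" using x(1) y V(1) by (simp add: subspace_add subspace_scale)
      from le[OF this] have "0 \<le> c * ((x + t *\<^sub>R y) \<bullet> (x + t *\<^sub>R y)) - (x + t *\<^sub>R y) \<bullet> (A *v (x + t *\<^sub>R y))" by simp
      also have "\<dots> = 2 * t * ((c *\<^sub>R x - A *v x) \<bullet> y) + t\<^sup>2 * (c * (y \<bullet> y) - y \<bullet> (A *v y))"
        using symmetric_inner[OF sym, of x y] xx
        by (simp add: c_def[symmetric] matrix_vector_right_distrib matrix_vector_mult_scaleR inner_add_left inner_add_right
            inner_diff_left power2_eq_square algebra_simps inner_commute)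
      finally show "0 \<le> 2 * t * ((c *\<^sub>R x - A *v x) \<bullet> y) + t\<^sup>2 * (c * (y \<bullet> y) - y \<bullet> (A *v y))" .
    qed
    then show ?thesis by (simp add: inner_diff_left inner_diff_right inner_commute)
  qed
  have "A *v x - c *\<^sub>R x \<in> V" using x(1) V by (simp add: subspace_diff subspace_scale)
  then have "A *v x = c *\<^sub>R x" using orth[of "A *v x - c *\<^sub>R x"] by simp
  then show ?thesis using that[of x c] x(1) by simp
qed

definition diag_mat :: "('n \<Rightarrow> real) \<Rightarrow> real^'n^'n" where
  "diag_mat d = (\<chi> i j. if i = j then d i else 0)"

lemma diag_mat_mult_right: "(M ** diag_mat f) $ i $ j = M $ i $ j * f j" for M :: "real^'n^'m"
proof -
  have "(M ** diag_mat f) $ i $ j = (\<Sum>k\<in>UNIV. if k = j then M $ i $ k * f k else 0)"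
    by (simp only: matrix_matrix_mult_def diag_mat_def vec_lambda_beta) (rule sum.cong, auto)
  then show ?thesis by simp
qed

text \<open>
  The spectral theorem. An orthonormal system \<open>B\<close> of eigenvectors of maximal size spans the space:
  its orthogonal complement is invariant under \<open>A\<close>, so it would otherwise contain another unit
  eigenvector.
\<close>
theorem symmetric_matrix_diagonalizable:
  fixes A :: "real^'n^'n"
  assumes sym: "transpose A = A"
  obtains P d where "orthogonal_matrix P" "A = P ** diag_mat d ** transpose P"
proof -
  define good where "good B \<longleftrightarrow> pairwise orthogonal B \<and> (\<forall>b\<in>B. norm b = 1 \<and> (\<exists>c. A *v b = c *\<^sub>R b))" for B
  have ind: "independent B" if "good B" for B
    using that by (intro pairwise_orthogonal_independent) (auto simp: good_def)
  have "good {}" by (simp add: good_def)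
  moreover have "\<forall>B. good B \<longrightarrow> card B < CARD('n) + 1"
    using independent_bound[OF ind] by (auto simp: less_Suc_eq_le)
  ultimately obtain B where B: "good B" "\<And>B'. good B' \<Longrightarrow> card B' \<le> card B"
    using ex_has_greatest_nat[of good "{}" card "CARD('n) + 1"] by blast
  have finB: "finite B" using independent_bound[OF ind[OF B(1)]] by simp
  define V where "V = {x. \<forall>b\<in>B. x \<bullet> b = 0}"
  have sV: "subspace V" by (auto simp: subspace_def V_def inner_add_left)
  have V0: "x = 0" if xV: "x \<in> V" for x
  proof (rule ccontr)
    assume "x \<noteq> 0"
    have inv: "A *v y \<in> V" if "y \<in> V" for y
    proof -
      have "(A *v y) \<bullet> b = 0" if b: "b \<in> B" for b
      proof -
        obtain c where "A *v b = c *\<^sub>R b" using B(1) b by (auto simp: good_def)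
        then show ?thesis using symmetric_inner[OF sym, of y b] \<open>y \<in> V\<close> b by (simp add: V_def)
      qed
      then show ?thesis by (simp add: V_def)
    qed
    obtain z c where z: "z \<in> V" "norm z = 1" "A *v z = c *\<^sub>R z"
      by (rule symmetric_eigenvector_in_subspace[OF sym sV]) (use inv xV \<open>x \<noteq> 0\<close> in blast)+
    have "z \<notin> B"
    proof
      assume "z \<in> B"
      then have "z \<bullet> z = 0" using z(1) by (simp add: V_def)
      then show False using z(2) by simp
    qed
    moreover have "good (insert z B)"
      using B(1) z unfolding good_def pairwise_insert by (auto simp: V_def orthogonal_def inner_commute)
    ultimately show False using B(2)[of "insert z B"] finB by simp
  qed
  have "span B = UNIV"
  proof (rule ccontr)
    assume "span B \<noteq> UNIV"
    then have "span B \<subset> span UNIV" by auto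
    then obtain x where "x \<noteq> 0" "\<And>y. y \<in> span B \<Longrightarrow> orthogonal x y"
      using orthogonal_to_subspace_exists_gen by metis
    then show False using V0[of x] by (auto simp: V_def orthogonal_def span_base)
  qed
  then have "card B = CARD('n)"
    using dim_eq_card[of B UNIV] ind[OF B(1)] by (simp add: dim_UNIV)
  then obtain e where e: "bij_betw e (UNIV::'n set) B"
    using finite_same_card_bij[of "UNIV::'n set" B] finB by auto
  have eB: "e k \<in> B" for k using e by (auto simp: bij_betw_def)
  have "\<exists>c. A *v e k = c *\<^sub>R e k" for k using B(1) eB[of k] by (auto simp: good_def)
  then obtain d where d: "\<And>k. A *v e k = d k *\<^sub>R e k" by metis
  define P where "P = (\<chi> i j. e j $ i)"
  have colP: "column k P = e k" for k by (simp add: column_def P_def vec_eq_iff)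
  have oP: "orthogonal_matrix P"
    unfolding orthogonal_matrix_orthonormal_columns colP
  proof (intro conjI allI impI)
    show "norm (e i) = 1" for i using B(1) eB by (simp add: good_def)
    show "orthogonal (e i) (e j)" if "i \<noteq> j" for i j
    proof -
      have "e i \<noteq> e j" using e that by (metis UNIV_I bij_betw_inv_into_left)
      then show ?thesis using B(1) eB by (auto simp: good_def pairwise_def)
    qed
  qed
  have "A ** P = P ** diag_mat d"
  proof (simp add: vec_eq_iff, intro allI)
    fix i k
    have "(A ** P) $ i $ k = (A *v e k) $ i" by (simp add: matrix_matrix_mult_def matrix_vector_mult_def P_def)
    also have "\<dots> = d k * e k $ i" by (simp add: d)
    also have "\<dots> = (P ** diag_mat d) $ i $ k"
      by (simp add: matrix_matrix_mult_def P_def diag_mat_def if_distrib cong: if_cong)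
    finally show "(A ** P) $ i $ k = (P ** diag_mat d) $ i $ k" .
  qed
  then have "A ** P ** transpose P = P ** diag_mat d ** transpose P" by simp
  moreover have "A ** P ** transpose P = A"
    using oP by (simp add: orthogonal_matrix_def matrix_mul_assoc[symmetric])
  ultimately have "A = P ** diag_mat d ** transpose P" by simp
  then show ?thesis using that oP by blast
qed

definition spectral_decomp :: "real^'n^'n \<Rightarrow> ('n \<Rightarrow> real) \<Rightarrow> real^'n^'n \<Rightarrow> bool" where
  "spectral_decomp P d A \<longleftrightarrow> orthogonal_matrix P \<and> A = P ** diag_mat d ** transpose P"

lemma spectral_decomp_exists:
  assumes "transpose A = A" obtains P d where "spectral_decomp P d A"
  using symmetric_matrix_diagonalizable[OF assms] unfolding spectral_decomp_def by metis

context
  fixes A P :: "real^'n^'n" and d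
  assumes dec: "spectral_decomp P d A"
begin

lemma spectral_decompD:
  "A = P ** diag_mat d ** transpose P" "transpose P ** P = mat 1" "P ** transpose P = mat 1"
  using dec by (auto simp: spectral_decomp_def orthogonal_matrix_def)

lemma orthogonal_conjugate_entry:
  "(transpose P ** M ** P) $ k $ l = column k P \<bullet> (M *v column l P)" for M :: "real^'n^'n"
  unfolding matrix_mul_assoc[symmetric]
  by (simp add: matrix_matrix_mult_def matrix_vector_mult_def transpose_def column_def inner_vec_def)

lemma spectral_eigenvalue: "d k = column k P \<bullet> (A *v column k P)"
proof -
  have "transpose P ** A ** P = (transpose P ** P) ** diag_mat d ** (transpose P ** P)"
    unfolding spectral_decompD(1) by (simp only: matrix_mul_assoc)
  then have "transpose P ** A ** P = diag_mat d" by (simp add: spectral_decompD(2))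
  then show ?thesis using orthogonal_conjugate_entry[of A k k] by (simp add: diag_mat_def)
qed

lemma spectral_column: "column k P \<bullet> column k P = 1"
proof -
  have "(mat 1 :: real^'n^'n) $ k $ k = 1" by (simp add: mat_def)
  then show ?thesis using orthogonal_conjugate_entry[of "mat 1" k k] spectral_decompD(2) by simp
qed

lemma spectral_column_nonzero: "column k P \<noteq> 0"
  using spectral_column[of k] by auto

lemma spectral_det: "det A = (\<Prod>k\<in>UNIV. d k)"
proof -
  have "det P * det P = 1" using arg_cong[OF spectral_decompD(2), of det] by (simp add: det_mul)
  moreover have "det (diag_mat d) = (\<Prod>k\<in>UNIV. d k)" by (subst det_diagonal) (simp_all add: diag_mat_def)
  ultimately show ?thesis unfolding spectral_decompD(1) by (simp add: det_mul)
qed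

text \<open>
  This is \<open>A = \<Sum>\<^sub>k d\<^sub>k p\<^sub>k p\<^sub>k\<^sup>T\<close> read under the trace, with \<open>p\<^sub>k\<close> the columns of \<open>P\<close>.
\<close>
lemma spectral_trace_mult: "trace (M ** A) = (\<Sum>k\<in>UNIV. d k * (column k P \<bullet> (M *v column k P)))"
proof -
  have "trace (M ** A) = trace ((M ** P ** diag_mat d) ** transpose P)"
    unfolding spectral_decompD(1) by (simp only: matrix_mul_assoc)
  also have "\<dots> = trace (transpose P ** (M ** P ** diag_mat d))" by (rule trace_mul_sym)
  also have "\<dots> = trace ((transpose P ** M ** P) ** diag_mat d)" by (simp only: matrix_mul_assoc)
  also have "\<dots> = (\<Sum>k\<in>UNIV. d k * (column k P \<bullet> (M *v column k P)))"
    by (simp add: trace_def matrix_matrix_mult_def[of "transpose P ** M ** P"] orthogonal_conjugate_entry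
        diag_mat_def if_distrib mult.commute cong: if_cong)
  finally show ?thesis .
qed

lemma spectral_trace: "trace A = (\<Sum>k\<in>UNIV. d k)"
  using spectral_trace_mult[of "mat 1"] by (simp add: spectral_column)

end

lemma trace_psd_mult_nonneg:
  assumes "psd M" "psd W" shows "0 \<le> trace (M ** W)"
proof -
  obtain P d where D: "spectral_decomp P d W" using spectral_decomp_exists assms(2) by (metis psd_def)
  show ?thesis
    unfolding spectral_trace_mult[OF D] using spectral_eigenvalue[OF D] assms
    by (intro sum_nonneg mult_nonneg_nonneg) (simp_all add: psd_def)
qed

lemma pd_imp_psd: assumes "pd X" shows "psd X"
proof -
  have "0 \<le> x \<bullet> (X *v x)" for x using assms by (cases "x = 0") (auto simp: pd_def intro: less_imp_le)
  then show ?thesis using assms by (simp add: pd_def psd_def)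
qed

lemma inner_congruence:
  fixes X :: "real^'n^'n" and S :: "real^'m^'n"
  shows "x \<bullet> ((transpose S ** X ** S) *v x) = (S *v x) \<bullet> (X *v (S *v x))"
proof -
  have "(transpose S ** X ** S) *v x = transpose S *v (X *v (S *v x))"
    by (simp only: matrix_vector_mul_assoc matrix_mul_assoc)
  then show ?thesis
    using dot_lmul_matrix[of x "transpose S" "X *v (S *v x)"] transpose_matrix_vector[of "transpose S" x]
    by (simp only: transpose_transpose)
qed

lemma transpose_congruence:
  fixes X :: "real^'n^'n" and S :: "real^'m^'n"
  shows "transpose (transpose S ** X ** S) = transpose S ** transpose X ** S"
  by (simp only: matrix_transpose_mul transpose_transpose matrix_mul_assoc)

lemma psd_congruence:
  fixes X :: "real^'n^'n" and S :: "real^'m^'n"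
  assumes "psd X" shows "psd (transpose S ** X ** S)"
  using assms unfolding psd_def transpose_congruence inner_congruence by simp

lemma pd_congruence:
  fixes X :: "real^'n^'n" and S :: "real^'m^'n"
  assumes "pd X" and inj: "\<And>x. S *v x = 0 \<Longrightarrow> x = 0" shows "pd (transpose S ** X ** S)"
  unfolding pd_def transpose_congruence inner_congruence
proof (intro conjI allI impI)
  show "transpose S ** transpose X ** S = transpose S ** X ** S" using assms(1) by (simp add: pd_def)
  show "0 < (S *v x) \<bullet> (X *v (S *v x))" if "x \<noteq> 0" for x
    using assms(1) inj[of x] that unfolding pd_def by metis
qed

lemma pd_eigenvalues:
  fixes Z :: "real^'n^'n"
  assumes "pd Z"
  obtains d :: "'n \<Rightarrow> real" where "\<forall>k. d k > 0" "det Z = (\<Prod>k\<in>UNIV. d k)" "trace Z = (\<Sum>k\<in>UNIV. d k)"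
proof -
  obtain P d where D: "spectral_decomp P d Z" using spectral_decomp_exists assms by (metis pd_def)
  have "d k > 0" for k
    using spectral_eigenvalue[OF D, of k] spectral_column_nonzero[OF D, of k] assms by (simp add: pd_def)
  then show ?thesis using that spectral_det[OF D] spectral_trace[OF D] by blast
qed

lemma pd_det_pos:
  fixes Z :: "real^'n^'n"
  assumes "pd Z" shows "0 < det Z"
proof -
  obtain d :: "'n \<Rightarrow> real" where d: "\<forall>k. d k > 0" "det Z = (\<Prod>k\<in>UNIV. d k)" using pd_eigenvalues[OF assms] by blast
  show ?thesis unfolding d(2) using d(1) by (intro prod_pos) simp
qed

text \<open>
  Summing \<open>ln d \<le> d / c + ln c - 1\<close> over the eigenvalues. The case \<open>c = 1\<close> is the non-negativity of the
  Kullback--Leibler divergence from the standard Gaussian; \<open>c = 2\<close> leaves half of the trace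
  to spare and thus bounds it on a divergence ball.
\<close>
lemma ln_det_le_trace:
  fixes Z :: "real^'n^'n"
  assumes "pd Z" and c: "c > 0" shows "ln (det Z) \<le> trace Z / c + real CARD('n) * (ln c - 1)"
proof -
  obtain d :: "'n \<Rightarrow> real" where d: "\<forall>k. d k > 0" "det Z = (\<Prod>k\<in>UNIV. d k)" "trace Z = (\<Sum>k\<in>UNIV. d k)"
    using pd_eigenvalues[OF assms(1)] by blast
  have dn: "d k \<noteq> 0" for k using spec[OF d(1), of k] by simp
  have "ln (det Z) = (\<Sum>k\<in>UNIV. ln (d k))" unfolding d(2) by (rule ln_prod) (simp_all add: dn)
  also have "\<dots> \<le> (\<Sum>k\<in>UNIV. d k / c + (ln c - 1))"
  proof (rule sum_mono)
    fix k show "ln (d k) \<le> d k / c + (ln c - 1)"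
      using ln_le_minus_one[of "d k / c"] spec[OF d(1), of k] c by (simp add: ln_div)
  qed
  also have "\<dots> = trace Z / c + real CARD('n) * (ln c - 1)"
    by (simp add: d(3) sum.distrib sum_divide_distrib)
  finally show ?thesis .
qed

text \<open>
  The congruence by \<open>S = P diag (d\<^sub>k)\<^sup>-\<^sup>1\<^sup>/\<^sup>2\<close> turns \<open>Y\<close> into the identity. It will reduce
  divergences from \<open>N(0, Y)\<close> to divergences from the standard Gaussian.
\<close>
lemma pd_whitening:
  fixes Y :: "real^'n^'n"
  assumes "pd Y"
  obtains S where "transpose S ** Y ** S = mat 1" "matrix_inv Y = S ** transpose S" "det S * det S * det Y = 1"
    "\<forall>x. S *v x = 0 \<longrightarrow> x = 0" "S ** (transpose S ** Y) = mat 1"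
proof -
  obtain P d where D: "spectral_decomp P d Y" using spectral_decomp_exists assms by (metis pd_def)
  note Y = spectral_decompD(1)[OF D] and PP = spectral_decompD(2,3)[OF D]
  have dp: "d k > 0" for k
    using spectral_eigenvalue[OF D, of k] spectral_column_nonzero[OF D, of k] assms by (simp add: pd_def)
  define R where "R = diag_mat (\<lambda>k. 1 / sqrt (d k))"
  define S where "S = P ** R"
  have tR: "transpose R = R" by (simp add: R_def diag_mat_def transpose_def vec_eq_iff)
  have dn: "d k \<noteq> 0" "0 \<le> d k" for k using dp[of k] by auto
  have RdR: "R ** diag_mat d ** R = mat 1"
    by (simp add: vec_eq_iff R_def diag_mat_mult_right) (simp add: diag_mat_def mat_def dn)
  have "transpose S ** Y ** S = R ** (transpose P ** P) ** diag_mat d ** (transpose P ** P) ** R"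
    unfolding S_def Y matrix_transpose_mul tR by (simp only: matrix_mul_assoc)
  then have 1: "transpose S ** Y ** S = mat 1" by (simp add: PP RdR)
  then have 2: "S ** (transpose S ** Y) = mat 1" using matrix_left_right_inverse by blast
  then have 3: "(S ** transpose S) ** Y = mat 1" by (simp add: matrix_mul_assoc)
  have 4: "Y ** (S ** transpose S) = mat 1" using 3 matrix_left_right_inverse by blast
  have inv: "invertible Y" using 3 4 by (auto simp: invertible_def)
  have 5: "matrix_inv Y = S ** transpose S"
  proof -
    have "matrix_inv Y = matrix_inv Y ** (Y ** (S ** transpose S))" by (simp add: 4)
    also have "\<dots> = (matrix_inv Y ** Y) ** (S ** transpose S)" by (simp only: matrix_mul_assoc)
    also have "matrix_inv Y ** Y = mat 1" using inv unfolding matrix_inv_def invertible_def by (metis (mono_tags, lifting) someI_ex)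
    finally show ?thesis by simp
  qed
  have 6: "det S * det S * det Y = 1" using arg_cong[OF 1, of det] by (simp add: det_mul mult_ac)
  have 7: "\<forall>x. S *v x = 0 \<longrightarrow> x = 0"
  proof (intro allI impI)
    fix x assume S0: "S *v x = 0"
    have "x = (transpose S ** Y ** S) *v x" by (simp add: 1)
    also have "\<dots> = (transpose S ** Y) *v (S *v x)" by (simp only: matrix_vector_mul_assoc)
    finally show "x = 0" using S0 by (simp add: matrix_vector_mult_0_right)
  qed
  show ?thesis using that[OF 1 5 6 7 2] by blast
qed

section \<open>Kullback--Leibler balls of centred Gaussians\<close>

lemma linear_trace: "linear (trace :: real^'n^'n \<Rightarrow> real)"
  by (rule linearI) (simp_all add: trace_def sum.distrib sum_distrib_left)

lemma linear_transpose: "linear (transpose :: real^'n^'m \<Rightarrow> real^'m^'n)"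
  by (rule linearI) (simp_all add: transpose_def vec_eq_iff)

lemma linear_matrix_mult_left: "linear ((**) (A :: real^'m^'n) :: real^'k^'m \<Rightarrow> real^'k^'n)"
  by (rule linearI) (simp_all add: matrix_matrix_mult_def vec_eq_iff sum_distrib_left sum.distrib algebra_simps)

lemma linear_matrix_mult_right: "linear (\<lambda>X :: real^'m^'n. X ** (A :: real^'k^'m))"
  by (rule linearI) (simp_all add: matrix_matrix_mult_def vec_eq_iff sum_distrib_left sum.distrib algebra_simps)

lemma bounded_bilinear_matrix_mult:
  "bounded_bilinear ((**) :: real^'m^'n \<Rightarrow> real^'k^'m \<Rightarrow> real^'k^'n)"
  unfolding bilinear_conv_bounded_bilinear[symmetric] bilinear_def
  by (simp add: linear_matrix_mult_left linear_matrix_mult_right)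

lemma linear_congruence:
  fixes S :: "real^'m^'n"
  shows "linear (\<lambda>X. transpose S ** X ** S)"
  using linear_compose[OF linear_matrix_mult_left[of "transpose S"] linear_matrix_mult_right[of S]]
  by (simp add: o_def)

lemma linear_comb: "linear f \<Longrightarrow> f (a *\<^sub>R x + b *\<^sub>R y) = a *\<^sub>R f x + b *\<^sub>R f y"
  by (simp add: linear_add linear_scale)

lemma matrix_norm_le_entries:
  fixes M :: "real^'n^'m"
  assumes "\<And>i j. \<bar>M $ i $ j\<bar> \<le> b"
  shows "norm M \<le> real CARD('m) * (real CARD('n) * b)"
proof -
  have "norm M \<le> (\<Sum>i\<in>UNIV. norm (M $ i))" unfolding norm_vec_def by (rule L2_set_le_sum) simp
  also have "\<dots> \<le> (\<Sum>i\<in>(UNIV::'m set). real CARD('n) * b)"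
  proof (rule sum_mono)
    fix i
    have "norm (M $ i) \<le> (\<Sum>j\<in>UNIV. \<bar>M $ i $ j\<bar>)" by (rule norm_le_l1_cart)
    also have "\<dots> \<le> (\<Sum>j\<in>(UNIV::'n set). b)" by (rule sum_mono) (rule assms)
    finally show "norm (M $ i) \<le> real CARD('n) * b" by simp
  qed
  finally show ?thesis by simp
qed

lemma inner_axis_matrix: "axis i 1 \<bullet> (Z *v axis j 1) = Z $ i $ j" for Z :: "real^'n^'m"
  by (simp add: inner_axis' matrix_vector_mult_basis column_def)

lemma symmetric_entry: "transpose Z = Z \<Longrightarrow> Z $ j $ i = Z $ i $ j" for Z :: "real^'n^'n"
  by (simp add: transpose_def vec_eq_iff)

lemma psd_entry_le_trace:
  assumes "psd Z" shows "\<bar>Z $ i $ j\<bar> \<le> trace Z"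
proof -
  have nn: "0 \<le> Z $ k $ k" for k
  proof -
    have "0 \<le> axis k 1 \<bullet> (Z *v axis k 1)" using assms unfolding psd_def by blast
    then show ?thesis by (simp only: inner_axis_matrix)
  qed
  have tr: "Z $ k $ k \<le> trace Z" for k
    unfolding trace_def by (rule member_le_sum) (use nn in auto)
  have sym: "Z $ j $ i = Z $ i $ j" using assms by (simp add: psd_def symmetric_entry)
  have "0 \<le> (axis i 1 + s *\<^sub>R axis j 1) \<bullet> (Z *v (axis i 1 + s *\<^sub>R axis j 1))" for s :: real
    using assms by (simp add: psd_def)
  then have "0 \<le> Z $ i $ i + 2 * s * Z $ i $ j + s * s * Z $ j $ j" for s :: real
    by (simp add: matrix_vector_right_distrib matrix_vector_mult_scaleR inner_add_left inner_add_right
        inner_axis_matrix sym algebra_simps)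
  from this[of 1] this[of "-1"] show ?thesis using tr[of i] tr[of j] by (simp add: abs_le_iff)
qed

text \<open>
  A zero \<open>x\<close> of the non-negative quadratic form is a minimizer, so its gradient \<open>2 Z x\<close> vanishes
  there.
\<close>
lemma psd_nonsingular_imp_pd:
  fixes Z :: "real^'n^'n"
  assumes Z: "psd Z" and det: "det Z \<noteq> 0" shows "pd Z"
proof -
  have sym: "transpose Z = Z" using Z by (simp add: psd_def)
  have "0 < x \<bullet> (Z *v x)" if x: "x \<noteq> 0" for x
  proof (rule ccontr)
    assume "\<not> ?thesis"
    then have x0: "x \<bullet> (Z *v x) = 0" using Z by (auto simp: psd_def intro: order_antisym)
    have "(Z *v x) \<bullet> y = 0" for y
    proof (rule quadratic_nonneg_imp_zero)
      fix t
      have "0 \<le> (x + t *\<^sub>R y) \<bullet> (Z *v (x + t *\<^sub>R y))" using Z by (simp add: psd_def)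
      also have "\<dots> = 2 * t * ((Z *v x) \<bullet> y) + t\<^sup>2 * (y \<bullet> (Z *v y))"
        using symmetric_inner[OF sym, of x y] x0
        by (simp add: matrix_vector_right_distrib matrix_vector_mult_scaleR inner_add_left inner_add_right
            power2_eq_square algebra_simps inner_commute)
      finally show "0 \<le> 2 * t * ((Z *v x) \<bullet> y) + t\<^sup>2 * (y \<bullet> (Z *v y))" .
    qed
    then have "Z *v x = Z *v 0" by (metis inner_eq_zero_iff matrix_vector_mult_0_right)
    moreover have "inj ((*v) Z)" using det by (simp add: invertible_det_nz[symmetric] inj_matrix_vector_mult)
    ultimately show False using x by (blast dest: injD)
  qed
  then show ?thesis using sym by (simp add: pd_def)
qed

lemma pd_convex_comb:
  assumes "pd X" "pd Y" "0 \<le> u" "u \<le> 1"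
  shows "pd ((1 - u) *\<^sub>R X + u *\<^sub>R Y)"
proof -
  have "0 < x \<bullet> (((1 - u) *\<^sub>R X + u *\<^sub>R Y) *v x)" if "x \<noteq> 0" for x
  proof -
    have p: "0 < x \<bullet> (X *v x)" "0 < x \<bullet> (Y *v x)" using assms that by (auto simp: pd_def)
    have "x \<bullet> (((1 - u) *\<^sub>R X + u *\<^sub>R Y) *v x) = (1 - u) * (x \<bullet> (X *v x)) + u * (x \<bullet> (Y *v x))"
      by (simp add: matrix_vector_mult_add_rdistrib scaleR_matrix_vector_assoc[symmetric] inner_add_right)
    also have "\<dots> > 0"
    proof (cases "u = 0")
      case False
      then have "0 < u * (x \<bullet> (Y *v x))" "0 \<le> (1 - u) * (x \<bullet> (X *v x))" using p assms by auto
      then show ?thesis by simp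
    qed (use p in simp)
    finally show ?thesis .
  qed
  then show ?thesis using assms by (simp add: pd_def linear_comb[OF linear_transpose])
qed

text \<open>
  Up to an affine change of the radius, a divergence ball around the standard Gaussian.
\<close>
definition whitened_kl_ball :: "real \<Rightarrow> (real^'n^'n) set" where
  "whitened_kl_ball c = {Z. pd Z \<and> trace Z - ln (det Z) \<le> c}"

text \<open>
  Convexity amounts to concavity of \<open>ln det\<close>. For a convex combination \<open>Z\<close> of \<open>X\<close> and \<open>Y\<close>, whitening
  with respect to \<open>Z\<close> bounds \<open>ln (det M)\<close>, for every positive definite \<open>M\<close>, by the affine function
  \<open>trace (Z\<^sup>-\<^sup>1 M) - n + ln (det Z)\<close>, with equality at \<open>M = Z\<close>.
\<close>
lemma convex_whitened_kl_ball: "convex (whitened_kl_ball c :: (real^'n^'n) set)"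
  unfolding convex_alt
proof (intro ballI allI impI)
  fix X Y :: "real^'n^'n" and u :: real
  assume XY: "X \<in> whitened_kl_ball c" "Y \<in> whitened_kl_ball c" and u: "0 \<le> u \<and> u \<le> 1"
  define Z where "Z = (1 - u) *\<^sub>R X + u *\<^sub>R Y"
  have pd: "pd X" "pd Y" "pd Z" using XY u by (auto simp: whitened_kl_ball_def Z_def intro: pd_convex_comb)
  obtain S where S: "transpose S ** Z ** S = mat 1" "det S * det S * det Z = 1" "\<forall>x. S *v x = 0 \<longrightarrow> x = 0"
    using pd_whitening[OF pd(3)] by blast
  define \<phi> where "\<phi> M = trace (transpose S ** M ** S)" for M
  have lin: "linear \<phi>" using linear_compose[OF linear_congruence linear_trace] by (simp add: \<phi>_def[abs_def] o_def)
  have bound: "ln (det M) \<le> \<phi> M - real CARD('n) + ln (det Z)" if M: "pd M" for M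
  proof -
    have "det (transpose S ** M ** S) = det M / det Z"
    proof -
      have "det (transpose S ** M ** S) = (det S * det S) * det M" by (simp add: det_mul)
      moreover have "det S * det S = 1 / det Z" using S(2) pd_det_pos[OF pd(3)] by (simp add: field_simps)
      ultimately show ?thesis by simp
    qed
    then have "ln (det (transpose S ** M ** S)) = ln (det M) - ln (det Z)"
      using pd_det_pos[OF pd(3)] pd_det_pos[OF M] by (simp add: ln_div)
    moreover have "pd (transpose S ** M ** S)" by (rule pd_congruence[OF M]) (use S(3) in blast)
    ultimately show ?thesis
      using ln_det_le_trace[of "transpose S ** M ** S" 1] by (simp add: \<phi>_def)
  qed
  have "(1 - u) * \<phi> X + u * \<phi> Y = \<phi> Z" unfolding Z_def linear_comb[OF lin] by simp
  also have "\<dots> = real CARD('n)" by (simp add: \<phi>_def S(1) trace_I)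
  finally have n: "(1 - u) * \<phi> X + u * \<phi> Y = real CARD('n)" .
  have "(1 - u) * ln (det X) + u * ln (det Y)
      \<le> (1 - u) * (\<phi> X - real CARD('n) + ln (det Z)) + u * (\<phi> Y - real CARD('n) + ln (det Z))"
    using u bound[OF pd(1)] bound[OF pd(2)] by (intro add_mono mult_left_mono) auto
  also have "\<dots> = ((1 - u) * \<phi> X + u * \<phi> Y) - real CARD('n) + ln (det Z)" by (simp add: algebra_simps)
  finally have "(1 - u) * ln (det X) + u * ln (det Y) \<le> ln (det Z)" using n by simp
  moreover have "trace Z = (1 - u) * trace X + u * trace Y" unfolding Z_def linear_comb[OF linear_trace] by simp
  moreover have "(1 - u) * (trace X - ln (det X)) + u * (trace Y - ln (det Y)) \<le> (1 - u) * c + u * c"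
    using XY u by (intro add_mono mult_left_mono) (auto simp: whitened_kl_ball_def)
  ultimately have "trace Z - ln (det Z) \<le> c" by (simp add: algebra_simps)
  then show "(1 - u) *\<^sub>R X + u *\<^sub>R Y \<in> whitened_kl_ball c"
    using pd(3) by (simp add: whitened_kl_ball_def Z_def)
qed

text \<open>
  The trace is bounded on the ball, and it bounds all entries. Moreover \<open>det Z \<ge> exp (- c)\<close> there, so
  the determinant stays away from zero and limits of positive definite matrices remain
  positive definite.
\<close>
lemma compact_whitened_kl_ball: "compact (whitened_kl_ball c :: (real^'n^'n) set)"
proof -
  let ?K = "whitened_kl_ball c :: (real^'n^'n) set"
  define b where "b = 2 * (c + real CARD('n) * (ln 2 - 1))"
  have tr: "trace Z \<le> b" if "Z \<in> ?K" for Z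
    using ln_det_le_trace[of Z 2] that by (simp add: whitened_kl_ball_def b_def algebra_simps)
  have "norm Z \<le> real CARD('n) * (real CARD('n) * b)" if "Z \<in> ?K" for Z
    using that tr[OF that] psd_entry_le_trace[OF pd_imp_psd, of Z]
    by (intro matrix_norm_le_entries) (auto simp: whitened_kl_ball_def intro: order_trans)
  then have "bounded ?K" by (auto simp: bounded_iff)
  moreover have "closed ?K"
    unfolding closed_sequential_limits
  proof (intro allI impI, elim conjE)
    fix Zs and Z :: "real^'n^'n" assume Zs: "\<forall>n. Zs n \<in> ?K" and lim: "Zs \<longlonglongrightarrow> Z"
    have ent: "(\<lambda>n. Zs n $ i $ j) \<longlonglongrightarrow> Z $ i $ j" for i j by (intro tendsto_intros lim)
    have ldet: "(\<lambda>n. det (Zs n)) \<longlonglongrightarrow> det Z" unfolding det_def by (intro tendsto_intros ent)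
    have ltr: "(\<lambda>n. trace (Zs n)) \<longlonglongrightarrow> trace Z" unfolding trace_def by (intro tendsto_intros ent)
    have lquad: "(\<lambda>n. x \<bullet> (Zs n *v x)) \<longlonglongrightarrow> x \<bullet> (Z *v x)" for x
      unfolding inner_vec_def matrix_vector_mult_def by (simp, intro tendsto_intros ent)
    have psdn: "psd (Zs n)" for n using Zs by (auto simp: whitened_kl_ball_def intro: pd_imp_psd)
    have "psd Z"
      unfolding psd_def
    proof (intro conjI allI)
      show "0 \<le> x \<bullet> (Z *v x)" for x
        using LIMSEQ_le_const[OF lquad] psdn by (auto simp: psd_def)
      have "Z $ i $ j = Z $ j $ i" for i j
      proof (rule LIMSEQ_unique[OF ent])
        have "Zs n $ i $ j = Zs n $ j $ i" for n using psdn[of n] by (simp add: psd_def symmetric_entry)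
        then show "(\<lambda>n. Zs n $ i $ j) \<longlonglongrightarrow> Z $ j $ i" using ent[of j i] by simp
      qed
      then show "transpose Z = Z" by (simp add: transpose_def vec_eq_iff)
    qed
    have "exp (- c) \<le> det (Zs n)" for n
    proof -
      have pd: "pd (Zs n)" and le: "trace (Zs n) - ln (det (Zs n)) \<le> c" using Zs by (auto simp: whitened_kl_ball_def)
      have "0 \<le> trace (Zs n)" using psd_entry_le_trace[OF psdn, of n undefined undefined] by linarith
      then have "exp (- c) \<le> exp (ln (det (Zs n)))" using le by simp
      then show ?thesis using pd_det_pos[OF pd] by simp
    qed
    then have "exp (- c) \<le> det Z" using LIMSEQ_le_const[OF ldet] by blast
    then have dpos: "0 < det Z" using exp_gt_zero[of "-c"] by linarith
    have "(\<lambda>n. trace (Zs n) - ln (det (Zs n))) \<longlonglongrightarrow> trace Z - ln (det Z)"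
      using dpos by (intro tendsto_intros ltr ldet) auto
    then have "trace Z - ln (det Z) \<le> c"
      by (rule LIMSEQ_le_const2) (use Zs in \<open>auto simp: whitened_kl_ball_def\<close>)
    then show "Z \<in> ?K"
      using psd_nonsingular_imp_pd[OF \<open>psd Z\<close>] dpos by (simp add: whitened_kl_ball_def)
  qed
  ultimately show ?thesis by (simp add: compact_eq_bounded_closed)
qed

definition kl_block :: "real^'n^'n \<Rightarrow> real \<Rightarrow> (real^'n^'n) set" where
  "kl_block Y \<rho> = {X. pd X \<and> kl_gauss X Y \<le> \<rho>}"

text \<open>
  Here \<open>T\<close> is the inverse of the whitening matrix \<open>S\<close> of \<open>Y\<close>: the divergence of \<open>N(0, X)\<close> from
  \<open>N(0, Y)\<close> is that of \<open>N(0, S\<^sup>T X S)\<close> from the standard Gaussian.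
\<close>
lemma kl_block_whitened:
  fixes Y :: "real^'n^'n"
  assumes "pd Y"
  obtains T :: "real^'n^'n" where "kl_block Y \<rho> = (\<lambda>Z. transpose T ** Z ** T) ` whitened_kl_ball (2 * \<rho> + real CARD('n))"
proof -
  obtain S where S: "transpose S ** Y ** S = mat 1" "matrix_inv Y = S ** transpose S" "det S * det S * det Y = 1"
    "\<forall>x. S *v x = 0 \<longrightarrow> x = 0" "S ** (transpose S ** Y) = mat 1"
    using pd_whitening[OF assms] by blast
  define T :: "real^'n^'n" where "T = transpose S ** Y"
  have ST: "S ** T = mat 1" "T ** S = mat 1" using S(1,5) by (auto simp: T_def)
  have STt: "transpose T ** transpose S = mat 1" "transpose S ** transpose T = mat 1"
    using ST by (metis matrix_transpose_mul transpose_mat)+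
  have Tinj: "x = 0" if "T *v x = 0" for x
  proof -
    have "x = (S ** T) *v x" by (simp add: ST)
    also have "\<dots> = S *v (T *v x)" by (simp only: matrix_vector_mul_assoc)
    finally show ?thesis using that by (simp add: matrix_vector_mult_0_right)
  qed
  have inv1: "transpose S ** (transpose T ** Z ** T) ** S = Z" for Z
  proof -
    have "transpose S ** (transpose T ** Z ** T) ** S = (transpose S ** transpose T) ** Z ** (T ** S)"
      by (simp only: matrix_mul_assoc)
    then show ?thesis by (simp add: ST STt)
  qed
  have inv2: "transpose T ** (transpose S ** X ** S) ** T = X" for X
  proof -
    have "transpose T ** (transpose S ** X ** S) ** T = (transpose T ** transpose S) ** X ** (S ** T)"
      by (simp only: matrix_mul_assoc)
    then show ?thesis by (simp add: ST STt)
  qed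
  have kl: "kl_gauss X Y = 1/2 * (trace (transpose S ** X ** S) - real CARD('n) - ln (det (transpose S ** X ** S)))"
    if X: "pd X" for X
  proof -
    have tr: "trace (matrix_inv Y ** X) = trace (transpose S ** X ** S)"
      unfolding S(2) matrix_mul_assoc[symmetric] by (subst trace_mul_sym) (simp only: matrix_mul_assoc)
    have Yp: "0 < det Y" and Xp: "0 < det X" using assms X by (auto intro: pd_det_pos)
    have "det S * det S = 1 / det Y" using S(3) Yp by (simp add: field_simps)
    moreover have "det (transpose S ** X ** S) = (det S * det S) * det X" by (simp add: det_mul)
    ultimately have "det (transpose S ** X ** S) = det X / det Y" by simp
    then have "ln (det Y / det X) = - ln (det (transpose S ** X ** S))" using Yp Xp by (simp add: ln_div)
    then show ?thesis unfolding kl_gauss_def tr by simp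
  qed
  have "kl_block Y \<rho> = (\<lambda>Z. transpose T ** Z ** T) ` whitened_kl_ball (2 * \<rho> + real CARD('n))"
  proof (intro equalityI subsetI)
    fix X assume X: "X \<in> kl_block Y \<rho>"
    then have "transpose S ** X ** S \<in> whitened_kl_ball (2 * \<rho> + real CARD('n))"
      using kl[of X] pd_congruence[OF _ S(4)[rule_format], of X] by (auto simp: kl_block_def whitened_kl_ball_def)
    then show "X \<in> (\<lambda>Z. transpose T ** Z ** T) ` whitened_kl_ball (2 * \<rho> + real CARD('n))"
      using inv2[of X] by (metis image_eqI)
  next
    fix X assume "X \<in> (\<lambda>Z. transpose T ** Z ** T) ` whitened_kl_ball (2 * \<rho> + real CARD('n))"
    then obtain Z where Z: "pd Z" "trace Z - ln (det Z) \<le> 2 * \<rho> + real CARD('n)" "X = transpose T ** Z ** T"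
      by (auto simp: whitened_kl_ball_def)
    have pX: "pd X" unfolding Z(3) by (rule pd_congruence[OF Z(1) Tinj])
    show "X \<in> kl_block Y \<rho>" using kl[OF pX] Z(2) pX inv1[of Z] unfolding Z(3) by (simp add: kl_block_def)
  qed
  then show ?thesis using that by blast
qed

lemma kl_block_compact:
  fixes Y :: "real^'n^'n"
  assumes "pd Y" shows "compact (kl_block Y \<rho>)"
proof -
  obtain T :: "real^'n^'n" where T: "kl_block Y \<rho> = (\<lambda>Z. transpose T ** Z ** T) ` whitened_kl_ball (2 * \<rho> + real CARD('n))"
    using kl_block_whitened[OF assms] by blast
  show ?thesis
    unfolding T by (rule compact_continuous_image[OF linear_continuous_on compact_whitened_kl_ball])
      (rule linear_conv_bounded_linear[THEN iffD1, OF linear_congruence])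
qed

lemma kl_block_convex:
  fixes Y :: "real^'n^'n"
  assumes "pd Y" shows "convex (kl_block Y \<rho>)"
proof -
  obtain T :: "real^'n^'n" where T: "kl_block Y \<rho> = (\<lambda>Z. transpose T ** Z ** T) ` whitened_kl_ball (2 * \<rho> + real CARD('n))"
    using kl_block_whitened[OF assms] by blast
  show ?thesis unfolding T by (rule convex_linear_image[OF linear_congruence convex_whitened_kl_ball])
qed

lemma kl_block_center:
  fixes Y :: "real^'n^'n"
  assumes "pd Y" "0 \<le> \<rho>" shows "Y \<in> kl_block Y \<rho>"
proof -
  obtain S :: "real^'n^'n" where S: "matrix_inv Y = S ** transpose S" "S ** (transpose S ** Y) = mat 1"
    using pd_whitening[OF assms(1)] by blast
  then have "matrix_inv Y ** Y = mat 1" by (simp add: matrix_mul_assoc)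
  then show ?thesis using assms pd_det_pos[OF assms(1)] by (simp add: kl_block_def kl_gauss_def trace_I)
qed

section \<open>The set of covariances\<close>

lemma time_less: "s < t \<Longrightarrow> time s < time t"
  unfolding time_def by (rule psubset_card_mono) auto

lemma inj_time: "inj time"
  by (rule linorder_injI) (metis less_irrefl time_less)

lemma time_eq_iff [simp]: "time s = time t \<longleftrightarrow> s = t"
  by (simp add: inj_eq[OF inj_time])

lemma time_bound: "time (t :: 't::{finite,linorder}) < CARD('t)"
  unfolding time_def by (rule psubset_card_mono) auto

lemma range_time: "range (time :: 't::{finite,linorder} \<Rightarrow> nat) = {..<CARD('t)}"
  by (rule card_subset_eq) (auto simp: time_bound card_image[OF inj_time])

lemma time_option_bound: "time (t :: 't::{finite,linorder} option) \<le> CARD('t)"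
  using time_bound[of t] by (simp add: card_option)

lemma range_time_option: "range (time :: 't::{finite,linorder} option \<Rightarrow> nat) = {..CARD('t)}"
  unfolding range_time by (auto simp: card_option)

definition diag_block :: "real^('a::finite \<times> 'r::finite)^('a \<times> 'r) \<Rightarrow> 'r \<Rightarrow> real^'a^'a" where
  "diag_block M t = (\<chi> i j. M $ (i, t) $ (j, t))"

definition slice :: "real^('a::finite \<times> 'r::finite) \<Rightarrow> 'r \<Rightarrow> real^'a" where
  "slice x t = (\<chi> i. x $ (i, t))"

lemma block_diag_entry:
  "(block_diag F :: real^('b::finite \<times> 's::{finite,linorder})^('a::finite \<times> 'r::{finite,linorder})) $ (i, t) $ (j, s)
     = (if time t = time s then F (time t) $ i $ j else 0)"
  by (simp add: block_diag_def block_mat_def)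

lemma inner_block_diag:
  fixes x :: "real^('a::finite \<times> 'r::{finite,linorder})"
  shows "x \<bullet> (block_diag F *v x) = (\<Sum>t\<in>UNIV. slice x t \<bullet> (F (time t) *v slice x t))"
proof -
  have UU: "(UNIV :: ('a \<times> 'r) set) = UNIV \<times> UNIV" by simp
  have row: "(block_diag F *v x) $ (i, t) = (F (time t) *v slice x t) $ i" for i and t :: 'r
  proof -
    have "(block_diag F *v x) $ (i, t) = (\<Sum>j\<in>UNIV. \<Sum>s\<in>UNIV. (if t = s then F (time t) $ i $ j else 0) * x $ (j, s))"
      unfolding matrix_vector_mult_def UU sum.cartesian_product' by (simp add: block_diag_entry)
    also have "\<dots> = (\<Sum>j\<in>UNIV. \<Sum>s\<in>UNIV. if s = t then F (time t) $ i $ j * x $ (j, s) else 0)"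
      by (intro sum.cong) auto
    also have "\<dots> = (F (time t) *v slice x t) $ i" by (simp add: matrix_vector_mult_def slice_def)
    finally show ?thesis .
  qed
  have "x \<bullet> (block_diag F *v x) = (\<Sum>i\<in>UNIV. \<Sum>t\<in>UNIV. x $ (i, t) * (F (time t) *v slice x t) $ i)"
    unfolding inner_vec_def UU sum.cartesian_product' by (simp add: row)
  also have "\<dots> = (\<Sum>t\<in>UNIV. \<Sum>i\<in>UNIV. x $ (i, t) * (F (time t) *v slice x t) $ i)" by (rule sum.swap)
  finally show ?thesis by (simp add: inner_vec_def slice_def)
qed

lemma transpose_block_diag:
  assumes "\<And>t :: 'r. transpose (F (time t)) = F (time t)"
  shows "transpose (block_diag F) = (block_diag F :: real^('a::finite \<times> 'r::{finite,linorder})^('a \<times> 'r))"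
proof -
  have "(block_diag F :: real^('a \<times> 'r)^('a \<times> 'r)) $ (j, s) $ (i, t) = block_diag F $ (i, t) $ (j, s)" for i j s t
    using symmetric_entry[OF assms, of t j i] by (cases "t = s") (simp_all add: block_diag_entry)
  then show ?thesis by (auto simp: transpose_def vec_eq_iff)
qed

lemma psd_block_diag:
  assumes "\<And>t :: 'r. psd (F (time t))"
  shows "psd (block_diag F :: real^('a::finite \<times> 'r::{finite,linorder})^('a \<times> 'r))"
  unfolding psd_def inner_block_diag
  using assms by (auto intro!: transpose_block_diag sum_nonneg simp: psd_def)

lemma pd_block_diag:
  assumes "\<And>t :: 'r. pd (F (time t))"
  shows "pd (block_diag F :: real^('a::finite \<times> 'r::{finite,linorder})^('a \<times> 'r))"
  unfolding pd_def inner_block_diag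
proof (intro conjI allI impI)
  show "transpose (block_diag F) = (block_diag F :: real^('a \<times> 'r)^('a \<times> 'r))"
    by (rule transpose_block_diag) (use assms in \<open>simp add: pd_def\<close>)
  fix x :: "real^('a \<times> 'r)" assume "x \<noteq> 0"
  then obtain i t where "x $ (i, t) \<noteq> 0" by (auto simp: vec_eq_iff)
  then have "slice x t \<noteq> 0" by (auto simp: slice_def vec_eq_iff)
  then have pos: "0 < slice x t \<bullet> (F (time t) *v slice x t)" using assms[of t] by (simp add: pd_def)
  show "0 < (\<Sum>t\<in>UNIV. slice x t \<bullet> (F (time t) *v slice x t))"
    by (rule sum_pos2[of _ t]) (use pos assms pd_imp_psd in \<open>auto simp: psd_def\<close>)
qed

lemma upper_block_diag2 [simp]: "upper_block (diag2 X Y) = X"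
  and lower_block_diag2 [simp]: "lower_block (diag2 X Y) = Y"
  by (simp_all add: upper_block_def lower_block_def diag2_def vec_eq_iff)

lemma linear_upper_block: "linear upper_block" and linear_lower_block: "linear lower_block"
  by (auto intro!: linearI simp: upper_block_def lower_block_def vec_eq_iff)

lemma linear_diag_block: "linear (\<lambda>M. diag_block M t)"
  by (rule linearI) (simp_all add: diag_block_def vec_eq_iff)

definition block_diagonal :: "real^('a::finite \<times> 'r::finite)^('a \<times> 'r) \<Rightarrow> bool" where
  "block_diagonal M \<longleftrightarrow> (\<forall>i j t s. t \<noteq> s \<longrightarrow> M $ (i, t) $ (j, s) = 0)"

lemma block_diagonal_iff:
  fixes M :: "real^('a::finite \<times> 'r::{finite,linorder})^('a \<times> 'r)"
  shows "block_diagonal M \<longleftrightarrow> M = block_diag (\<lambda>k. diag_block M (inv time k))"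
proof
  assume "block_diagonal M"
  then show "M = block_diag (\<lambda>k. diag_block M (inv time k))"
    by (auto simp: vec_eq_iff block_diag_entry diag_block_def block_diagonal_def inv_f_f[OF inj_time])
next
  assume M: "M = block_diag (\<lambda>k. diag_block M (inv time k))"
  show "block_diagonal M" by (subst M) (simp add: block_diagonal_def block_diag_entry)
qed

lemma diag_block_block_diag [simp]:
  fixes t :: "'r::{finite,linorder}"
  shows "diag_block (block_diag F :: real^('a::finite \<times> 'r)^('a \<times> 'r)) t = F (time t)"
  by (simp add: diag_block_def block_diag_entry vec_eq_iff)

lemma block_diagonal_block_diag [simp]:
  "block_diagonal (block_diag F :: real^('a::finite \<times> 'r::{finite,linorder})^('a \<times> 'r))"
  by (simp add: block_diagonal_def block_diag_entry)

lemma block_diagonal_entry_le: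
  assumes M: "block_diagonal M" "0 \<le> B" "\<And>t. norm (diag_block M t) \<le> B"
  shows "\<bar>M $ x $ y\<bar> \<le> B"
proof (cases "snd x = snd y")
  case True
  have "M $ x $ y = diag_block M (snd x) $ fst x $ fst y"
    using True by (cases x; cases y) (simp add: diag_block_def)
  also have "\<bar>\<dots>\<bar> \<le> norm (diag_block M (snd x))"
    by (rule order_trans[OF component_le_norm_cart Finite_Cartesian_Product.norm_nth_le])
  finally show ?thesis using M(3)[of "snd x"] by simp
next
  case False
  then show ?thesis using M(1,2) by (cases x; cases y) (simp add: block_diagonal_def)
qed

definition off_diag_zero :: "real^('a::finite + 'b::finite)^('a + 'b) \<Rightarrow> bool" where
  "off_diag_zero M \<longleftrightarrow> (\<forall>a b. M $ Inl a $ Inr b = 0 \<and> M $ Inr b $ Inl a = 0)"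

lemma diag2_blocks: "off_diag_zero M \<Longrightarrow> diag2 (upper_block M) (lower_block M) = M"
  by (auto simp: vec_eq_iff diag2_def upper_block_def lower_block_def off_diag_zero_def split: sum.splits)

lemma off_diag_zero_diag2 [simp]: "off_diag_zero (diag2 X Y)"
  by (simp add: off_diag_zero_def diag2_def)

text \<open>
  Describes the ball by conditions on linear images of the matrix itself instead of by the families
  that generate it, which makes convexity and closedness matters of preimages under linear maps.
\<close>
lemma kl_ball_iff:
  fixes P :: "('n::finite, 'm::finite, 'p::finite) lqg" and M :: "('n, 'p, 't::{finite,linorder}) cov"
  shows "M \<in> kl_ball P \<longleftrightarrow> off_diag_zero M \<and> block_diagonal (upper_block M) \<and> block_diagonal (lower_block M) \<and>
     (\<forall>t. diag_block (upper_block M) t \<in> kl_block (What P (time t)) (rho_w P (time t))) \<and>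
     (\<forall>t. diag_block (lower_block M) t \<in> kl_block (Vhat P (time t)) (rho_v P (time t)))"
    (is "_ \<longleftrightarrow> ?R")
proof
  assume "M \<in> kl_ball P"
  then obtain W V where M: "M = diag2 (block_diag W) (block_diag V)"
    and W: "\<And>t. t \<le> CARD('t) \<Longrightarrow> pd (W t) \<and> kl_gauss (W t) (What P t) \<le> rho_w P t"
    and V: "\<And>t. t < CARD('t) \<Longrightarrow> pd (V t) \<and> kl_gauss (V t) (Vhat P t) \<le> rho_v P t"
    unfolding kl_ball_def by blast
  show ?R unfolding M using W[OF time_option_bound] V[OF time_bound] by (simp add: kl_block_def)
next
  assume R: ?R
  define W where "W k = diag_block (upper_block M) (inv time k)" for k
  define V where "V k = diag_block (lower_block M) (inv time k)" for k
  have "M = diag2 (block_diag W) (block_diag V)"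
    using R diag2_blocks[of M] by (simp add: block_diagonal_iff W_def[abs_def] V_def[abs_def])
  moreover have "pd (W k) \<and> kl_gauss (W k) (What P k) \<le> rho_w P k" if "k \<le> CARD('t)" for k
  proof -
    have "k \<in> range (time :: 't option \<Rightarrow> nat)" using that by (simp add: range_time_option)
    then obtain t :: "'t option" where "k = time t" by blast
    then show ?thesis using R by (simp add: W_def kl_block_def inv_f_f[OF inj_time])
  qed
  moreover have "pd (V k) \<and> kl_gauss (V k) (Vhat P k) \<le> rho_v P k" if "k < CARD('t)" for k
  proof -
    have "k \<in> range (time :: 't \<Rightarrow> nat)" using that by (simp add: range_time)
    then obtain t :: 't where "k = time t" by blast
    then show ?thesis using R by (simp add: V_def kl_block_def inv_f_f[OF inj_time])
  qed
  ultimately show "M \<in> kl_ball P" unfolding kl_ball_def by blast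
qed

lemma linear_vimage_closed: "linear f \<Longrightarrow> closed T \<Longrightarrow> closed {x. f x \<in> T}" for f :: "'a::euclidean_space \<Rightarrow> 'b::real_normed_vector"
  using continuous_closed_vimage[of T f] linear_continuous_at[of f] by (simp add: vimage_def linear_conv_bounded_linear)

lemma linear_vimage_convex: "linear f \<Longrightarrow> convex T \<Longrightarrow> convex {x. f x \<in> T}"
  using convex_linear_vimage[of f T] by (simp add: vimage_def)

lemma kl_ball_upper_pd: "M \<in> kl_ball P \<Longrightarrow> pd (upper_block (M :: ('n::finite, 'p::finite, 't::{finite,linorder}) cov))"
  by (auto simp: kl_ball_def intro!: pd_block_diag time_option_bound)

lemma kl_ball_lower_pd: "M \<in> kl_ball P \<Longrightarrow> pd (lower_block (M :: ('n::finite, 'p::finite, 't::{finite,linorder}) cov))"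
  by (auto simp: kl_ball_def intro!: pd_block_diag time_bound)

lemma kl_ball_inter:
  "(kl_ball P :: ('n::finite, 'p::finite, 't::{finite,linorder}) cov set) = {M. off_diag_zero M} \<inter> {M. block_diagonal (upper_block M)}
     \<inter> {M. block_diagonal (lower_block M)}
     \<inter> (\<Inter>t. {M. diag_block (upper_block M) t \<in> kl_block (What P (time t)) (rho_w P (time t))})
     \<inter> (\<Inter>t. {M. diag_block (lower_block M) t \<in> kl_block (Vhat P (time t)) (rho_v P (time t))})"
  by (auto simp: kl_ball_iff)

lemma subspace_off_diag: "subspace {M :: ('n::finite, 'p::finite, 't::{finite,linorder}) cov. off_diag_zero M}"
  by (auto simp: subspace_def off_diag_zero_def)

lemma subspace_block_diagonal:
  "subspace {M :: ('n::finite, 'p::finite, 't::{finite,linorder}) cov. block_diagonal (upper_block M)}"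
  "subspace {M :: ('n::finite, 'p::finite, 't::{finite,linorder}) cov. block_diagonal (lower_block M)}"
  by (auto simp: subspace_def block_diagonal_def upper_block_def lower_block_def)

lemma linear_blocks:
  "linear (\<lambda>M :: ('n::finite, 'p::finite, 't::{finite,linorder}) cov. diag_block (upper_block M) t)"
  "linear (\<lambda>M :: ('n::finite, 'p::finite, 't::{finite,linorder}) cov. diag_block (lower_block M) s)"
  using linear_compose[OF linear_upper_block linear_diag_block] linear_compose[OF linear_lower_block linear_diag_block]
  by (simp_all add: o_def)

context
  fixes P :: "('n::finite, 'm::finite, 'p::finite) lqg"
  assumes What: "\<And>t. t \<le> CARD('t::{finite,linorder}) \<Longrightarrow> pd (What P t) \<and> 0 \<le> rho_w P t"
    and Vhat: "\<And>t. t < CARD('t) \<Longrightarrow> pd (Vhat P t) \<and> 0 \<le> rho_v P t"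
begin

lemma kl_ball_nonempty: "(kl_ball P :: ('n, 'p, 't) cov set) \<noteq> {}"
proof -
  have "diag2 (block_diag (What P)) (block_diag (Vhat P)) \<in> (kl_ball P :: ('n, 'p, 't) cov set)"
    unfolding kl_ball_iff
    using What[OF time_option_bound] Vhat[OF time_bound] by (simp add: kl_block_center)
  then show ?thesis by blast
qed

lemma kl_ball_convex: "convex (kl_ball P :: ('n, 'p, 't) cov set)"
  unfolding kl_ball_inter
  by (intro convex_Int convex_INT subspace_imp_convex subspace_off_diag subspace_block_diagonal
      linear_vimage_convex linear_blocks kl_block_convex)
     (use What[OF time_option_bound] Vhat[OF time_bound] in auto)

lemma kl_ball_closed: "closed (kl_ball P :: ('n, 'p, 't) cov set)"
  unfolding kl_ball_inter
  by (intro closed_Int closed_INT ballI closed_subspace subspace_off_diag subspace_block_diagonal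
      linear_vimage_closed linear_blocks compact_imp_closed kl_block_compact)
     (use What[OF time_option_bound] Vhat[OF time_bound] in auto)

lemma kl_ball_bounded: "bounded (kl_ball P :: ('n, 'p, 't) cov set)"
proof -
  have "\<exists>b. \<forall>X\<in>kl_block (What P (time t)) (rho_w P (time t)). norm X \<le> b" for t :: "'t option"
    using compact_imp_bounded[OF kl_block_compact] What[OF time_option_bound[of t]] by (auto simp: bounded_iff)
  then obtain bw where bw: "\<And>t :: 't option. \<And>X. X \<in> kl_block (What P (time t)) (rho_w P (time t)) \<Longrightarrow> norm X \<le> bw t"
    by metis
  have "\<exists>b. \<forall>X\<in>kl_block (Vhat P (time t)) (rho_v P (time t)). norm X \<le> b" for t :: 't
    using compact_imp_bounded[OF kl_block_compact] Vhat[OF time_bound[of t]] by (auto simp: bounded_iff)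
  then obtain bv where bv: "\<And>t :: 't. \<And>X. X \<in> kl_block (Vhat P (time t)) (rho_v P (time t)) \<Longrightarrow> norm X \<le> bv t"
    by metis
  define B where "B = (\<Sum>t\<in>UNIV. \<bar>bw t\<bar>) + (\<Sum>t\<in>UNIV. \<bar>bv t\<bar>)"
  have Bw: "\<bar>bw t\<bar> \<le> B" for t
    using member_le_sum[of t UNIV "\<lambda>t. \<bar>bw t\<bar>"] by (simp add: B_def add_increasing2 sum_nonneg)
  have Bv: "\<bar>bv t\<bar> \<le> B" for t
    using member_le_sum[of t UNIV "\<lambda>t. \<bar>bv t\<bar>"] by (simp add: B_def add_increasing sum_nonneg)
  have B0: "0 \<le> B" by (simp add: B_def sum_nonneg)
  have "\<bar>M $ a $ b\<bar> \<le> B" if M: "M \<in> kl_ball P" for M :: "('n, 'p, 't) cov" and a b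
  proof -
    note R = M[unfolded kl_ball_iff]
    have nbw: "norm (diag_block (upper_block M) t) \<le> B" for t
      by (rule order_trans[OF bw order_trans[OF abs_ge_self Bw]]) (use R in blast)
    have nbv: "norm (diag_block (lower_block M) t) \<le> B" for t
      by (rule order_trans[OF bv order_trans[OF abs_ge_self Bv]]) (use R in blast)
    have "\<bar>upper_block M $ x $ y\<bar> \<le> B" for x y
      by (rule block_diagonal_entry_le) (use R B0 nbw in auto)
    moreover have "\<bar>lower_block M $ x $ y\<bar> \<le> B" for x y
      by (rule block_diagonal_entry_le) (use R B0 nbv in auto)
    ultimately show ?thesis
      using R B0 by (cases a; cases b) (auto simp: upper_block_def lower_block_def off_diag_zero_def)
  qed
  then have "norm M \<le> real CARD(('n \<times> 't option) + ('p \<times> 't)) * (real CARD(('n \<times> 't option) + ('p \<times> 't)) * B)"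
    if "M \<in> kl_ball P" for M :: "('n, 'p, 't) cov"
    using that by (intro matrix_norm_le_entries) blast
  then show ?thesis unfolding bounded_iff by blast
qed

lemma kl_ball_compact: "compact (kl_ball P :: ('n, 'p, 't) cov set)"
  using kl_ball_closed kl_ball_bounded by (simp add: compact_eq_bounded_closed)

end

section \<open>The payoff\<close>

text \<open>
  For positive semidefinite \<open>M\<close> and \<open>W\<close> this is the expectation of \<open>x\<^sup>T Z\<^sup>T M Z x\<close> for centred \<open>x\<close>
  with covariance \<open>W\<close>.
\<close>
definition qform :: "real^'l^'l \<Rightarrow> real^'k^'k \<Rightarrow> real^'k^'l \<Rightarrow> real" where
  "qform M W Z = trace (transpose Z ** M ** Z ** W)"

lemmas matrix_linear_simps =
  linear_add[OF linear_matrix_mult_left] linear_add[OF linear_matrix_mult_right]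
  linear_scale[OF linear_matrix_mult_left] linear_scale[OF linear_matrix_mult_right]
  linear_add[OF linear_transpose] linear_scale[OF linear_transpose]
  linear_add[OF linear_trace] linear_scale[OF linear_trace]
  linear_diff[OF linear_matrix_mult_left] linear_diff[OF linear_matrix_mult_right]
  linear_diff[OF linear_transpose] linear_diff[OF linear_trace]

lemma qform_nonneg: "psd M \<Longrightarrow> psd W \<Longrightarrow> 0 \<le> qform M W Z"
  unfolding qform_def by (intro trace_psd_mult_nonneg psd_congruence)

text \<open>
  The identity that expresses the convexity defect of a quadratic form.
\<close>
lemma qform_comb:
  "qform M W ((1 - u) *\<^sub>R Z + u *\<^sub>R Y) = (1 - u) * qform M W Z + u * qform M W Y - u * (1 - u) * qform M W (Z - Y)"
  by (simp add: qform_def matrix_linear_simps) (simp add: algebra_simps)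

lemma convex_on_qform_affine:
  assumes "psd M" "psd W" and aff: "\<And>u x y. L ((1 - u) *\<^sub>R x + u *\<^sub>R y) = (1 - u) *\<^sub>R L x + u *\<^sub>R L y"
  shows "convex_on UNIV (\<lambda>x. qform M W (L x))"
proof (rule convex_onI)
  fix t :: real and x y assume t: "0 < t" "t < 1"
  have "0 \<le> t * (1 - t) * qform M W (L x - L y)" using t assms by (simp add: qform_nonneg)
  then show "qform M W (L ((1 - t) *\<^sub>R x + t *\<^sub>R y)) \<le> (1 - t) * qform M W (L x) + t * qform M W (L y)"
    unfolding aff qform_comb by simp
qed simp

text \<open>
  With the spectral decomposition of \<open>W\<close> the form is \<open>\<Sum>\<^sub>k d\<^sub>k (Z p\<^sub>k)\<^sup>T M (Z p\<^sub>k)\<close>. It vanishes only if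
  \<open>Z\<close> annihilates the basis \<open>p\<^sub>k\<close>.
\<close>
lemma qform_pos:
  assumes M: "pd M" and W: "pd W" and Z: "Z \<noteq> 0"
  shows "0 < qform M W Z"
proof -
  obtain P d where D: "spectral_decomp P d W" using spectral_decomp_exists W by (metis pd_def)
  have dp: "0 < d k" for k
    using spectral_eigenvalue[OF D, of k] spectral_column_nonzero[OF D, of k] W by (simp add: pd_def)
  have q: "qform M W Z = (\<Sum>k\<in>UNIV. d k * ((Z *v column k P) \<bullet> (M *v (Z *v column k P))))"
    unfolding qform_def spectral_trace_mult[OF D] inner_congruence ..
  have Mnn: "0 \<le> x \<bullet> (M *v x)" for x using pd_imp_psd[OF M] by (simp add: psd_def)
  have "\<exists>k. Z *v column k P \<noteq> 0"
  proof (rule ccontr)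
    assume "\<not> ?thesis"
    then have "Z *v column k P = 0" for k by simp
    moreover have "(Z ** P) $ i $ k = (Z *v column k P) $ i" for i k
      by (simp add: matrix_matrix_mult_def matrix_vector_mult_def column_def)
    ultimately have "(Z ** P) $ i $ k = 0" for i k by simp
    then have "Z ** P = 0" by (simp add: vec_eq_iff)
    then have "Z ** (P ** transpose P) = 0" by (simp add: matrix_mul_assoc)
    then show False using Z spectral_decompD(3)[OF D] by simp
  qed
  then obtain k where "Z *v column k P \<noteq> 0" by blast
  then have "0 < d k * ((Z *v column k P) \<bullet> (M *v (Z *v column k P)))" using dp[of k] M by (simp add: pd_def)
  then show ?thesis
    unfolding q by (intro sum_pos2[of _ k]) (use dp Mnn in \<open>auto intro!: mult_nonneg_nonneg less_imp_le[OF dp]\<close>)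
qed

lemma qform_scale: "qform M W (c *\<^sub>R Z) = c\<^sup>2 * qform M W Z"
  by (simp add: qform_def matrix_linear_simps power2_eq_square)

text \<open>
  On compact sets this class of functions is closed under matrix products, so that the Lipschitz
  property of the payoff follows from its shape, without keeping track of constants.
\<close>
definition lip_on :: "'a::metric_space set \<Rightarrow> ('a \<Rightarrow> 'b::metric_space) \<Rightarrow> bool" where
  "lip_on K f \<longleftrightarrow> (\<exists>L. L-lipschitz_on K f)"

lemma lip_on_const: "lip_on K (\<lambda>_. c)"
  unfolding lip_on_def using lipschitz_on_constant by blast

lemma lip_on_add: "lip_on K f \<Longrightarrow> lip_on K g \<Longrightarrow> lip_on K (\<lambda>x. f x + g x)"
  for f g :: "'a::metric_space \<Rightarrow> 'b::real_normed_vector"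
  unfolding lip_on_def using lipschitz_on_add by blast

lemma lip_on_linear:
  fixes h :: "'b::euclidean_space \<Rightarrow> 'c::real_normed_vector"
  assumes "linear h" "lip_on K f" shows "lip_on K (\<lambda>x. h (f x))"
proof -
  obtain B where B: "B-lipschitz_on UNIV h"
    using bounded_linear.lipschitz_boundE[of h] assms(1) by (metis linear_conv_bounded_linear)
  obtain L where L: "L-lipschitz_on K f" using assms(2) by (auto simp: lip_on_def)
  show ?thesis unfolding lip_on_def using lipschitz_on_compose2[OF L lipschitz_on_subset[OF B]] by blast
qed

lemma lip_on_matrix_mult:
  fixes f :: "'a::metric_space \<Rightarrow> real^'m^'n" and g :: "'a \<Rightarrow> real^'k^'m"
  assumes K: "compact K" and f: "lip_on K f" and g: "lip_on K g"
  shows "lip_on K (\<lambda>x. f x ** g x)"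
proof -
  obtain Lf Lg where L: "Lf-lipschitz_on K f" "Lg-lipschitz_on K g" using f g by (auto simp: lip_on_def)
  have "bounded (f ` K)" "bounded (g ` K)"
    using L K by (auto intro!: compact_imp_bounded compact_continuous_image lipschitz_on_continuous_on)
  then show ?thesis
    unfolding lip_on_def using lipschitz_on_bilinear[OF bounded_bilinear_matrix_mult L] by blast
qed

context
  fixes P :: "('n::finite, 'm::finite, 'p::finite) lqg"
begin

lemma payoff_eq:
  fixes U :: "('m, 'p, 't::{finite,linorder}) gain"
  shows "payoff P U \<Sigma> =
    qform (stackR P) (upper_block \<Sigma>) (U ** stackD P)
    + qform (stackQ P) (upper_block \<Sigma>) (stackH P ** U ** stackD P + stackG P)
    + (qform (stackR P) (lower_block \<Sigma>) U + qform (stackQ P) (lower_block \<Sigma>) (stackH P ** U))"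
proof -
  have 1: "transpose (stackD P) ** transpose U ** stackR P ** U ** stackD P
      = transpose (U ** stackD P) ** stackR P ** (U ** stackD P)"
    by (simp only: matrix_transpose_mul matrix_mul_assoc)
  have 2: "transpose U ** transpose (stackH P) ** stackQ P ** stackH P ** U
      = transpose (stackH P ** U) ** stackQ P ** (stackH P ** U)"
    by (simp only: matrix_transpose_mul matrix_mul_assoc)
  show ?thesis unfolding payoff_def F1_def F2_def 1 2 qform_def matrix_linear_simps ..
qed

lemma linear_payoff: "linear (payoff P (U :: ('m, 'p, 't::{finite,linorder}) gain))"
proof -
  have "linear (\<lambda>\<Sigma>. trace (F1 P U ** upper_block \<Sigma>))"
    using linear_compose[OF linear_upper_block linear_compose[OF linear_matrix_mult_left[of "F1 P U"] linear_trace]]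
    by (simp add: o_def)
  moreover have "linear (\<lambda>\<Sigma>. trace (F2 P U ** lower_block \<Sigma>))"
    using linear_compose[OF linear_lower_block linear_compose[OF linear_matrix_mult_left[of "F2 P U"] linear_trace]]
    by (simp add: o_def)
  ultimately show ?thesis unfolding payoff_def[abs_def] by (rule linear_compose_add)
qed

lemma lip_on_payoff:
  fixes K :: "(('m, 'p, 't::{finite,linorder}) gain \<times> ('n, 'p, 't) cov) set"
  assumes K: "compact K"
  shows "lip_on K (\<lambda>z. payoff P (fst z) (snd z))"
proof -
  have f: "lip_on K fst" "lip_on K snd"
    unfolding lip_on_def by (rule exI[of _ 1], rule lipschitz_onI, auto simp: dist_fst_le dist_snd_le)+
  show ?thesis
    unfolding payoff_def F1_def F2_def
    by (intro lip_on_add lip_on_linear[OF linear_trace] lip_on_linear[OF linear_transpose]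
        lip_on_linear[OF linear_upper_block] lip_on_linear[OF linear_lower_block]
        lip_on_matrix_mult[OF K] lip_on_const f)
qed

context
  assumes Q: "psd (Qmat P)" "psd (QTmat P)" and R: "pd (Rmat P)"
begin

lemma psd_stackQ: "psd (stackQ P)"
  unfolding stackQ_def by (rule psd_block_diag) (use Q in auto)

lemma pd_stackR: "pd (stackR P)"
  unfolding stackR_def by (rule pd_block_diag) (rule R)

lemma convex_on_payoff:
  fixes \<Sigma> :: "('n, 'p, 't::{finite,linorder}) cov"
  assumes "psd (upper_block \<Sigma>)" "psd (lower_block \<Sigma>)"
  shows "convex_on UNIV (\<lambda>U. payoff P U \<Sigma>)"
  unfolding payoff_eq
proof (intro convex_on_add convex_on_qform_affine assms psd_stackQ pd_imp_psd[OF pd_stackR])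
  show "stackH P ** ((1 - u) *\<^sub>R U + u *\<^sub>R U') ** stackD P + stackG P
      = (1 - u) *\<^sub>R (stackH P ** U ** stackD P + stackG P) + u *\<^sub>R (stackH P ** U' ** stackD P + stackG P)"
    for u and U U' :: "('m, 'p, 't) gain"
    by (simp add: matrix_linear_simps algebra_simps)
qed (simp_all add: matrix_linear_simps)

text \<open>
  The term \<open>trace (U\<^sup>T R U V)\<close> alone is coercive: it is quadratic in \<open>U\<close> and positive on the unit
  sphere, hence bounded below there by a positive constant.
\<close>
lemma payoff_coercive:
  fixes \<Sigma> :: "('n, 'p, 't::{finite,linorder}) cov"
  assumes W: "psd (upper_block \<Sigma>)" and V: "pd (lower_block \<Sigma>)"
  obtains c where "c > 0" "\<And>U :: ('m, 'p, 't) gain. c * (norm U)\<^sup>2 \<le> payoff P U \<Sigma>"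
proof -
  let ?q = "qform (stackR P) (lower_block \<Sigma>) :: ('m, 'p, 't) gain \<Rightarrow> real"
  have ge: "?q U \<le> payoff P U \<Sigma>" for U
  proof -
    have "0 \<le> qform (stackR P) (upper_block \<Sigma>) (U ** stackD P)"
      "0 \<le> qform (stackQ P) (upper_block \<Sigma>) (stackH P ** U ** stackD P + stackG P)"
      "0 \<le> qform (stackQ P) (lower_block \<Sigma>) (stackH P ** U)"
      by (intro qform_nonneg psd_stackQ pd_imp_psd[OF pd_stackR] W pd_imp_psd[OF V])+
    then show ?thesis unfolding payoff_eq by simp
  qed
  have cont: "continuous_on (sphere 0 1) ?q"
  proof -
    have id: "lip_on (sphere 0 1) (\<lambda>U. U :: ('m, 'p, 't) gain)"
      unfolding lip_on_def using lipschitz_on_id by blast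
    have "lip_on (sphere 0 1) ?q"
      unfolding qform_def[abs_def]
      by (intro lip_on_linear[OF linear_trace] lip_on_linear[OF linear_transpose]
          lip_on_matrix_mult[OF compact_sphere] lip_on_const id)
    then show ?thesis unfolding lip_on_def using lipschitz_on_continuous_on by blast
  qed
  have "sphere 0 1 \<noteq> ({} :: ('m, 'p, 't) gain set)" by simp
  then obtain U0 where U0: "U0 \<in> sphere 0 1" "\<And>U. U \<in> sphere 0 1 \<Longrightarrow> ?q U0 \<le> ?q U"
    using continuous_attains_inf[OF compact_sphere _ cont] by blast
  have "?q U0 * (norm U)\<^sup>2 \<le> ?q U" for U
  proof (cases "U = 0")
    case False
    have "?q U = ?q (norm U *\<^sub>R sgn U)" using False by (simp add: sgn_div_norm)
    also have "\<dots> = (norm U)\<^sup>2 * ?q (sgn U)" by (rule qform_scale)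
    also have "\<dots> \<ge> (norm U)\<^sup>2 * ?q U0" using U0(2)[of "sgn U"] False by (intro mult_left_mono) (auto simp: norm_sgn)
    finally show ?thesis by (simp add: mult.commute)
  qed (simp add: qform_nonneg[OF pd_imp_psd[OF pd_stackR] pd_imp_psd[OF V]])
  moreover have "0 < ?q U0" using U0(1) by (intro qform_pos pd_stackR V) auto
  ultimately show ?thesis using that[of "?q U0"] ge order_trans by blast
qed

text \<open>
  Outside the ball of radius \<open>r\<close> coercivity makes the payoff at least its value at the zero gain,
  so the minimum over the ball is a minimum over all causal gains.
\<close>
lemma payoff_attains_min:
  fixes \<Sigma> :: "('n, 'p, 't::{finite,linorder}) cov"
  assumes W: "psd (upper_block \<Sigma>)" and V: "pd (lower_block \<Sigma>)"
  obtains U :: "('m, 'p, 't) gain" where "U \<in> causal_gains" "\<And>U'. U' \<in> causal_gains \<Longrightarrow> payoff P U \<Sigma> \<le> payoff P U' \<Sigma>"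
proof -
  obtain c where c: "c > 0" "\<And>U :: ('m, 'p, 't) gain. c * (norm U)\<^sup>2 \<le> payoff P U \<Sigma>"
    using payoff_coercive[OF assms] by blast
  have sub: "subspace (causal_gains :: ('m, 'p, 't) gain set)" by (auto simp: subspace_def causal_gains_def)
  define f0 where "f0 = payoff P (0 :: ('m, 'p, 't) gain) \<Sigma>"
  have f0: "0 \<le> f0" using c(2)[of 0] by (simp add: f0_def)
  define r where "r = sqrt (f0 / c) + 1"
  have r: "r > 0" using f0 c by (simp add: r_def add_nonneg_pos)
  define K where "K = (causal_gains :: ('m, 'p, 't) gain set) \<inter> cball 0 r"
  have K: "compact K" "0 \<in> K"
    using closed_Int_compact[OF closed_subspace[OF sub] compact_cball] r subspace_0[OF sub] by (auto simp: K_def)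
  have "continuous_on K (\<lambda>U. payoff P U \<Sigma>)"
  proof -
    obtain L where L: "L-lipschitz_on (K \<times> {\<Sigma>}) (\<lambda>z. payoff P (fst z) (snd z))"
      using lip_on_payoff[OF compact_Times[OF K(1)], of "{\<Sigma>}"] by (auto simp: lip_on_def)
    have "continuous_on K (\<lambda>U. (\<lambda>z. payoff P (fst z) (snd z)) (U, \<Sigma>))"
      by (rule continuous_on_compose2[OF lipschitz_on_continuous_on[OF L]]) (auto intro!: continuous_intros)
    then show ?thesis by simp
  qed
  then obtain U where U: "U \<in> K" "\<And>U'. U' \<in> K \<Longrightarrow> payoff P U \<Sigma> \<le> payoff P U' \<Sigma>"
    using continuous_attains_inf[OF K(1)] K(2) by blast
  have "payoff P U \<Sigma> \<le> payoff P U' \<Sigma>" if U': "U' \<in> causal_gains" for U'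
  proof (cases "U' \<in> K")
    case False
    then have "r < norm U'" using U' by (simp add: K_def)
    then have "sqrt (f0 / c) < norm U'" by (simp add: r_def)
    then have "(sqrt (f0 / c))\<^sup>2 \<le> (norm U')\<^sup>2" using f0 c by (intro power_mono) auto
    then have "f0 / c \<le> (norm U')\<^sup>2" using f0 c by simp
    then have "f0 \<le> c * (norm U')\<^sup>2" using c(1) by (simp add: field_simps)
    then show ?thesis using c(2)[of U'] U(2)[OF K(2)] by (simp add: f0_def)
  qed (use U in blast)
  then show ?thesis using that U(1) by (auto simp: K_def)
qed

end
end

section \<open>Best response dynamics of the control game\<close>

lemma worst_cost_attained:
  fixes P :: "('n::finite, 'm::finite, 'p::finite) lqg" and U :: "('m, 'p, 't::{finite,linorder}) gain"
  assumes "compact (kl_ball P :: ('n, 'p, 't) cov set)" "(kl_ball P :: ('n, 'p, 't) cov set) \<noteq> {}"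
  obtains \<Sigma> where "\<Sigma> \<in> kl_ball P" "payoff P U \<Sigma> = worst_cost P U"
    "\<forall>\<Sigma>'\<in>kl_ball P. payoff P U \<Sigma>' \<le> worst_cost P U"
proof -
  have "continuous_on (kl_ball P) (payoff P U)"
    by (intro linear_continuous_on linear_conv_bounded_linear[THEN iffD1] linear_payoff)
  then obtain \<Sigma> where S: "\<Sigma> \<in> kl_ball P" "\<And>\<Sigma>'. \<Sigma>' \<in> kl_ball P \<Longrightarrow> payoff P U \<Sigma>' \<le> payoff P U \<Sigma>"
    using continuous_attains_sup[OF assms] by blast
  have "worst_cost P U = payoff P U \<Sigma>"
    unfolding worst_cost_def using S by (intro Greatest_equality) auto
  then show ?thesis using that S by auto
qed

lemma best_cost_eq: "U \<in> BR1 P \<Sigma> \<Longrightarrow> best_cost P \<Sigma> = payoff P U \<Sigma>"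
  unfolding best_cost_def BR1_def by (intro Least_equality) (auto simp: is_arg_min_linorder)

text \<open>
  The hypothesis on \<open>S\<close> makes the best replies of the game on \<open>S \<times> kl_ball P\<close> agree with \<open>BR1\<close> and
  \<open>BR2\<close>, so its solutions, gap and saddle points are those of the control problem. A saddle point
  gives the value over all causal gains, since \<open>worst_cost P U \<ge> payoff P U \<Sigma>s \<ge> payoff P Us \<Sigma>s\<close>.
\<close>
theorem theorem7:
  fixes P :: "('n::finite, 'm::finite, 'p::finite) lqg"
    and S :: "('m, 'p, 't::{finite,linorder}) gain set"
  assumes "psd (Qmat P)" and "psd (QTmat P)" and "pd (Rmat P)"
    and "\<forall>t\<le>CARD('t). pd (What P t) \<and> 0 \<le> rho_w P t"
    and "\<forall>t<CARD('t). pd (Vhat P t) \<and> 0 \<le> rho_v P t"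
    and "S \<subseteq> causal_gains" and "compact S" and "convex S"
    and "\<forall>\<Sigma>\<in>kl_ball P. BR1 P \<Sigma> = {U. is_arg_min (\<lambda>U. payoff P U \<Sigma>) (\<lambda>U. U \<in> S) U}"
  shows
    "(\<forall>U0\<in>S. \<forall>\<Sigma>0\<in>kl_ball P. \<exists>U \<Sigma>. br_solution P S U \<Sigma> \<and> U 0 = U0 \<and> \<Sigma> 0 = \<Sigma>0) \<and>
     (\<forall>U \<Sigma>. br_solution P S U \<Sigma> \<longrightarrow>
       (let v = (\<lambda>l. duality_gap P (U l) (\<Sigma> l)) in
         (\<forall>l\<ge>0. 0 \<le> v l \<and> (v l = 0 \<longleftrightarrow> (U l, \<Sigma> l) \<in> saddle_points P)) \<and>
         abs_cont_halfline v \<and> antimono_on {0..} v \<and>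
         (AE l in lborel. 0 \<le> l \<longrightarrow>
            (\<exists>v'. (v has_real_derivative v') (at l within {0..}) \<and> v' \<le> - v l)) \<and>
         (\<forall>l\<ge>0. v l \<le> exp (- l) * v 0))) \<and>
     (\<exists>(Us :: ('m, 'p, 't) gain) (\<Sigma>s :: ('n, 'p, 't) cov).
        is_arg_min (worst_cost P) (\<lambda>U. U \<in> causal_gains) Us \<and>
        is_arg_max (best_cost P) (\<lambda>\<Sigma>. \<Sigma> \<in> kl_ball P) \<Sigma>s \<and>
        best_cost P \<Sigma>s = worst_cost P Us) \<and>
     (saddle_points P :: (('m, 'p, 't) gain \<times> ('n, 'p, 't) cov) set) \<noteq> {} \<and>
     (\<forall>U \<Sigma>. br_solution P S U \<Sigma> \<longrightarrow>
        ((\<lambda>l. infdist (U l, \<Sigma> l) (saddle_points P)) \<longlongrightarrow> 0) at_top) \<and>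
     (\<forall>\<epsilon>>0. \<exists>\<Lambda>\<ge>0. \<forall>U \<Sigma>. br_solution P S U \<Sigma> \<longrightarrow>
        (\<forall>l\<ge>\<Lambda>. infdist (U l, \<Sigma> l) (saddle_points P) < \<epsilon>))"
proof -
  let ?G = "kl_ball P :: ('n, 'p, 't) cov set"
  note W = assms(4)[rule_format] and V = assms(5)[rule_format]
  have G: "compact ?G" "convex ?G" "?G \<noteq> {}"
    by (rule kl_ball_compact kl_ball_convex kl_ball_nonempty; use W V in blast)+
  have blocks: "pd (upper_block \<Sigma>)" "pd (lower_block \<Sigma>)" if "\<Sigma> \<in> ?G" for \<Sigma>
    using kl_ball_upper_pd[OF that] kl_ball_lower_pd[OF that] .
  have BR1_S: "U \<in> BR1 P \<Sigma> \<longleftrightarrow> U \<in> S \<and> (\<forall>U'\<in>S. payoff P U \<Sigma> \<le> payoff P U' \<Sigma>)" if "\<Sigma> \<in> ?G" for U \<Sigma>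
    using assms(9) that by (auto simp: is_arg_min_linorder)
  have BR1_causal: "U \<in> BR1 P \<Sigma> \<longleftrightarrow> U \<in> causal_gains \<and> (\<forall>U'\<in>causal_gains. payoff P U \<Sigma> \<le> payoff P U' \<Sigma>)"
    for U :: "('m, 'p, 't) gain" and \<Sigma> :: "('n, 'p, 't) cov"
    by (auto simp: BR1_def is_arg_min_linorder)
  have S_ne: "S \<noteq> {}"
  proof -
    obtain \<Sigma> where \<Sigma>: "\<Sigma> \<in> ?G" using G(3) by blast
    obtain U :: "('m, 'p, 't) gain" where "U \<in> causal_gains"
      "\<And>U'. U' \<in> causal_gains \<Longrightarrow> payoff P U \<Sigma> \<le> payoff P U' \<Sigma>"
      using payoff_attains_min[OF assms(1-3) pd_imp_psd[OF blocks(1)[OF \<Sigma>]] blocks(2)[OF \<Sigma>]] by metis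
    then have "U \<in> BR1 P \<Sigma>" by (simp add: BR1_causal)
    then show ?thesis using BR1_S[OF \<Sigma>] by blast
  qed
  obtain L where L: "L-lipschitz_on (S \<times> ?G) (\<lambda>z. payoff P (fst z) (snd z))"
    using lip_on_payoff[OF compact_Times[OF assms(7) G(1)]] by (auto simp: lip_on_def)
  interpret game: convex_concave_game S ?G "payoff P" L
  proof
    show "convex_on S (\<lambda>U. payoff P U \<Sigma>)" if "\<Sigma> \<in> ?G" for \<Sigma>
      by (rule convex_on_subset[OF convex_on_payoff[OF assms(1-3)]])
         (use blocks[OF that] assms(8) in \<open>auto intro: pd_imp_psd\<close>)
    show "convex_on ?G (\<lambda>\<Sigma>. - payoff P U \<Sigma>)" for U
      using G(2) by (intro convex_onI) (simp_all add: linear_add[OF linear_payoff] linear_scale[OF linear_payoff])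
  qed (use assms(7,8) S_ne G L in auto)
  have upper: "game.upper U = worst_cost P U" for U
  proof -
    obtain \<Sigma> where \<Sigma>: "\<Sigma> \<in> ?G" "payoff P U \<Sigma> = worst_cost P U" "\<forall>\<Sigma>'\<in>?G. payoff P U \<Sigma>' \<le> worst_cost P U"
      by (rule worst_cost_attained[OF G(1,3)])
    show ?thesis
      unfolding max_payoff_def
    proof (rule cSup_eq_maximum)
      show "worst_cost P U \<in> payoff P U ` ?G" using \<Sigma>(2) by (rule image_eqI[OF sym \<Sigma>(1)])
    qed (use \<Sigma>(3) in auto)
  qed
  have min_reply: "game.min_reply \<Sigma> = BR1 P \<Sigma>" if "\<Sigma> \<in> ?G" for \<Sigma>
    using BR1_S[OF that] by (auto simp: game.min_reply_def)
  have max_reply: "game.max_reply U = BR2 P U" for U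
    by (auto simp: game.max_reply_def BR2_def is_arg_max_linorder)
  have lower: "game.lower \<Sigma> = best_cost P \<Sigma>" if \<Sigma>: "\<Sigma> \<in> ?G" for \<Sigma>
  proof -
    obtain U where U: "U \<in> S" "payoff P U \<Sigma> = game.lower \<Sigma>" "\<And>U'. U' \<in> S \<Longrightarrow> game.lower \<Sigma> \<le> payoff P U' \<Sigma>"
      using game.lower_attained[OF \<Sigma>] by metis
    then have "U \<in> BR1 P \<Sigma>" using BR1_S[OF \<Sigma>] by auto
    then show ?thesis using best_cost_eq U(2) by metis
  qed
  have gap: "duality_gap P U \<Sigma> = game.gap U \<Sigma>" if "\<Sigma> \<in> ?G" for U \<Sigma>
    by (simp add: duality_gap_def game.gap_def upper lower[OF that])
  have saddles: "saddle_points P = game.saddles"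
  proof -
    have "(U, \<Sigma>) \<in> saddle_points P \<longleftrightarrow> (U, \<Sigma>) \<in> game.saddles" for U \<Sigma>
    proof (cases "\<Sigma> \<in> ?G")
      case True
      then show ?thesis
        by (auto simp: saddle_points_def game.saddles_def min_reply BR1_causal game.max_reply_def)
    qed (auto simp: saddle_points_def game.saddles_def game.max_reply_def)
    then show ?thesis by auto
  qed
  have sol: "br_solution P S U \<Sigma> \<longleftrightarrow> game.br_curve U \<Sigma>" for U \<Sigma>
  proof (cases "\<forall>l\<ge>0. U l \<in> S \<and> \<Sigma> l \<in> ?G")
    case True
    then have "l \<ge> 0 \<Longrightarrow> game.min_reply (\<Sigma> l) = BR1 P (\<Sigma> l)" for l using min_reply by blast
    then show ?thesis unfolding br_solution_def game.br_curve_def max_reply by (simp cong: imp_cong)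
  qed (auto simp: br_solution_def game.br_curve_def)
  have lyapunov: "let v = (\<lambda>l. duality_gap P (U l) (\<Sigma> l)) in
         (\<forall>l\<ge>0. 0 \<le> v l \<and> (v l = 0 \<longleftrightarrow> (U l, \<Sigma> l) \<in> saddle_points P)) \<and>
         abs_cont_halfline v \<and> antimono_on {0..} v \<and>
         (AE l in lborel. 0 \<le> l \<longrightarrow>
            (\<exists>v'. (v has_real_derivative v') (at l within {0..}) \<and> v' \<le> - v l)) \<and>
         (\<forall>l\<ge>0. v l \<le> exp (- l) * v 0)"
    if c: "game.br_curve U \<Sigma>" for U \<Sigma>
  proof -
    define v where "v = (\<lambda>l. duality_gap P (U l) (\<Sigma> l))"
    define w where "w = (\<lambda>l. game.gap (U l) (\<Sigma> l))"
    have inSG: "U l \<in> S" "\<Sigma> l \<in> ?G" if "0 \<le> l" for l using c that by (auto simp: game.br_curve_def)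
    have vw: "w l = v l" if "0 \<le> l" for l using gap[OF inSG(2)[OF that]] by (simp add: v_def w_def)
    have lyap: "abs_cont_halfline w"
      "AE l in lborel. 0 \<le> l \<longrightarrow> (\<exists>v'. (w has_real_derivative v') (at l within {0..}) \<and> v' \<le> - w l)"
      "\<And>s t. 0 \<le> s \<Longrightarrow> s \<le> t \<Longrightarrow> w t \<le> exp (s - t) * w s"
      unfolding w_def
      by (rule game.gap_lyapunov(1)[OF c], rule game.gap_lyapunov(2)[OF c], rule game.gap_lyapunov(3)[OF c])
    have decay: "v t \<le> exp (s - t) * v s" if "0 \<le> s" "s \<le> t" for s t
      using lyap(3)[OF that] vw[of s] vw[of t] that by simp
    have nonneg: "0 \<le> v l" if "0 \<le> l" for l
      using game.gap_nonneg[OF inSG[OF that]] vw[OF that] by (simp add: w_def)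
    have "v l = 0 \<longleftrightarrow> (U l, \<Sigma> l) \<in> saddle_points P" if "0 \<le> l" for l
      using game.gap_zero_iff[OF inSG[OF that]] vw[OF that] by (simp add: w_def saddles)
    moreover have "abs_cont_halfline v" using abs_cont_halfline_cong[OF lyap(1) vw] .
    moreover have "antimono_on {0..} v"
    proof (rule monotone_onI)
      fix s t :: real assume st: "s \<in> {0..}" "t \<in> {0..}" "s \<le> t"
      then have "v t \<le> exp (s - t) * v s" by (intro decay) auto
      also have "\<dots> \<le> 1 * v s" using st nonneg[of s] by (intro mult_right_mono) auto
      finally show "v t \<le> v s" by simp
    qed
    moreover have "AE l in lborel. 0 \<le> l \<longrightarrow> (\<exists>v'. (v has_real_derivative v') (at l within {0..}) \<and> v' \<le> - v l)"
      using lyap(2)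
    proof eventually_elim
      case (elim l)
      show ?case
      proof
        assume l: "0 \<le> l"
        then obtain v' where v': "(w has_real_derivative v') (at l within {0..})" "v' \<le> - w l" using elim by blast
        have "(v has_real_derivative v') (at l within {0..})"
          by (rule has_field_derivative_transform_within[OF v'(1), where d=1]) (use l vw in auto)
        then show "\<exists>v'. (v has_real_derivative v') (at l within {0..}) \<and> v' \<le> - v l"
          using v'(2) vw[OF l] by auto
      qed
    qed
    moreover have "\<forall>l\<ge>0. v l \<le> exp (- l) * v 0" using decay[of 0] by simp
    ultimately show ?thesis unfolding Let_def v_def[symmetric] using nonneg by blast
  qed
  obtain Us :: "('m, 'p, 't) gain" and \<Sigma>s :: "('n, 'p, 't) cov" where sad: "(Us, \<Sigma>s) \<in> saddle_points P"
    using game.saddles_nonempty unfolding saddles by auto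
  have \<Sigma>s: "\<Sigma>s \<in> ?G" and Us: "Us \<in> causal_gains" using sad by (auto simp: saddle_points_def)
  have wc: "payoff P U \<Sigma> \<le> worst_cost P U" if "\<Sigma> \<in> ?G" for U \<Sigma>
    using worst_cost_attained[OF G(1,3)] that by metis
  have bc: "best_cost P \<Sigma> \<le> payoff P U \<Sigma>" if \<Sigma>: "\<Sigma> \<in> ?G" and U: "U \<in> causal_gains" for U \<Sigma>
  proof -
    obtain U' where U': "U' \<in> BR1 P \<Sigma>" using game.min_reply_nonempty[OF \<Sigma>] min_reply[OF \<Sigma>] by blast
    then show ?thesis using best_cost_eq[OF U'] BR1_causal U by auto
  qed
  have w: "worst_cost P Us = payoff P Us \<Sigma>s"
  proof -
    obtain \<Sigma> where "\<Sigma> \<in> ?G" "payoff P Us \<Sigma> = worst_cost P Us" by (rule worst_cost_attained[OF G(1,3)])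
    then show ?thesis using sad wc[OF \<Sigma>s, of Us] by (auto simp: saddle_points_def intro: order_antisym)
  qed
  have b: "best_cost P \<Sigma>s = payoff P Us \<Sigma>s"
    by (rule best_cost_eq) (use sad in \<open>auto simp: saddle_points_def BR1_causal\<close>)
  have "is_arg_min (worst_cost P) (\<lambda>U. U \<in> causal_gains) Us"
    unfolding is_arg_min_linorder
  proof (intro conjI allI impI Us)
    fix U :: "('m, 'p, 't) gain" assume "U \<in> causal_gains"
    then have "payoff P Us \<Sigma>s \<le> payoff P U \<Sigma>s" using sad by (auto simp: saddle_points_def)
    then show "worst_cost P Us \<le> worst_cost P U" using wc[OF \<Sigma>s, of U] w by simp
  qed
  moreover have "is_arg_max (best_cost P) (\<lambda>\<Sigma>. \<Sigma> \<in> ?G) \<Sigma>s"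
    unfolding is_arg_max_linorder
  proof (intro conjI allI impI \<Sigma>s)
    fix \<Sigma> assume "\<Sigma> \<in> ?G"
    then have "payoff P Us \<Sigma> \<le> payoff P Us \<Sigma>s" "best_cost P \<Sigma> \<le> payoff P Us \<Sigma>"
      using sad bc Us by (auto simp: saddle_points_def)
    then show "best_cost P \<Sigma> \<le> best_cost P \<Sigma>s" using b by simp
  qed
  ultimately have minimax: "\<exists>(Us :: ('m, 'p, 't) gain) (\<Sigma>s :: ('n, 'p, 't) cov).
        is_arg_min (worst_cost P) (\<lambda>U. U \<in> causal_gains) Us \<and>
        is_arg_max (best_cost P) (\<lambda>\<Sigma>. \<Sigma> \<in> kl_ball P) \<Sigma>s \<and>
        best_cost P \<Sigma>s = worst_cost P Us"
    using w b by (intro exI[of _ Us] exI[of _ \<Sigma>s]) simp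
  have attr: "\<exists>\<Lambda>\<ge>0. \<forall>U \<Sigma>. game.br_curve U \<Sigma> \<longrightarrow> (\<forall>l\<ge>\<Lambda>. infdist (U l, \<Sigma> l) game.saddles < \<epsilon>)" if "\<epsilon> > 0" for \<epsilon>
    using game.saddles_uniform_attractor[OF that] by metis
  have conv: "((\<lambda>l. infdist (U l, \<Sigma> l) game.saddles) \<longlongrightarrow> 0) at_top" if c: "game.br_curve U \<Sigma>" for U \<Sigma>
  proof (rule tendstoI)
    fix \<epsilon> :: real assume "0 < \<epsilon>"
    then obtain \<Lambda> where "\<forall>l\<ge>\<Lambda>. infdist (U l, \<Sigma> l) game.saddles < \<epsilon>" using attr c by blast
    then show "eventually (\<lambda>l. dist (infdist (U l, \<Sigma> l) game.saddles) 0 < \<epsilon>) at_top"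
      unfolding eventually_at_top_linorder by (auto simp: infdist_nonneg)
  qed
  have ex: "\<exists>U \<Sigma>. game.br_curve U \<Sigma> \<and> U 0 = U0 \<and> \<Sigma> 0 = \<Sigma>0" if "U0 \<in> S" "\<Sigma>0 \<in> ?G" for U0 \<Sigma>0
    using game.br_curve_exists[OF that] by metis
  show ?thesis
    unfolding sol saddles
    using ex lyapunov[unfolded saddles] minimax game.saddles_nonempty conv attr by blast
qed

end
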